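(* Let $g:\mathbb{D}\to\mathbb{C}\setminus(-\infty,0]$ be $g(z)=\log\bigl(\frac{e}{1-z}\bigr)$. Then: (a) $g\in BMOA$, but for any $\alpha\ge-1$ and $p>0$, $S_gT_g^2\notin\mathcal{B}(A^p_\alpha)$. (b) For $\frac12<\beta<\frac23$, $g^{2\beta}\notin\mathscr{B}$ (and so $g^{2\beta}\notin BMOA$), but $S_{g^\beta}T_{g^\beta}^2$ is a compact operator on $A^p_\alpha$ for every $\alpha\ge-1$ and $p>0$.
   Context: $\log$ is the principal branch of the logarithm on $\mathbb{C}\setminus(-\infty,0]$; for an analytic $h$ with values in $\mathbb{C}\setminus(-\infty,0]$ and $\beta\in\mathbb{C}$, $h^\beta=\exp(\beta\log h)$. $\mathbb{D}$ is the unit disc, $\mathcal{H}(\mathbb{D})$ analytic functions on it. For $\alpha>-1$, $A^p_\alpha$ is the set of $f\in\mathcal{H}(\mathbb{D})$ with $(\alpha+1)\int_{\mathbb{D}}|f|^p(1-|z|^2)^\alpha\,dA<\infty$; $A^p_{-1}:=H^p$. For analytic $u$: $T_uf(z)=\int_0^z f(\zeta)u'(\zeta)\,d\zeta$, $S_uf(z)=\int_0^z f'(\zeta)u(\zeta)\,d\zeta$. $\mathcal{B}(A^p_\alpha)$ denotes bounded operators on $A^p_\alpha$. $\mathscr{B}$ is the Bloch space ($\sup_z(1-|z|^2)|f'(z)|<\infty$), $BMOA$ the space of $f\in H^2$ with $\sup_{a\in\mathbb{D}}\|f\circ\phi_a-f(a)\|_{H^2}<\infty$, $\phi_a(z)=\frac{a-z}{1-\bar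 az}$. *)

theory Defs
  imports "HOL-Complex_Analysis.Complex_Analysis"
begin

abbreviation disc :: "complex set" where "disc \<equiv> ball 0 1"

definition hardy_pow :: "real \<Rightarrow> (complex \<Rightarrow> complex) \<Rightarrow> ennreal" where
  "hardy_pow p f = (SUP r\<in>{0..<1::real}.
      ennreal (1 / (2*pi)) * (\<integral>\<^sup>+ t. ennreal (norm (f (complex_of_real r * cis t)) powr p)
                                     * indicator {0..2*pi} t \<partial>lborel))"

text \<open>p-th power of the weighted Bergman (quasi)norm, with normalized area measure dA = dx dy / pi.\<close>
definition bergman_pow :: "real \<Rightarrow> real \<Rightarrow> (complex \<Rightarrow> complex) \<Rightarrow> ennreal" where
  "bergman_pow p \<alpha> f = ennreal ((\<alpha> + 1) / pi) *
      (\<integral>\<^sup>+ z. ennreal (norm (f z) powr p * (1 - (cmod z)\<^sup>2) powr \<alpha>) * indicator disc z \<partial>lborel)"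

definition Apa_pow :: "real \<Rightarrow> real \<Rightarrow> (complex \<Rightarrow> complex) \<Rightarrow> ennreal" where
  "Apa_pow p \<alpha> f = (if \<alpha> = -1 then hardy_pow p f else bergman_pow p \<alpha> f)"

definition Apa :: "real \<Rightarrow> real \<Rightarrow> (complex \<Rightarrow> complex) set" where
  "Apa p \<alpha> = {f. f holomorphic_on disc \<and> Apa_pow p \<alpha> f < \<infinity>}"

definition T_op :: "(complex \<Rightarrow> complex) \<Rightarrow> (complex \<Rightarrow> complex) \<Rightarrow> complex \<Rightarrow> complex" where
  "T_op u f z = contour_integral (linepath 0 z) (\<lambda>\<zeta>. f \<zeta> * deriv u \<zeta>)"

definition S_op :: "(complex \<Rightarrow> complex) \<Rightarrow> (complex \<Rightarrow> complex) \<Rightarrow> complex \<Rightarrow> complex" where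
  "S_op u f z = contour_integral (linepath 0 z) (\<lambda>\<zeta>. deriv f \<zeta> * u \<zeta>)"

text \<open>Bounded operator on A^p_alpha (quasi-normed space; stated with p-th powers).\<close>
definition bounded_Apa_op :: "real \<Rightarrow> real \<Rightarrow> ((complex \<Rightarrow> complex) \<Rightarrow> (complex \<Rightarrow> complex)) \<Rightarrow> bool" where
  "bounded_Apa_op p \<alpha> L \<longleftrightarrow> (\<forall>f\<in>Apa p \<alpha>. L f \<in> Apa p \<alpha>) \<and>
     (\<exists>C::real. \<forall>f\<in>Apa p \<alpha>. Apa_pow p \<alpha> (L f) \<le> ennreal C * Apa_pow p \<alpha> f)"

definition compact_Apa_op :: "real \<Rightarrow> real \<Rightarrow> ((complex \<Rightarrow> complex) \<Rightarrow> (complex \<Rightarrow> complex)) \<Rightarrow> bool" where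
  "compact_Apa_op p \<alpha> L \<longleftrightarrow> (\<forall>f\<in>Apa p \<alpha>. L f \<in> Apa p \<alpha>) \<and>
     (\<forall>fs. (\<exists>C::real. \<forall>n::nat. fs n \<in> Apa p \<alpha> \<and> Apa_pow p \<alpha> (fs n) \<le> ennreal C) \<longrightarrow>
        (\<exists>r h. strict_mono r \<and> h \<in> Apa p \<alpha> \<and>
           ((\<lambda>k. Apa_pow p \<alpha> (\<lambda>z. L (fs (r k)) z - h z)) \<longlongrightarrow> 0) sequentially))"

definition bloch :: "(complex \<Rightarrow> complex) set" where
  "bloch = {f. f holomorphic_on disc \<and> (\<exists>C. \<forall>z\<in>disc. (1 - (cmod z)\<^sup>2) * norm (deriv f z) \<le> C)}"

definition mobius :: "complex \<Rightarrow> complex \<Rightarrow> complex" where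
  "mobius a z = (a - z) / (1 - cnj a * z)"

definition BMOA :: "(complex \<Rightarrow> complex) set" where
  "BMOA = {f. f \<in> Apa 2 (-1) \<and>
     (\<exists>C::real. \<forall>a\<in>disc. hardy_pow 2 (\<lambda>z. f (mobius a z) - f a) \<le> ennreal C)}"

definition cpow_fun :: "(complex \<Rightarrow> complex) \<Rightarrow> complex \<Rightarrow> complex \<Rightarrow> complex" where
  "cpow_fun h \<beta> z = exp (\<beta> * Ln (h z))"

definition g_fun :: "complex \<Rightarrow> complex" where
  "g_fun z = Ln (exp 1 / (1 - z))"

end

theory Submission
  imports Defs
begin

text \<open>
  Since \<open>S\<^sub>u T\<^sub>u\<^sup>2 = T\<^sub>v T\<^sub>u\<close> for \<open>v = u\<^sup>2/2\<close>, exchanging the order of integration gives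
  \<open>S\<^sub>u T\<^sub>u\<^sup>2 f(z) = \<integral>\<^bsub>[0,z]\<^esub> (v(z) - v(w)) u'(w) f(w) dw\<close>. For \<open>u = g\<^sup>\<beta>\<close> the kernel at
  \<open>w = (1-s)z\<close> is at most a constant times \<open>(d/\<delta>)\<^sup>\<eta> |g(w)| powr (3\<beta>-2) / d\<close>, where \<open>\<delta> = |1-z|\<close>,
  \<open>d = s + \<delta>\<close> and \<open>\<eta> > 0\<close> is arbitrary; the factor \<open>|g| powr (3\<beta>-2)\<close> is bounded and tends to 0 at the
  point 1, which gives compactness once the remaining positive operator is bounded.

  For that, and for every \<open>p > 0\<close> at once, \<open>|f|\<^sup>p\<close> is majorised by the modulus of an entire function
  with almost the same boundary values, so \<open>|f(w)|\<^sup>p |1-w|\<close> is at most its Poisson integral. The weight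
  \<open>|1-w|\<close> turns this into a pointwise bound for \<open>|f((1-s)z)|\<^sup>p\<close>, with room to spare in the powers of
  \<open>s/d\<close> and \<open>\<delta>/d\<close>, by one kernel integral over the circle through \<open>z\<close> whose kernel
  is integrable. The resulting inequality holds on each circle separately, so it covers Hardy and
  Bergman spaces alike.

  Unboundedness for \<open>u = g\<close>: with \<open>s = -log(1-x)\<close>, the \<open>n\<close>-th iterate applied to the constant 1
  is at least \<open>s powr (3n) / (9\<^sup>n (n!)\<^sup>2)\<close> on the real axis, which at \<open>s = n\<close> outgrows
  \<open>C\<^sup>n\<close> times the pointwise growth allowed in the space.
\<close>

section \<open>Holomorphic majorants and the Poisson inequality\<close>

text \<open>Integrating 1/d over s already costs log(1/\<delta>), so bounding f along the radius is
  not enough: f must gain a power of \<delta>/d. The weight |1-w| supplies it: |f((1-s)z)| powr p is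
  at most N (d/s)^\<mu> (\<delta>/d)^(1-\<mu>), with N controlled by the kernel integral. With
  \<eta> = (1-\<mu>)/(2p) the p-th root gains (\<delta>/d)^(2\<eta>); one half pays for
  (d/\<delta>)^\<eta>, the other makes ds/d integrable uniformly in \<delta>. The loss
  (d/s)^(\<mu>/p) is integrable at s = 0 as \<mu>/p \<le> 1/2. Allowing this loss replaces a maximal
  function by an integral operator bounded on L^1, which is where |f| powr p lives.

  The exponent 3\<beta>-2 is (2\<beta>-1) + (\<beta>-1), from the difference of v and from u'. For
  compactness |g| powr (3\<beta>-2) \<le> e + K|1-w|. The e part is a small multiple of the norm; in
  the other part |1-w| \<le> d cancels 1/d, small s contribute little, and the remaining s see f
  only on a compact disc. The p-th power of the norm of the image is thus at most \<epsilon> times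
  that of f plus a constant times sup |f| powr p over a smaller disc, and Montel's theorem
  applies.\<close>

inductive trig_poly :: "(complex \<Rightarrow> real) \<Rightarrow> bool" where
  monom: "trig_poly (\<lambda>z. Re (a * z ^ n))"
| add: "trig_poly f \<Longrightarrow> trig_poly h \<Longrightarrow> trig_poly (\<lambda>z. f z + h z)"

text \<open>Each \<open>trig_poly\<close> is visibly the real part of an entire function. Products
  keep that form only on the unit circle, where z * cnj z = 1, so closure under multiplication is
  stated for agreement on the circle.\<close>

definition circle_trig :: "(complex \<Rightarrow> real) \<Rightarrow> bool" where
  "circle_trig f \<longleftrightarrow> (\<exists>h. trig_poly h \<and> (\<forall>z. norm z = 1 \<longrightarrow> f z = h z))"

lemma trig_poly_holomorphic:
  assumes "trig_poly f"
  shows "\<exists>H. H holomorphic_on UNIV \<and> (\<forall>z. f z = Re (H z))"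
  using assms
proof induction
  case (monom a n)
  show ?case by (rule exI[of _ "\<lambda>z. a * z ^ n"]) (auto intro!: holomorphic_intros)
next
  case (add f h)
  then obtain F H where "F holomorphic_on UNIV" "\<forall>z. f z = Re (F z)"
    "H holomorphic_on UNIV" "\<forall>z. h z = Re (H z)" by blast
  then show ?case by (intro exI[of _ "\<lambda>z. F z + H z"]) (auto intro!: holomorphic_intros)
qed

lemma circle_trig_add: "circle_trig f \<Longrightarrow> circle_trig h \<Longrightarrow> circle_trig (\<lambda>z. f z + h z)"
  unfolding circle_trig_def using trig_poly.add by metis

lemma circle_trig_monom: "circle_trig (\<lambda>z. Re (a * z ^ n))"
  unfolding circle_trig_def using trig_poly.monom by blast

lemma circle_trig_cong:
  assumes "circle_trig f" "\<And>z. norm z = 1 \<Longrightarrow> h z = f z"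
  shows "circle_trig h"
  using assms unfolding circle_trig_def by metis

text \<open>Re x * Re y = Re (x y)/2 + Re (x cnj y)/2, and on the circle z^m * cnj (z^n) = z^(m-n).
  The order m \<ge> n keeps this exponent natural; the other order follows by symmetry.\<close>

lemma circle_trig_mult_monom_aux:
  assumes "m \<ge> n"
  shows "circle_trig (\<lambda>z. Re (a * z ^ m) * Re (b * z ^ n))"
proof (rule circle_trig_cong[OF circle_trig_add[OF circle_trig_monom[of "a * b / 2" "m + n"]
      circle_trig_monom[of "a * cnj b / 2" "m - n"]]])
  fix z :: complex assume z: "norm z = 1"
  have "z * cnj z = 1" using z by (simp add: complex_norm_square[symmetric] flip: of_real_power)
  then have "z ^ n * cnj z ^ n = 1" by (metis power_mult_distrib power_one)
  then have "z ^ m * cnj (z ^ n) = z ^ (m - n)"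
    using assms by (metis complex_cnj_power le_add_diff_inverse2 mult.assoc mult.right_neutral power_add)
  then have e: "a * cnj b / 2 * z ^ (m - n) = (a * z ^ m) * cnj (b * z ^ n) / 2"
    by (simp add: algebra_simps)
  have "Re x * Re y = Re (x * y / 2) + Re (x * cnj y / 2)" for x y
    by (simp add: field_simps)
  from this[of "a * z ^ m" "b * z ^ n"]
  show "Re (a * z ^ m) * Re (b * z ^ n) = Re (a * b / 2 * z ^ (m + n)) + Re (a * cnj b / 2 * z ^ (m - n))"
    unfolding e by (simp add: power_add algebra_simps)
qed

lemma circle_trig_mult_monom: "circle_trig (\<lambda>z. Re (a * z ^ m) * Re (b * z ^ n))"
proof (cases "m \<ge> n")
  case True then show ?thesis by (rule circle_trig_mult_monom_aux)
next
  case False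
  then show ?thesis using circle_trig_mult_monom_aux[of m n b a] by (simp add: mult.commute)
qed

lemma circle_trig_mult:
  assumes "circle_trig f" "circle_trig h"
  shows "circle_trig (\<lambda>z. f z * h z)"
proof -
  have 1: "circle_trig (\<lambda>z. Re (a * z ^ m) * h z)" if "trig_poly h" for a m h
    using that
  proof induction
    case (monom b n) show ?case by (rule circle_trig_mult_monom)
  next
    case (add f h) from circle_trig_add[OF add.IH] show ?case by (simp add: algebra_simps)
  qed
  have 2: "circle_trig (\<lambda>z. f z * h z)" if "trig_poly f" "trig_poly h" for f h
    using that
  proof induction
    case (monom b n) then show ?case using 1 by blast
  next
    case (add f1 f2) from circle_trig_add[OF add.IH] add.prems show ?case by (simp add: algebra_simps)
  qed
  show ?thesis using assms 2 unfolding circle_trig_def by (metis (no_types, lifting))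
qed

lemma circle_trig_real_polynomial:
  assumes "real_polynomial_function f"
  shows "circle_trig f"
  using assms
proof induction
  case (linear f)
  interpret bounded_linear f by fact
  \<comment> \<open>A real linear functional on the plane is z -> Re (c z), here with c = f 1 - \<i>
    * f \<i>.\<close>
  have "f z = Re (Complex (f 1) (- f \<i>) * z ^ 1)" for z
  proof -
    have "z = Re z *\<^sub>R 1 + Im z *\<^sub>R \<i>" by (simp add: complex_eq_iff)
    then have "f z = Re z *\<^sub>R f 1 + Im z *\<^sub>R f \<i>" by (metis add scaleR)
    then show ?thesis by (simp add: algebra_simps)
  qed
  then show ?case by (intro circle_trig_cong[OF circle_trig_monom[of "Complex (f 1) (- f \<i>)" 1]])
next
  case (const c)
  show ?case using circle_trig_monom[of "of_real c" 0] by simp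
next
  case (add f g)
  show ?case by (rule circle_trig_add[OF add.IH])
next
  case (mult f g)
  show ?case by (rule circle_trig_mult[OF mult.IH])
qed

text \<open>An approximate Dirichlet problem, solved by Stone-Weierstrass. Approximation is enough,
  because the majorant built from H may exceed its target by e.\<close>

lemma circle_approx_Re_holomorphic:
  fixes u :: "complex \<Rightarrow> real"
  assumes "continuous_on (sphere 0 1) u" "e > 0"
  obtains H where "H holomorphic_on UNIV" "\<And>z. norm z = 1 \<Longrightarrow> \<bar>u z - Re (H z)\<bar> < e"
proof -
  obtain q where q: "real_polynomial_function q" "\<And>z. z \<in> sphere 0 1 \<Longrightarrow> \<bar>u z - q z\<bar> < e"
    using Stone_Weierstrass_real_polynomial_function[OF compact_sphere assms] by blast
  from circle_trig_real_polynomial[OF q(1)] obtain h where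
    h: "trig_poly h" "\<And>z. norm z = 1 \<Longrightarrow> q z = h z" unfolding circle_trig_def by blast
  from trig_poly_holomorphic[OF h(1)] obtain H where
    "H holomorphic_on UNIV" "\<And>z. h z = Re (H z)" by blast
  then show ?thesis using that q h by simp
qed

text \<open>If \<phi> has zeros, |\<phi>| powr p need not be the modulus of a holomorphic function.
  G = exp H is zero-free and has the p-th root exp (H/p), so the maximum modulus principle for
  \<phi> * exp (-H/p) carries the bound by |G| from the circle inwards.\<close>

lemma powr_holomorphic_majorant:
  fixes \<phi> :: "complex \<Rightarrow> complex"
  assumes hol: "\<phi> holomorphic_on ball 0 1" and cont: "continuous_on (cball 0 1) \<phi>"
    and p: "p > 0" and e: "e > 0"
  obtains G where "G holomorphic_on UNIV"
    "\<And>z. norm z \<le> 1 \<Longrightarrow> norm (\<phi> z) powr p \<le> norm (G z)"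
    "\<And>z. norm z = 1 \<Longrightarrow> norm (G z) \<le> norm (\<phi> z) powr p + e"
proof -
  have cs: "continuous_on (sphere 0 1) \<phi>"
    using cont by (rule continuous_on_subset) auto
  have cp: "continuous_on (sphere 0 1) (\<lambda>z. norm (\<phi> z) powr p)"
    using p by (intro continuous_intros cs continuous_on_powr') auto
  obtain B where B: "\<And>z. norm z = 1 \<Longrightarrow> norm (\<phi> z) powr p \<le> B"
  proof -
    have "compact ((\<lambda>z. norm (\<phi> z) powr p) ` sphere 0 1)"
      by (rule compact_continuous_image[OF cp]) auto
    then obtain B where "\<forall>x\<in>((\<lambda>z. norm (\<phi> z) powr p) ` sphere 0 1). norm x \<le> B"
      using compact_imp_bounded bounded_iff by metis
    then show ?thesis using that[of B] by auto
  qed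
  define b where "b = \<bar>B\<bar> + e"
  have b: "b > 0" using e b_def by simp
  \<comment> \<open>Since exp (2 d) = 1 + (e/2)/b, a relative error of that size on a quantity at
    most b costs at most e/2. The other e/2 keeps the logarithm below finite at zeros of
    \<phi>.\<close>
  define d where "d = ln (1 + (e/2) / b) / 2"
  have "1 + (e/2) / b > 1" using e b by simp
  then have d: "d > 0" unfolding d_def by (simp only: ln_gt_zero zero_less_divide_iff) simp
  have ed: "exp (2 * d) = 1 + (e/2) / b" unfolding d_def using e b by (simp add: add_pos_nonneg)
  \<comment> \<open>Shifting by d before approximating within d keeps Re H above the logarithm and
    at most 2 d away from it.\<close>
  have "continuous_on (sphere 0 1) (\<lambda>z. ln (norm (\<phi> z) powr p + e/2) + d)"
    using e by (intro continuous_intros cp) (auto simp: add_nonneg_pos less_imp_neq[symmetric] intro!: less_imp_neq[symmetric] add_nonneg_pos)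
  from circle_approx_Re_holomorphic[OF this d] obtain H where
    H: "H holomorphic_on UNIV" "\<And>z. norm z = 1 \<Longrightarrow> \<bar>ln (norm (\<phi> z) powr p + e/2) + d - Re (H z)\<bar> < d"
    by blast
  define G where "G z = exp (H z)" for z
  have up: "norm (G z) \<le> norm (\<phi> z) powr p + e" if "norm z = 1" for z
  proof -
    define y where "y = norm (\<phi> z) powr p + e/2"
    have y: "0 < y" "y \<le> b" using e B[OF that] unfolding y_def b_def by (auto intro: add_nonneg_pos)
    have "Re (H z) \<le> ln y + 2 * d" using H(2)[OF that] unfolding y_def by linarith
    then have "norm (G z) \<le> exp (ln y + 2 * d)" unfolding G_def by simp
    also have "\<dots> = y * (1 + (e/2) / b)" using y ed by (simp add: exp_add)
    also have "\<dots> \<le> y + e/2" using y e b by (simp add: field_simps)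
    finally show ?thesis unfolding y_def by simp
  qed
  have low: "norm (\<phi> z) powr p \<le> norm (G z)" if "norm z = 1" for z
  proof -
    define y where "y = norm (\<phi> z) powr p + e/2"
    have y: "0 < y" using e unfolding y_def by (auto intro: add_nonneg_pos)
    have "ln y \<le> Re (H z)" using H(2)[OF that] unfolding y_def by linarith
    then have "y \<le> norm (G z)" unfolding G_def using y by (metis exp_le_cancel_iff exp_ln norm_exp_eq_Re)
    then show ?thesis using e unfolding y_def by simp
  qed
  have low': "norm (\<phi> z) powr p \<le> norm (G z)" if "norm z \<le> 1" for z
  proof -
    define F where "F z = \<phi> z * exp (- H z / p)" for z
    have nF: "norm (F z) powr p = norm (\<phi> z) powr p / norm (G z)" for z
    proof -
      have "norm (exp (- H z / p)) powr p = exp (- Re (H z))"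
        using p by (simp add: powr_def)
      then have "norm (F z) powr p = norm (\<phi> z) powr p * exp (- Re (H z))"
        unfolding F_def by (simp only: norm_mult powr_mult norm_ge_zero)
      then show ?thesis unfolding G_def by (simp add: exp_minus divide_inverse)
    qed
    have "norm (F z) \<le> 1"
    proof (rule maximum_modulus_frontier[of F "cball 0 1"])
      show "F holomorphic_on interior (cball 0 1)" unfolding F_def
        using hol holomorphic_on_subset[OF H(1) subset_UNIV[of "ball 0 1"]] p
        by (simp, intro holomorphic_intros) auto
      show "continuous_on (closure (cball 0 1)) F" unfolding F_def
        using cont holomorphic_on_imp_continuous_on[OF holomorphic_on_subset[OF H(1) subset_UNIV[of "cball 0 1"]]] p
        by (simp, intro continuous_intros) auto
    next
      fix x :: complex assume "x \<in> frontier (cball 0 1)"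
      then have x: "norm x = 1" by simp
      have "norm (F x) powr p \<le> 1" unfolding nF using low[OF x] by (simp add: G_def divide_le_eq_1)
      then show "norm (F x) \<le> 1" using p gr_one_powr[of "norm (F x)" p] by linarith
    qed (use that in auto)
    then have "norm (F z) powr p \<le> 1" using p by (simp add: powr_le1)
    then show ?thesis unfolding nF by (simp add: G_def divide_le_eq_1)
  qed
  have "G holomorphic_on UNIV" unfolding G_def using H(1) by (intro holomorphic_intros)
  then show ?thesis using that up low' by blast
qed

section \<open>The Poisson formula for entire functions and the inequality for |\<phi>| powr
  p\<close>

lemma circlepath_integral_iff:
  "(f has_contour_integral I) (circlepath z r) \<longleftrightarrow>
   ((\<lambda>t. f (z + r * cis t) * r * \<i> * cis t) has_integral I) {0..2*pi}"
  unfolding circlepath_def by (subst has_contour_integral_part_circlepath_iff) auto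

text \<open>Cauchy's formula for F(u) / (1 - cnj w * u). On the circle 1 - cnj w * u = u * cnj (u -
  w), which turns the Cauchy kernel into the Poisson kernel; at u = w the extra denominator is 1 -
  |w|^2.\<close>

lemma Poisson_holomorphic:
  fixes F :: "complex \<Rightarrow> complex"
  assumes F: "F holomorphic_on UNIV" and w: "norm w < 1"
  shows "((\<lambda>t. of_real ((1 - (norm w)\<^sup>2) / (norm (cis t - w))\<^sup>2) * F (cis t)) has_integral 2 * pi * F w) {0..2*pi}"
proof -
  define h where "h u = F u / (1 - cnj w * u)" for u
  have nz: "1 - cnj w * u \<noteq> 0" if "norm u \<le> 1" for u
  proof
    assume "1 - cnj w * u = 0"
    then have "norm (cnj w * u) = 1" by (metis eq_iff_diff_eq_0 norm_one)
    moreover have "norm (cnj w * u) \<le> norm w" using that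
      by (simp add: norm_mult mult_left_le)
    ultimately show False using w by simp
  qed
  have "h holomorphic_on cball 0 1" unfolding h_def using nz
    by (intro holomorphic_intros holomorphic_on_subset[OF F]) auto
  from Cauchy_integral_circlepath_simple[OF this, of w] w
  have "((\<lambda>t. h (cis t) / (cis t - w) * \<i> * cis t) has_integral (2 * of_real pi * \<i> * h w)) {0..2*pi}"
    by (simp add: circlepath_integral_iff)
  from has_integral_mult_right[OF this, of "of_real (1 - (norm w)\<^sup>2) / \<i>"]
  have "((\<lambda>t. of_real (1 - (norm w)\<^sup>2) / \<i> * (h (cis t) / (cis t - w) * \<i> * cis t)) has_integral
     (of_real (1 - (norm w)\<^sup>2) / \<i> * (2 * of_real pi * \<i> * h w))) {0..2*pi}" .
  moreover have "of_real (1 - (norm w)\<^sup>2) / \<i> * (2 * of_real pi * \<i> * h w) = 2 * pi * F w"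
  proof -
    have "1 - cnj w * w = of_real (1 - (norm w)\<^sup>2)"
      by (metis complex_norm_square mult.commute of_real_1 of_real_diff of_real_power)
    moreover have "1 - cnj w * w \<noteq> 0" using nz[of w] w by simp
    ultimately show ?thesis unfolding h_def by simp
  qed
  moreover have "of_real (1 - (norm w)\<^sup>2) / \<i> * (h (cis t) / (cis t - w) * \<i> * cis t)
    = of_real ((1 - (norm w)\<^sup>2) / (norm (cis t - w))\<^sup>2) * F (cis t)" for t
  proof -
    have c: "cis t * cnj (cis t) = 1" by (simp add: cis_cnj cis_mult)
    have "1 - cnj w * cis t = cis t * cnj (cis t - w)"
      using c by (simp add: algebra_simps)
    then have "h (cis t) / (cis t - w) * cis t = F (cis t) / ((cis t - w) * cnj (cis t - w))"
      unfolding h_def by simp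
    also have "(cis t - w) * cnj (cis t - w) = of_real ((norm (cis t - w))\<^sup>2)"
      by (metis complex_norm_square of_real_power)
    finally have "h (cis t) / (cis t - w) * cis t = F (cis t) / of_real ((norm (cis t - w))\<^sup>2)" .
    moreover have "a / \<i> * (b * \<i> * c) = a * (b * c)" for a b c :: complex by (simp add: field_simps)
    moreover have "a * (b / of_real d) = of_real (c / d) * b" if "a = of_real c" for a b :: complex and c d
      using that by simp
    ultimately show ?thesis by metis
  qed
  ultimately show ?thesis by (simp only:)
qed

text \<open>The majorant G of |\<phi>| powr p is holomorphic, so G * A obeys the Poisson formula
  exactly. The excess e of |G| on the circle costs e * K, where K is the Poisson integral of |A|,
  and e tends to 0.\<close>

lemma weighted_Poisson_bound:
  fixes \<phi> :: "complex \<Rightarrow> complex"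
  assumes hol: "\<phi> holomorphic_on ball 0 1" and cont: "continuous_on (cball 0 1) \<phi>"
    and p: "p > 0" and w: "norm w < 1" and A: "A holomorphic_on UNIV"
  shows "2 * pi * (norm (\<phi> w) powr p * norm (A w))
    \<le> integral {0..2*pi} (\<lambda>t. (1 - (norm w)\<^sup>2) / (norm (cis t - w))\<^sup>2 *
         (norm (\<phi> (cis t)) powr p * norm (A (cis t))))" (is "_ \<le> integral _ ?f")
proof -
  have nz: "cis t - w \<noteq> 0" for t using w by auto
  have cA: "continuous_on S (\<lambda>t. A (cis t))" for S
    by (rule continuous_on_compose2[OF holomorphic_on_imp_continuous_on[OF A]]) (auto intro!: continuous_intros)
  have c\<phi>: "continuous_on S (\<lambda>t. \<phi> (cis t))" for S
    by (rule continuous_on_compose2[OF cont]) (auto intro!: continuous_intros)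
  have cP: "continuous_on S (\<lambda>t. (1 - (norm w)\<^sup>2) / (norm (cis t - w))\<^sup>2)" for S
    using nz by (auto intro!: continuous_intros)
  define P where "P t = (1 - (norm w)\<^sup>2) / (norm (cis t - w))\<^sup>2" for t
  have P0: "P t \<ge> 0" for t unfolding P_def using w by (simp add: power_le_one)
  have if': "?f integrable_on {0..2*pi}"
    using p by (intro integrable_continuous_interval continuous_intros cP cA c\<phi> continuous_on_powr') auto
  have iA: "(\<lambda>t. P t * norm (A (cis t))) integrable_on {0..2*pi}"
    unfolding P_def by (intro integrable_continuous_interval continuous_intros cP cA)
  define K where "K = integral {0..2*pi} (\<lambda>t. P t * norm (A (cis t)))"
  have "2 * pi * (norm (\<phi> w) powr p * norm (A w)) \<le> integral {0..2*pi} ?f + e * K" if e: "e > 0" for e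
  proof -
    obtain G where G: "G holomorphic_on UNIV"
      "\<And>z. norm z \<le> 1 \<Longrightarrow> norm (\<phi> z) powr p \<le> norm (G z)"
      "\<And>z. norm z = 1 \<Longrightarrow> norm (G z) \<le> norm (\<phi> z) powr p + e"
      using powr_holomorphic_majorant[OF hol cont p e] by blast
    have "(\<lambda>z. G z * A z) holomorphic_on UNIV" using G(1) A by (intro holomorphic_intros)
    from Poisson_holomorphic[OF this w]
    have *: "((\<lambda>t. of_real (P t) * (G (cis t) * A (cis t))) has_integral 2 * pi * (G w * A w)) {0..2*pi}"
      unfolding P_def .
    have sum: "((\<lambda>t. ?f t + e * (P t * norm (A (cis t)))) has_integral (integral {0..2*pi} ?f + e * K)) {0..2*pi}"
      unfolding K_def by (intro has_integral_add has_integral_mult_right integrable_integral if' iA)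
    have "norm (integral {0..2*pi} (\<lambda>t. of_real (P t) * (G (cis t) * A (cis t))))
      \<le> integral {0..2*pi} (\<lambda>t. ?f t + e * (P t * norm (A (cis t))))"
    proof (rule integral_norm_bound_integral)
      fix t
      have "norm (of_real (P t) * (G (cis t) * A (cis t))) = P t * (norm (G (cis t)) * norm (A (cis t)))"
        using P0 by (simp add: norm_mult)
      also have "\<dots> \<le> P t * ((norm (\<phi> (cis t)) powr p + e) * norm (A (cis t)))"
        using P0 G(3)[of "cis t"] by (intro mult_left_mono mult_right_mono) auto
      finally show "norm (of_real (P t) * (G (cis t) * A (cis t))) \<le> ?f t + e * (P t * norm (A (cis t)))"
        unfolding P_def[symmetric] by (simp only: distrib_left distrib_right mult_ac)
    qed (use * sum in \<open>auto simp: integrable_on_def\<close>)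
    then have "norm (2 * pi * (G w * A w)) \<le> integral {0..2*pi} ?f + e * K"
      using integral_unique[OF *] integral_unique[OF sum] by simp
    moreover have "norm (2 * pi * (G w * A w)) = 2 * pi * (norm (G w) * norm (A w))"
      by (simp add: norm_mult)
    moreover have "norm (\<phi> w) powr p * norm (A w) \<le> norm (G w) * norm (A w)"
      using G(2)[of w] w by (intro mult_right_mono) auto
    ultimately show ?thesis by (smt (verit) mult_left_mono pi_gt_zero)
  qed
  then have "\<forall>\<^sub>F e in at_right 0. 2 * pi * (norm (\<phi> w) powr p * norm (A w)) \<le> integral {0..2*pi} ?f + e * K"
    by (simp add: eventually_at_right_less eventually_at_filter)
  moreover have "((\<lambda>e. integral {0..2*pi} ?f + e * K) \<longlongrightarrow> integral {0..2*pi} ?f + 0 * K) (at_right 0)"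
    by (intro tendsto_intros)
  ultimately show ?thesis using tendsto_lowerbound by fastforce
qed

section \<open>The kernel estimates\<close>

text \<open>The derivative of \<open>(u / (u + y)) powr \<mu> / \<mu>\<close> with respect to \<open>u\<close>.\<close>

definition hardy_ker :: "real \<Rightarrow> real \<Rightarrow> real \<Rightarrow> real" where
  "hardy_ker \<mu> u y = u powr (\<mu> - 1) * y * (u + y) powr (- 1 - \<mu>)"

lemma hardy_ker_nonneg: "y \<ge> 0 \<Longrightarrow> hardy_ker \<mu> u y \<ge> 0"
  by (simp add: hardy_ker_def)

lemma hardy_ker_antimono:
  assumes "0 < u" "u \<le> v" "y \<ge> 0" "0 < \<mu>" "\<mu> < 1"
  shows "hardy_ker \<mu> v y \<le> hardy_ker \<mu> u y"
  unfolding hardy_ker_def using assms by (intro mult_mono powr_mono2') auto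

lemma hardy_ker_measurable [measurable]:
  assumes [measurable]: "f \<in> borel_measurable M" "g \<in> borel_measurable M"
  shows "(\<lambda>x. hardy_ker \<mu> (f x) (g x)) \<in> borel_measurable M"
  unfolding hardy_ker_def by measurable

lemma hardy_ker_integral:
  assumes \<mu>: "0 < \<mu>" "\<mu> < 1" and y: "y > 0" and b: "b \<ge> 0"
  shows "((\<lambda>t. hardy_ker \<mu> t y) has_integral (b / (b + y)) powr \<mu> / \<mu>) {0..b}"
proof -
  let ?F = "\<lambda>t. (t / (t + y)) powr \<mu> / \<mu>"
  have "((\<lambda>t. hardy_ker \<mu> t y) has_integral (?F b - ?F 0)) {0..b}"
  proof (rule fundamental_theorem_of_calculus_interior)
    show "continuous_on {0..b} ?F"
      using \<mu> y by (intro continuous_intros continuous_on_powr') auto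
    fix t assume t: "t \<in> {0<..<b}"
    have "((\<lambda>t. t / (t + y)) has_real_derivative (y / (t + y)\<^sup>2)) (at t)"
      using t y by (auto intro!: derivative_eq_intros simp: field_simps power2_eq_square)
    from DERIV_powr[OF this _ DERIV_const[of \<mu>]]
    have "((\<lambda>t. (t / (t + y)) powr \<mu>) has_real_derivative ((t / (t + y)) powr \<mu> * (\<mu> * (y / (t + y)\<^sup>2) / (t / (t+y))))) (at t)"
      using t y by (simp add: ac_simps)
    then have "(?F has_real_derivative ((t / (t + y)) powr \<mu> * (\<mu> * (y / (t + y)\<^sup>2) / (t / (t+y)))) / \<mu>) (at t)"
      by (rule DERIV_cdivide)
    moreover have "((t / (t + y)) powr \<mu> * (\<mu> * (y / (t + y)\<^sup>2) / (t / (t+y)))) / \<mu> = hardy_ker \<mu> t y"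
    proof -
      have "(t / (t + y)) powr \<mu> = t powr \<mu> * (t + y) powr (- \<mu>)"
        using t y by (simp add: powr_divide powr_minus_divide)
      moreover have "t powr (\<mu> - 1) = t powr \<mu> / t" using t by (simp add: powr_diff)
      moreover have "(t + y) powr (- 1 - \<mu>) = (t + y) powr (- \<mu>) / (t + y)"
        using t y powr_diff[of "t + y" "- \<mu>" 1] by (simp add: minus_diff_commute)
      ultimately show ?thesis unfolding hardy_ker_def using t y \<mu>
        by (simp add: power2_eq_square mult_ac)
    qed
    ultimately show "(?F has_vector_derivative hardy_ker \<mu> t y) (at t)"
      by (simp add: has_real_derivative_iff_has_vector_derivative)
  qed (use b in auto)
  then show ?thesis by simp
qed

text \<open>The kernel is homogeneous of degree -1 in (u, y), so its integral in u is bounded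
  independently of y. The L^1 bound for \<open>maximal_majorant\<close> rests on this
  uniformity.\<close>

lemma hardy_ker_nn_integral:
  assumes \<mu>: "0 < \<mu>" "\<mu> < 1" and y: "y > 0"
  shows "(\<integral>\<^sup>+t. ennreal (hardy_ker \<mu> t y) * indicator {0..b} t \<partial>lborel) \<le> ennreal (1 / \<mu>)"
proof (cases "b \<ge> 0")
  case True
  have "(\<integral>\<^sup>+t. ennreal (hardy_ker \<mu> t y) * indicator {0..b} t \<partial>lborel) = ennreal ((b / (b + y)) powr \<mu> / \<mu>)"
    using hardy_ker_nonneg[of y \<mu>] y
    by (intro nn_integral_has_integral_lebesgue' hardy_ker_integral \<mu> y True) auto
  also have "\<dots> \<le> ennreal (1 / \<mu>)"
  proof -
    have "(b / (b + y)) powr \<mu> \<le> 1" using y True \<mu> by (intro powr_le1) auto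
    then show ?thesis using \<mu> by (intro ennreal_leI divide_right_mono) auto
  qed
  finally show ?thesis .
qed auto

text \<open>
  The left side is the weight \<open>\<delta>'\<close> at the boundary point, times the loss allowed in the maximal
  inequality, times a bound for the Poisson kernel of a point at depth \<open>s\<close>; the right side does not depend on \<open>s\<close>.
\<close>

lemma kernel_pointwise_bound:
  fixes s x \<delta> \<delta>' \<mu> :: real
  assumes \<mu>: "0 < \<mu>" "\<mu> < 1" and pos: "s > 0" "x > 0" "\<delta> > 0" "\<delta>' > 0" and tri: "\<delta>' \<le> \<delta> + x"
  shows "\<delta>' * ((s / (s + \<delta>)) powr \<mu> * ((s + \<delta>) / \<delta>) powr (1 - \<mu>)) / (s + \<delta>) * (s / (s + x)\<^sup>2)
     \<le> 9 * (hardy_ker \<mu> x \<delta>' + hardy_ker \<mu> \<delta> \<delta>')" (is "?L \<le> _")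
proof -
  define d where "d = s + \<delta>"
  have d: "d > 0" "\<delta> \<le> d" "s \<le> d" using pos d_def by auto
  \<comment> \<open>Sorting the powers isolates \<delta>' * \<delta> powr (\<mu> - 1). Only the last
    factor depends on s, and it is estimated separately for x \<le> \<delta> and x >
    \<delta>.\<close>
  have expand: "?L = \<delta>' * \<delta> powr (\<mu> - 1) * (s powr (1 + \<mu>) * d powr (- 2 * \<mu>) / (s + x) powr 2)"
  proof -
    have "(s / d) powr \<mu> = s powr \<mu> * d powr (- \<mu>)"
      using pos d by (simp add: powr_divide powr_minus_divide)
    moreover have "(d / \<delta>) powr (1 - \<mu>) = d powr (1 - \<mu>) * \<delta> powr (\<mu> - 1)"
      using pos d powr_minus[of \<delta> "1 - \<mu>"] by (simp add: powr_divide) (simp add: divide_inverse)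
    moreover have "d powr (- 2 * \<mu>) = d powr (- \<mu>) * d powr (1 - \<mu>) / d"
    proof -
      have "d powr (- 2 * \<mu>) = d powr (- \<mu> + (1 - \<mu>) - 1)" by (simp add: algebra_simps)
      also have "\<dots> = d powr (- \<mu>) * d powr (1 - \<mu>) / d powr 1" unfolding powr_diff powr_add by simp
      finally show ?thesis using d by simp
    qed
    moreover have "s powr (1 + \<mu>) = s * s powr \<mu>" using pos by (simp add: powr_add)
    moreover have "(s + x) powr 2 = (s + x)\<^sup>2" using pos by simp
    ultimately show ?thesis unfolding d_def[symmetric] by (simp add: field_simps)
  qed
  have three: "3 powr (1 + \<mu>) \<le> (9::real)"
  proof -
    have "3 powr (1 + \<mu>) \<le> (3::real) powr 2" using \<mu> by (intro powr_mono) auto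
    then show ?thesis by simp
  qed
  \<comment> \<open>Used with v = \<delta>, w = x + \<delta>' if x \<le> \<delta>, and with v = x, w
    = \<delta> + \<delta>' otherwise; in both cases \<open>tri\<close> gives w \<le> 3 v.\<close>
  have key: "v powr (- 1 - \<mu>) \<le> 9 * w powr (- 1 - \<mu>)" if "0 < w" "w \<le> 3 * v" for v w :: real
  proof -
    have v: "v > 0" using that by linarith
    have "(3 * v) powr (- 1 - \<mu>) \<le> w powr (- 1 - \<mu>)" using that \<mu> by (intro powr_mono2') auto
    moreover have "(3 * v) powr (- 1 - \<mu>) = v powr (- 1 - \<mu>) / 3 powr (1 + \<mu>)"
      using v powr_minus[of 3 "1 + \<mu>"] by (simp add: powr_mult divide_inverse)
    ultimately have "v powr (- 1 - \<mu>) / 3 powr (1 + \<mu>) \<le> w powr (- 1 - \<mu>)" by simp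
    then have "v powr (- 1 - \<mu>) \<le> 3 powr (1 + \<mu>) * w powr (- 1 - \<mu>)"
      by (simp add: pos_divide_le_eq mult.commute)
    also have "\<dots> \<le> 9 * w powr (- 1 - \<mu>)" using three by (intro mult_right_mono) auto
    finally show ?thesis .
  qed
  show ?thesis
  proof (cases "x \<le> \<delta>")
    case True
    have "s powr (1 + \<mu>) \<le> (s + x) powr (1 + \<mu>)" using pos \<mu> by (intro powr_mono2) auto
    then have "s powr (1 + \<mu>) / (s + x) powr 2 \<le> (s + x) powr (1 + \<mu>) / (s + x) powr 2"
      by (intro divide_right_mono) auto
    also have "\<dots> = (s + x) powr (\<mu> - 1)" by (simp add: powr_diff[symmetric])
    also have "\<dots> \<le> x powr (\<mu> - 1)" using pos \<mu> by (intro powr_mono2') auto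
    finally have 1: "s powr (1 + \<mu>) / (s + x) powr 2 \<le> x powr (\<mu> - 1)" .
    have 2: "d powr (- 2 * \<mu>) \<le> \<delta> powr (- 2 * \<mu>)" using d pos \<mu> by (intro powr_mono2') auto
    have "?L = \<delta>' * \<delta> powr (\<mu> - 1) * (d powr (- 2 * \<mu>) * (s powr (1 + \<mu>) / (s + x) powr 2))"
      unfolding expand by simp
    also have "\<dots> \<le> \<delta>' * \<delta> powr (\<mu> - 1) * (\<delta> powr (- 2 * \<mu>) * x powr (\<mu> - 1))"
      using 1 2 pos by (intro mult_left_mono mult_mono) auto
    also have "\<dots> = \<delta>' * x powr (\<mu> - 1) * \<delta> powr (- 1 - \<mu>)"
      using powr_add[of \<delta> "\<mu> - 1" "- 2 * \<mu>"] by (simp add: algebra_simps)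
    also have "\<dots> \<le> \<delta>' * x powr (\<mu> - 1) * (9 * (x + \<delta>') powr (- 1 - \<mu>))"
      using True tri pos by (intro mult_left_mono key) auto
    also have "\<dots> = 9 * hardy_ker \<mu> x \<delta>'" unfolding hardy_ker_def by simp
    finally show ?thesis using hardy_ker_nonneg[of \<delta>' \<mu> \<delta>] pos by simp
  next
    case False
    have "s powr (1 + \<mu>) * d powr (- 2 * \<mu>) \<le> d powr (1 + \<mu>) * d powr (- 2 * \<mu>)"
      using pos \<mu> d by (intro mult_right_mono powr_mono2) auto
    also have "\<dots> = d powr (1 - \<mu>)" by (simp add: powr_add[symmetric])
    also have "\<dots> \<le> (s + x) powr (1 - \<mu>)" using False pos \<mu> d by (intro powr_mono2) (auto simp: d_def)
    finally have "s powr (1 + \<mu>) * d powr (- 2 * \<mu>) / (s + x) powr 2 \<le> (s + x) powr (1 - \<mu>) / (s + x) powr 2"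
      by (intro divide_right_mono) auto
    also have "\<dots> = (s + x) powr (- 1 - \<mu>)" by (simp add: powr_diff[symmetric])
    also have "\<dots> \<le> x powr (- 1 - \<mu>)" using pos \<mu> by (intro powr_mono2') auto
    also have "\<dots> \<le> 9 * (\<delta> + \<delta>') powr (- 1 - \<mu>)" using False tri pos by (intro key) auto
    finally have "?L \<le> \<delta>' * \<delta> powr (\<mu> - 1) * (9 * (\<delta> + \<delta>') powr (- 1 - \<mu>))"
      unfolding expand using pos by (intro mult_left_mono) auto
    also have "\<dots> = 9 * hardy_ker \<mu> \<delta> \<delta>'" unfolding hardy_ker_def by simp
    finally show ?thesis using hardy_ker_nonneg[of \<delta>' \<mu> x] pos by simp
  qed
qed

section \<open>Kernel integrals over the circle, uniform in the second argument\<close>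

text \<open>With y = x/2: sin x = 2 sin y cos y \<ge> 2 y (cos y)^2 = x (1 + cos x)/2 \<ge> x/2. At
  x = t/2 this bounds the chord |1 - cis t| below by t/2 on [0, pi].\<close>

lemma sin_ge_half:
  fixes x :: real
  assumes "0 \<le> x" "x \<le> pi / 2"
  shows "x / 2 \<le> sin x"
proof -
  define y where "y = x / 2"
  have "0 * cos 0 - 0 \<le> sin y - y * cos y"
  proof -
    have "(\<lambda>y. sin y - y * cos y) 0 \<le> (\<lambda>y. sin y - y * cos y) y"
    proof (rule DERIV_nonneg_imp_nondecreasing[where f = "\<lambda>y. sin y - y * cos y"])
      fix u assume u: "0 \<le> u" "u \<le> y"
      have "((\<lambda>y. sin y - y * cos y) has_real_derivative u * sin u) (at u)"
        by (auto intro!: derivative_eq_intros)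
      moreover have "u * sin u \<ge> 0" using u assms by (intro mult_nonneg_nonneg sin_ge_zero) (auto simp: y_def)
      ultimately show "\<exists>d. ((\<lambda>y. sin y - y * cos y) has_real_derivative d) (at u) \<and> 0 \<le> d" by blast
    qed (use assms in \<open>auto simp: y_def\<close>)
    then show ?thesis by simp
  qed
  then have "sin y \<ge> y * cos y" by simp
  moreover have "cos y \<ge> 0" using assms by (intro cos_ge_zero) (auto simp: y_def)
  ultimately have "2 * sin y * cos y \<ge> 2 * (y * cos y) * cos y"
    by (intro mult_right_mono) auto
  moreover have "2 * (y * cos y) * cos y = x * (1 + cos x) / 2"
    using cos_double_cos[of y] by (simp add: y_def power2_eq_square)
  moreover have "x * (1 + cos x) / 2 \<ge> x / 2"
  proof -
    have "x * cos x \<ge> 0" using assms by (intro mult_nonneg_nonneg cos_ge_zero) auto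
    then show ?thesis by (simp add: algebra_simps)
  qed
  ultimately have "x / 2 \<le> 2 * sin y * cos y" by linarith
  then show ?thesis using sin_double[of y] by (simp add: y_def)
qed

lemma norm_one_minus_cis: "norm (1 - cis t) = 2 * \<bar>sin (t / 2)\<bar>"
proof -
  have "(norm (1 - cis t))\<^sup>2 = (1 - cos t)\<^sup>2 + (sin t)\<^sup>2" by (simp add: cmod_power2)
  also have "\<dots> = 2 - 2 * cos t" using sin_cos_squared_add[of t] by (simp add: power2_eq_square algebra_simps)
  also have "\<dots> = (2 * \<bar>sin (t / 2)\<bar>)\<^sup>2" using cos_double_sin[of "t / 2"] by (simp add: power_mult_distrib)
  finally show ?thesis by (rule power2_eq_imp_eq) auto
qed

lemma cis_ne_one:
  assumes "0 < t" "t < 2 * pi"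
  shows "cis t \<noteq> 1"
proof
  assume "cis t = 1"
  then have "sin (t / 2) = 0" using norm_one_minus_cis[of t] by simp
  moreover have "sin (t / 2) > 0" using assms by (intro sin_gt_zero) auto
  ultimately show False by simp
qed

lemma nn_integral_periodic_shift:
  fixes h :: "real \<Rightarrow> ennreal"
  assumes [measurable]: "h \<in> borel_measurable borel" and per: "\<And>t. h (t + 2 * pi) = h t"
    and a: "0 \<le> a" "a \<le> 2 * pi"
  shows "(\<integral>\<^sup>+t. h (t + a) * indicator {0..2*pi} t \<partial>lborel) = (\<integral>\<^sup>+t. h t * indicator {0..2*pi} t \<partial>lborel)"
proof -
  have shift: "(\<integral>\<^sup>+t. k t \<partial>lborel) = (\<integral>\<^sup>+t. k (c + t) \<partial>lborel)" if "k \<in> borel_measurable borel" for k :: "real \<Rightarrow> ennreal" and c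
    using nn_integral_real_affine[OF that, of 1 c] by simp
  have "(\<integral>\<^sup>+t. h (t + a) * indicator {0..2*pi} t \<partial>lborel) = (\<integral>\<^sup>+t. h t * indicator {a..a+2*pi} t \<partial>lborel)"
    by (subst shift[of "\<lambda>t. h t * indicator {a..a+2*pi} t" a]) (auto intro!: nn_integral_cong simp: indicator_def add.commute)
  also have "\<dots> = (\<integral>\<^sup>+t. h t * indicator {a..2*pi} t + h t * indicator {2*pi<..a+2*pi} t \<partial>lborel)"
    using a by (intro nn_integral_cong) (auto simp: indicator_def)
  also have "\<dots> = (\<integral>\<^sup>+t. h t * indicator {a..2*pi} t \<partial>lborel) + (\<integral>\<^sup>+t. h t * indicator {2*pi<..a+2*pi} t \<partial>lborel)"
    by (intro nn_integral_add) auto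
  also have "(\<integral>\<^sup>+t. h t * indicator {2*pi<..a+2*pi} t \<partial>lborel) = (\<integral>\<^sup>+t. h t * indicator {0<..a} t \<partial>lborel)"
    by (subst shift[of _ "2*pi"]) (auto intro!: nn_integral_cong simp: indicator_def per add.commute[of "2*pi"])
  also have "(\<integral>\<^sup>+t. h t * indicator {a..2*pi} t \<partial>lborel) + (\<integral>\<^sup>+t. h t * indicator {0<..a} t \<partial>lborel)
     = (\<integral>\<^sup>+t. h t * indicator {a..2*pi} t + h t * indicator {0<..a} t \<partial>lborel)"
    by (intro nn_integral_add[symmetric]) auto
  also have "\<dots> = (\<integral>\<^sup>+t. h t * indicator {0..2*pi} t \<partial>lborel)"
  proof (intro nn_integral_cong_AE)
    \<comment> \<open>The two pieces overlap in a and miss 0, so the equality holds almost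
      everywhere only.\<close>
    show "AE t in lborel. h t * indicator {a..2*pi} t + h t * indicator {0<..a} t = h t * indicator {0..2*pi} t"
      using AE_lborel_singleton[of a] AE_lborel_singleton[of 0]
      by eventually_elim (use a in \<open>auto simp: indicator_def\<close>)
  qed
  finally show ?thesis .
qed

text \<open>Half the chord |1 - cis t| is at least t/4 on [0, pi] and (2*pi - t)/4 on the rest, and
  the kernel decreases in its first argument; each side costs 4/\<mu> after rescaling. The chord is
  halved since that is the lower bound available for |1 - r cis t|.\<close>

lemma hardy_ker_circle_integral:
  assumes \<mu>: "0 < \<mu>" "\<mu> < 1" and y: "y > 0"
  shows "(\<integral>\<^sup>+t. ennreal (hardy_ker \<mu> (norm (1 - cis t) / 2) y) * indicator {0..2*pi} t \<partial>lborel) \<le> ennreal (8 / \<mu>)"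
proof -
  have scaled: "(\<integral>\<^sup>+t. ennreal (hardy_ker \<mu> (t / 4) y) * indicator {0..2*pi} t \<partial>lborel) \<le> ennreal (4 / \<mu>)"
  proof -
    have "(\<integral>\<^sup>+t. ennreal (hardy_ker \<mu> (t / 4) y) * indicator {0..2*pi} t \<partial>lborel)
       = ennreal 4 * (\<integral>\<^sup>+t. ennreal (hardy_ker \<mu> t y) * indicator {0..pi/2} t \<partial>lborel)"
      by (subst nn_integral_real_affine[of _ 4 0])
        (auto intro!: arg_cong[where f="\<lambda>x. 4 * x"] nn_integral_cong simp: indicator_def)
    also have "\<dots> \<le> ennreal 4 * ennreal (1 / \<mu>)"
      by (intro mult_left_mono hardy_ker_nn_integral \<mu> y) auto
    also have "\<dots> = ennreal (4 / \<mu>)" using \<mu> by (simp add: ennreal_mult[symmetric] del: ennreal_numeral)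
    finally show ?thesis .
  qed
  have refl: "(\<integral>\<^sup>+t. ennreal (hardy_ker \<mu> ((2*pi - t) / 4) y) * indicator {0..2*pi} t \<partial>lborel)
     = (\<integral>\<^sup>+t. ennreal (hardy_ker \<mu> (t / 4) y) * indicator {0..2*pi} t \<partial>lborel)"
    by (subst nn_integral_real_affine[of _ "-1" "2*pi"])
      (auto intro!: nn_integral_cong simp: indicator_def)
  have pw: "hardy_ker \<mu> (norm (1 - cis t) / 2) y \<le> hardy_ker \<mu> (t / 4) y + hardy_ker \<mu> ((2*pi - t) / 4) y"
    if t: "0 \<le> t" "t \<le> 2 * pi" for t
  proof (cases "t = 0 \<or> t = 2 * pi")
    \<comment> \<open>\<open>0 powr (\<mu> - 1)\<close> is 0, so the kernel vanishes at the
      endpoints although it blows up next to them, and monotonicity cannot be used there.\<close>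
    case True
    then have "norm (1 - cis t) = 0" by auto
    then have "hardy_ker \<mu> (norm (1 - cis t) / 2) y = 0" by (simp add: hardy_ker_def)
    then show ?thesis using hardy_ker_nonneg[of y \<mu>] y by simp
  next
    case False
    show ?thesis
    proof (cases "t \<le> pi")
      case True
      have "t / 4 \<le> sin (t / 2)" using sin_ge_half[of "t/2"] t True by simp
      then have "hardy_ker \<mu> (norm (1 - cis t) / 2) y \<le> hardy_ker \<mu> (t / 4) y"
        using t False y \<mu> by (intro hardy_ker_antimono) (auto simp: norm_one_minus_cis)
      then show ?thesis using hardy_ker_nonneg[of y \<mu> "(2*pi - t) / 4"] y by simp
    next
      case c: False
      have "(2 * pi - t) / 4 \<le> sin ((2 * pi - t) / 2)" using sin_ge_half[of "(2 * pi - t)/2"] t c by simp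
      also have "\<dots> = sin (pi - t / 2)" by (simp add: diff_divide_distrib)
      also have "\<dots> = sin (t / 2)" by (rule sin_pi_minus)
      finally have "hardy_ker \<mu> (norm (1 - cis t) / 2) y \<le> hardy_ker \<mu> ((2 * pi - t) / 4) y"
        using t False y \<mu> by (intro hardy_ker_antimono) (auto simp: norm_one_minus_cis)
      then show ?thesis using hardy_ker_nonneg[of y \<mu> "t / 4"] y by simp
    qed
  qed
  have "(\<integral>\<^sup>+t. ennreal (hardy_ker \<mu> (norm (1 - cis t) / 2) y) * indicator {0..2*pi} t \<partial>lborel)
    \<le> (\<integral>\<^sup>+t. ennreal (hardy_ker \<mu> (t / 4) y) * indicator {0..2*pi} t +
         ennreal (hardy_ker \<mu> ((2*pi - t) / 4) y) * indicator {0..2*pi} t \<partial>lborel)"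
    using pw hardy_ker_nonneg[of y \<mu>] y
    by (intro nn_integral_mono) (auto simp: indicator_def ennreal_plus[symmetric] simp del: ennreal_plus intro!: ennreal_leI)
  also have "\<dots> = (\<integral>\<^sup>+t. ennreal (hardy_ker \<mu> (t / 4) y) * indicator {0..2*pi} t \<partial>lborel)
       + (\<integral>\<^sup>+t. ennreal (hardy_ker \<mu> ((2*pi - t) / 4) y) * indicator {0..2*pi} t \<partial>lborel)"
    by (intro nn_integral_add) auto
  also have "\<dots> \<le> ennreal (4 / \<mu>) + ennreal (4 / \<mu>)" unfolding refl by (intro add_mono scaled)
  also have "\<dots> = ennreal (8 / \<mu>)" using \<mu> by (simp add: ennreal_plus[symmetric] del: ennreal_plus)
  finally show ?thesis .
qed

section \<open>The weighted maximal inequality\<close>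

definition circle_int :: "real \<Rightarrow> (complex \<Rightarrow> complex) \<Rightarrow> real \<Rightarrow> ennreal" where
  "circle_int p f r = (\<integral>\<^sup>+ t. ennreal (norm (f (of_real r * cis t)) powr p) * indicator {0..2*pi} t \<partial>lborel)"

text \<open>The two kernels are what \<open>kernel_pointwise_bound\<close> leaves once the depth s
  is eliminated. Being an integral operator in |f| powr p and not a supremum, it is bounded on L^1
  of the circle, where the Hardy-Littlewood maximal operator is not.\<close>

definition maximal_majorant :: "real \<Rightarrow> real \<Rightarrow> (complex \<Rightarrow> complex) \<Rightarrow> real \<Rightarrow> real \<Rightarrow> ennreal" where
  "maximal_majorant p \<mu> f r t = (\<integral>\<^sup>+ t'. ennreal ((hardy_ker \<mu> (norm (cis t - cis t')) (norm (1 - of_real r * cis t'))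
       + hardy_ker \<mu> (norm (1 - of_real r * cis t)) (norm (1 - of_real r * cis t')))
       * norm (f (of_real r * cis t')) powr p) * indicator {0..2*pi} t' \<partial>lborel)"

lemma borel_measurable_cis [measurable]: "cis \<in> borel_measurable borel"
  by (intro borel_measurable_continuous_onI continuous_intros)

lemma norm_of_real_cis: "r \<ge> 0 \<Longrightarrow> norm (of_real r * cis t) = r"
  by (simp add: norm_mult)

lemma continuous_on_circle:
  assumes "continuous_on disc f" "0 \<le> r" "r < 1"
  shows "continuous_on A (\<lambda>t. f (of_real r * cis t))"
  using assms by (intro continuous_on_compose2[OF assms(1)] continuous_intros) (auto simp: norm_mult)

lemma measurable_on_circle:
  assumes "continuous_on disc f" "0 \<le> r" "r < 1"
  shows "(\<lambda>t. f (of_real r * cis t)) \<in> borel_measurable borel"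
  using continuous_on_circle[OF assms] by (intro borel_measurable_continuous_onI)

lemma nn_integral_interval_eq_integral:
  fixes h :: "real \<Rightarrow> real"
  assumes "continuous_on {a..b} h" "\<And>t. t \<in> {a..b} \<Longrightarrow> h t \<ge> 0"
  shows "(\<integral>\<^sup>+t. ennreal (h t) * indicator {a..b} t \<partial>lborel) = ennreal (integral {a..b} h)"
  using assms by (intro nn_integral_has_integral_lebesgue' integrable_integral integrable_continuous_interval)

text \<open>With s = 1 - t and \<delta> = |1-z|, the first inequality and twice the second add up to
  (s + \<delta>)/3 \<le> |1 - t z|. Along a radius the distance to 1 is therefore comparable to s +
  \<delta>.\<close>

lemma one_minus_dist:
  fixes z :: complex
  assumes "0 \<le> t" "t \<le> 1" "norm z \<le> 1"
  shows "1 - t \<le> norm (1 - t *\<^sub>R z)" "norm (1 - z) / 2 \<le> norm (1 - t *\<^sub>R z)"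
    "norm (1 - t *\<^sub>R z) \<le> (1 - t) + norm (1 - z)"
proof -
  have "norm (t *\<^sub>R z) \<le> t" using assms by (simp add: mult_left_le)
  then show 1: "1 - t \<le> norm (1 - t *\<^sub>R z)"
    using norm_triangle_ineq2[of 1 "t *\<^sub>R z"] by (simp only: norm_one)
  have e: "norm (t *\<^sub>R z - z) \<le> 1 - t"
  proof -
    have "t *\<^sub>R z - z = (t - 1) *\<^sub>R z" by (simp add: algebra_simps)
    then have "norm (t *\<^sub>R z - z) = (1 - t) * norm z" using assms by simp
    also have "\<dots> \<le> 1 - t" using assms by (simp add: mult_left_le)
    finally show ?thesis .
  qed
  have "norm (1 - z) \<le> norm (1 - t *\<^sub>R z) + norm (t *\<^sub>R z - z)"
    using norm_triangle_ineq[of "1 - t *\<^sub>R z" "t *\<^sub>R z - z"] by simp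
  then show "norm (1 - z) / 2 \<le> norm (1 - t *\<^sub>R z)" using e 1 by linarith
  have "norm (1 - t *\<^sub>R z) \<le> norm (1 - z) + norm (z - t *\<^sub>R z)"
    using norm_triangle_ineq[of "1 - z" "z - t *\<^sub>R z"] by simp
  then show "norm (1 - t *\<^sub>R z) \<le> (1 - t) + norm (1 - z)" using e by (simp add: norm_minus_commute)
qed

lemma dilate_holomorphic:
  assumes f: "f holomorphic_on disc" and r: "0 \<le> r" "r < 1"
  shows "(\<lambda>w. f (complex_of_real r * w)) holomorphic_on ball 0 1"
    "continuous_on (cball 0 1) (\<lambda>w. f (complex_of_real r * w))"
proof -
  have in_disc: "complex_of_real r * u \<in> disc" if "norm u \<le> 1" for u
  proof -
    have "r * norm u \<le> r" using r that by (simp add: mult_left_le)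
    then have "r * norm u < 1" using r(2) by (rule order_le_less_trans)
    then show ?thesis using r by (simp add: norm_mult)
  qed
  have "f \<circ> (\<lambda>w. complex_of_real r * w) holomorphic_on ball 0 1"
    by (rule holomorphic_on_compose_gen[OF _ f]) (auto intro!: holomorphic_intros in_disc[unfolded mem_ball dist_0_norm])
  then show "(\<lambda>w. f (complex_of_real r * w)) holomorphic_on ball 0 1" by (simp add: comp_def)
  show "continuous_on (cball 0 1) (\<lambda>w. f (complex_of_real r * w))"
    by (rule continuous_on_compose2[OF holomorphic_on_imp_continuous_on[OF f]])
      (auto intro!: continuous_intros in_disc[unfolded mem_ball dist_0_norm])
qed

text \<open>The Poisson inequality for \<phi>(w) = f(r w) at depth s below cis t, with A(w) = 1 - r
  w: on the circle |A| is \<delta>', at the point it is at least (s + \<delta>)/3. Dividing by the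
  latter produces the left side of \<open>kernel_pointwise_bound\<close>. The dilation by r makes
  \<phi> continuous up to the circle.\<close>

lemma maximal_majorant_pointwise:
  fixes f :: "complex \<Rightarrow> complex" and t :: real
  assumes f: "f holomorphic_on disc" and p: "p > 0" and \<mu>: "0 < \<mu>" "\<mu> < 1"
    and r: "0 \<le> r" "r < 1" and s: "0 < s" "s \<le> 1"
  defines "z \<equiv> of_real r * cis t" and "\<delta> \<equiv> norm (1 - of_real r * cis t)"
  shows "ennreal ((s / (s + \<delta>)) powr \<mu> * ((s + \<delta>) / \<delta>) powr (1 - \<mu>) * norm (f ((1 - s) *\<^sub>R z)) powr p)
     \<le> 100 * maximal_majorant p \<mu> f r t"
proof -
  define \<phi> where "\<phi> w = f (complex_of_real r * w)" for w
  define \<delta>' where "\<delta>' t' = norm (1 - of_real r * cis t')" for t'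
  define w where "w = complex_of_real (1 - s) * cis t"
  define x where "x t' = norm (cis t - cis t')" for t'
  have cont: "continuous_on disc f" using f by (rule holomorphic_on_imp_continuous_on)
  have \<phi>_eq: "\<phi> w = f ((1 - s) *\<^sub>R z)" unfolding \<phi>_def w_def z_def by (simp add: scaleR_conv_of_real mult_ac)
  have nw: "norm w < 1" unfolding w_def using s by (simp add: norm_mult del: of_real_diff)
  have \<phi>hol: "\<phi> holomorphic_on ball 0 1" and \<phi>cont: "continuous_on (cball 0 1) \<phi>"
    unfolding \<phi>_def by (rule dilate_holomorphic[OF f]; use r in simp)+
  have \<delta>: "\<delta> > 0" "\<delta>' t' > 0" for t'
  proof -
    have "1 - complex_of_real r * cis u \<noteq> 0" for u using r by (metis eq_iff_diff_eq_0 norm_of_real_cis norm_one order_less_irrefl)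
    then show "\<delta> > 0" "\<delta>' t' > 0" unfolding \<delta>_def \<delta>'_def by auto
  qed
  define P where "P t' = (1 - (norm w)\<^sup>2) / (norm (cis t' - w))\<^sup>2" for t'
  have nz: "cis t' - w \<noteq> 0" for t' using nw by auto
  have P_bound: "0 \<le> P t'" "P t' \<le> 18 * (s / (s + x t')\<^sup>2)" for t'
  proof -
    have "norm w = 1 - s" unfolding w_def using s by (simp add: norm_mult del: of_real_diff)
    then have nw1: "norm w = 1 - s" .
    then have num: "0 \<le> 1 - (norm w)\<^sup>2" "1 - (norm w)\<^sup>2 \<le> 2 * s"
      unfolding nw1 using s by (auto simp: power2_eq_square algebra_simps intro: mult_le_one)
    have wt: "norm (cis t - w) = s"
    proof -
      have "cis t - w = complex_of_real s * cis t" unfolding w_def by (simp add: algebra_simps)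
      then show ?thesis using s by (simp add: norm_mult)
    qed
    have "norm (cis t' - w) \<ge> s" using norm_triangle_ineq2[of "cis t'" w] \<open>norm w = 1 - s\<close> by simp
    moreover have "x t' \<le> norm (cis t' - w) + s"
      unfolding x_def using norm_triangle_ineq4[of "cis t - w" "cis t' - w"] wt by simp
    \<comment> \<open>Here s \<le> |cis t' - w| and x \<le> |cis t' - w| + s. Together with 1 -
      |w|^2 \<le> 2 s this gives the constant 2 * 9 = 18.\<close>
    ultimately have den: "(s + x t') / 3 \<le> norm (cis t' - w)" by simp
    have x0: "x t' \<ge> 0" unfolding x_def by simp
    show "0 \<le> P t'" unfolding P_def using num by simp
    have "P t' \<le> 2 * s / ((s + x t') / 3)\<^sup>2"
      unfolding P_def using num den s x0 by (intro frac_le power_mono) auto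
    also have "\<dots> = 18 * (s / (s + x t')\<^sup>2)" by (simp add: power_divide)
    finally show "P t' \<le> 18 * (s / (s + x t')\<^sup>2)" .
  qed
  let ?om = "(s / (s + \<delta>)) powr \<mu> * ((s + \<delta>) / \<delta>) powr (1 - \<mu>)"
  have "2 * pi * (norm (\<phi> w) powr p * norm (1 - complex_of_real r * w))
    \<le> integral {0..2*pi} (\<lambda>t'. P t' * (norm (\<phi> (cis t')) powr p * \<delta>' t'))"
    unfolding P_def \<delta>'_def
    by (rule weighted_Poisson_bound[OF \<phi>hol \<phi>cont p nw, of "\<lambda>w. 1 - complex_of_real r * w"])
      (auto intro!: holomorphic_intros)
  moreover have "(s + \<delta>) / 3 \<le> norm (1 - complex_of_real r * w)"
  proof -
    have e: "complex_of_real r * w = (1 - s) *\<^sub>R z" unfolding w_def z_def by (simp add: scaleR_conv_of_real mult_ac)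
    have "norm z \<le> 1" unfolding z_def using r by (simp add: norm_mult)
    from one_minus_dist(1,2)[of "1 - s" z, OF _ _ this] s
    show ?thesis unfolding e \<delta>_def z_def by auto
  qed
  ultimately have main: "2 * pi * (norm (\<phi> w) powr p * ((s + \<delta>) / 3))
    \<le> integral {0..2*pi} (\<lambda>t'. P t' * (norm (\<phi> (cis t')) powr p * \<delta>' t'))"
    by (smt (verit) mult_left_mono pi_gt_zero powr_ge_zero mult_nonneg_nonneg)
  have cont_int: "continuous_on S (\<lambda>t'. P t' * (norm (\<phi> (cis t')) powr p * \<delta>' t'))" for S
  proof -
    have "continuous_on S (\<lambda>t. \<phi> (cis t))"
      by (rule continuous_on_compose2[OF \<phi>cont]) (auto intro!: continuous_intros)
    then show ?thesis
      unfolding P_def \<delta>'_def using nz p by (intro continuous_intros continuous_on_powr') auto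
  qed
  \<comment> \<open>The factor 3 / (2 * pi * (s + \<delta>)) undoes the constants of
    \<open>main\<close>. Then 3 * 18 / (2 * pi) = 27 / pi, and 27 * 9 / pi < 100 explains the final
    constant.\<close>
  define c where "c = ?om * 3 / (2 * pi * (s + \<delta>))"
  have c: "c \<ge> 0" unfolding c_def using s \<delta> by simp
  have "?om * norm (\<phi> w) powr p = c * (2 * pi * (norm (\<phi> w) powr p * ((s + \<delta>) / 3)))"
  proof -
    have "a * X = a * 3 / (2 * pi * d) * (2 * pi * (X * (d / 3)))" if "d \<noteq> 0" for a d X :: real
      using that by simp
    moreover have "s + \<delta> \<noteq> 0" using s \<delta> by simp
    ultimately show ?thesis unfolding c_def by blast
  qed
  also have "\<dots> \<le> c * integral {0..2*pi} (\<lambda>t'. P t' * (norm (\<phi> (cis t')) powr p * \<delta>' t'))"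
    using main c by (rule mult_left_mono)
  finally have "ennreal (?om * norm (\<phi> w) powr p) \<le> ennreal c * ennreal (integral {0..2*pi} (\<lambda>t'. P t' * (norm (\<phi> (cis t')) powr p * \<delta>' t')))"
    using c by (simp add: ennreal_mult'[symmetric] ennreal_leI)
  also have "ennreal (integral {0..2*pi} (\<lambda>t'. P t' * (norm (\<phi> (cis t')) powr p * \<delta>' t')))
     = (\<integral>\<^sup>+t'. ennreal (P t' * (norm (\<phi> (cis t')) powr p * \<delta>' t')) * indicator {0..2*pi} t' \<partial>lborel)"
  proof (rule nn_integral_interval_eq_integral[symmetric])
    show "continuous_on {0..2*pi} (\<lambda>t'. P t' * (norm (\<phi> (cis t')) powr p * \<delta>' t'))" by (rule cont_int)
  qed (use P_bound \<delta> in \<open>auto intro!: mult_nonneg_nonneg simp: less_imp_le\<close>)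
  also have "ennreal c * \<dots> = (\<integral>\<^sup>+t'. ennreal c * (ennreal (P t' * (norm (\<phi> (cis t')) powr p * \<delta>' t')) * indicator {0..2*pi} t') \<partial>lborel)"
  proof (rule nn_integral_cmult[symmetric])
    have "(\<lambda>t'. P t' * (norm (\<phi> (cis t')) powr p * \<delta>' t')) \<in> borel_measurable borel"
      by (rule borel_measurable_continuous_onI[OF cont_int])
    then show "(\<lambda>t'. ennreal (P t' * (norm (\<phi> (cis t')) powr p * \<delta>' t')) * indicator {0..2*pi} t') \<in> borel_measurable lborel"
      by measurable
  qed
  also have "\<dots> \<le> (\<integral>\<^sup>+t'. 100 * (ennreal ((hardy_ker \<mu> (x t') (\<delta>' t') + hardy_ker \<mu> \<delta> (\<delta>' t')) * norm (\<phi> (cis t')) powr p) * indicator {0..2*pi} t') \<partial>lborel)"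
  proof (rule nn_integral_mono_AE)
    have pw: "c * (P t' * (norm (\<phi> (cis t')) powr p * \<delta>' t')) \<le> 100 * ((hardy_ker \<mu> (x t') (\<delta>' t') + hardy_ker \<mu> \<delta> (\<delta>' t')) * norm (\<phi> (cis t')) powr p)"
      if "x t' \<noteq> 0" for t'
    proof -
      have x: "x t' > 0" using that unfolding x_def by simp
      have tri: "\<delta>' t' \<le> \<delta> + x t'"
      proof -
        have "\<delta>' t' \<le> \<delta> + norm (complex_of_real r * (cis t - cis t'))"
          unfolding \<delta>'_def \<delta>_def using norm_triangle_ineq[of "1 - of_real r * cis t" "complex_of_real r * (cis t - cis t')"]
          by (simp add: algebra_simps)
        also have "norm (complex_of_real r * (cis t - cis t')) \<le> x t'"
          unfolding x_def using r by (simp add: norm_mult mult_left_le_one_le)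
        finally show ?thesis by simp
      qed
      let ?H = "hardy_ker \<mu> (x t') (\<delta>' t') + hardy_ker \<mu> \<delta> (\<delta>' t')"
      have kb: "\<delta>' t' * ?om / (s + \<delta>) * (s / (s + x t')\<^sup>2) \<le> 9 * ?H"
        by (rule kernel_pointwise_bound[OF \<mu> s(1) x \<delta>(1) \<delta>(2) tri])
      have H0: "?H \<ge> 0" using hardy_ker_nonneg \<delta>(2)[of t'] by (simp add: less_imp_le)
      have "c * (P t' * \<delta>' t') \<le> c * (18 * (s / (s + x t')\<^sup>2) * \<delta>' t')"
        using P_bound[of t'] \<delta>(2)[of t'] c by (intro mult_left_mono mult_right_mono) auto
      also have "\<dots> = 27 / pi * (\<delta>' t' * ?om / (s + \<delta>) * (s / (s + x t')\<^sup>2))"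
      proof -
        have "o' * 3 / (2 * pi * D) * (18 * a * b) = 27 / pi * (b * o' / D * a)" for o' D a b :: real
          by (simp add: mult_ac)
        then show ?thesis unfolding c_def by blast
      qed
      also have "\<dots> \<le> 27 / pi * (9 * ?H)" using kb by (intro mult_left_mono) auto
      also have "\<dots> \<le> 100 * ?H"
      proof -
        have "27 / pi * 9 \<le> 100" using pi_gt3 by (simp add: pos_divide_le_eq)
        from mult_right_mono[OF this H0] show ?thesis by simp
      qed
      finally have "c * (P t' * \<delta>' t') * norm (\<phi> (cis t')) powr p \<le> 100 * ?H * norm (\<phi> (cis t')) powr p"
        by (intro mult_right_mono) auto
      then show ?thesis by (simp add: mult_ac)
    qed
    \<comment> \<open>At x = 0 the first kernel is 0 by the convention for \<open>powr\<close>, and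
      the pointwise bound is available for x > 0 only; the exceptional parameters are countably
      many.\<close>
    have "{t'. x t' = 0} \<subseteq> range (\<lambda>i::int. 2 * of_int i * pi + t)"
    proof
      fix t' assume "t' \<in> {t'. x t' = 0}"
      then have "cis (t' - t) = 1" unfolding x_def by (simp add: cis_divide[symmetric])
      then have "sin ((t' - t) / 2) = 0" using norm_one_minus_cis[of "t' - t"] by simp
      then obtain i :: int where "(t' - t) / 2 = of_int i * pi" by (auto simp: sin_zero_iff_int2)
      then have "t' = 2 * of_int i * pi + t" by (simp add: field_simps)
      then show "t' \<in> range (\<lambda>i::int. 2 * of_int i * pi + t)" by blast
    qed
    then have "countable {t'. x t' = 0}" by (rule countable_subset) simp
    then have "AE t' in lborel. t' \<notin> {t'. x t' = 0}"
      by (intro AE_not_in countable_imp_null_set_lborel)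
    then show "AE t' in lborel. ennreal c * (ennreal (P t' * (norm (\<phi> (cis t')) powr p * \<delta>' t')) * indicator {0..2*pi} t')
       \<le> 100 * (ennreal ((hardy_ker \<mu> (x t') (\<delta>' t') + hardy_ker \<mu> \<delta> (\<delta>' t')) * norm (\<phi> (cis t')) powr p) * indicator {0..2*pi} t')"
    proof eventually_elim
      fix t' assume a: "t' \<notin> {t'. x t' = 0}"
      show "ennreal c * (ennreal (P t' * (norm (\<phi> (cis t')) powr p * \<delta>' t')) * indicator {0..2*pi} t')
       \<le> 100 * (ennreal ((hardy_ker \<mu> (x t') (\<delta>' t') + hardy_ker \<mu> \<delta> (\<delta>' t')) * norm (\<phi> (cis t')) powr p) * indicator {0..2*pi} t')"
      proof (cases "t' \<in> {0..2*pi}")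
        case True
        have "ennreal c * ennreal (P t' * (norm (\<phi> (cis t')) powr p * \<delta>' t')) = ennreal (c * (P t' * (norm (\<phi> (cis t')) powr p * \<delta>' t')))"
          using c by (simp add: ennreal_mult')
        also have "\<dots> \<le> ennreal (100 * ((hardy_ker \<mu> (x t') (\<delta>' t') + hardy_ker \<mu> \<delta> (\<delta>' t')) * norm (\<phi> (cis t')) powr p))"
          using pw[of t'] a True by (intro ennreal_leI) auto
        also have "\<dots> = 100 * ennreal ((hardy_ker \<mu> (x t') (\<delta>' t') + hardy_ker \<mu> \<delta> (\<delta>' t')) * norm (\<phi> (cis t')) powr p)"
          by (subst ennreal_mult') auto
        finally show ?thesis using True by simp
      qed simp
    qed
  qed
  also have "\<dots> = 100 * maximal_majorant p \<mu> f r t"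
    unfolding maximal_majorant_def x_def \<delta>'_def \<phi>_def \<delta>_def
  proof (rule nn_integral_cmult)
    have [measurable]: "(\<lambda>t'. f (of_real r * cis t')) \<in> borel_measurable borel"
      by (rule measurable_on_circle[OF cont r])
    show "(\<lambda>t'. ennreal ((hardy_ker \<mu> (cmod (cis t - cis t')) (cmod (1 - of_real r * cis t')) +
              hardy_ker \<mu> (cmod (1 - of_real r * cis t)) (cmod (1 - of_real r * cis t'))) *
             cmod (f (of_real r * cis t')) powr p) * indicator {0..2 * pi} t') \<in> borel_measurable lborel"
      by measurable
  qed
  finally show ?thesis unfolding \<phi>_eq .
qed

lemma norm_one_minus_of_real_cis:
  assumes "0 \<le> r" "r \<le> 1"
  shows "norm (1 - cis t) / 2 \<le> norm (1 - of_real r * cis t)"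
  using one_minus_dist(2)[of r "cis t"] assms by (simp add: scaleR_conv_of_real)

text \<open>Tonelli reduces this to integrating the kernel in t for fixed t'. The first kernel is
  then dominated by a rotation of the one in \<open>hardy_ker_circle_integral\<close>, the second by
  that kernel itself as |1 - r cis t| \<ge> |1 - cis t|/2; each contributes 8/\<mu>, whatever
  \<delta> t' is.\<close>

lemma maximal_majorant_integral:
  fixes f :: "complex \<Rightarrow> complex"
  assumes cont: "continuous_on disc f" and \<mu>: "0 < \<mu>" "\<mu> < 1" and r: "0 \<le> r" "r < 1"
  shows "(\<integral>\<^sup>+t. maximal_majorant p \<mu> f r t * indicator {0..2*pi} t \<partial>lborel) \<le> ennreal (16 / \<mu>) * circle_int p f r"
proof -
  have [measurable]: "(\<lambda>t'. f (of_real r * cis t')) \<in> borel_measurable borel"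
    by (rule measurable_on_circle[OF cont r])
  define \<delta> where "\<delta> t = norm (1 - of_real r * cis t)" for t
  have [measurable]: "\<delta> \<in> borel_measurable borel" unfolding \<delta>_def by measurable
  have \<delta>: "\<delta> t > 0" for t
  proof -
    have "1 - of_real r * cis t \<noteq> 0" using r by (metis eq_iff_diff_eq_0 norm_of_real_cis norm_one order_less_irrefl)
    then show ?thesis unfolding \<delta>_def by auto
  qed
  define k where "k t t' = ennreal (hardy_ker \<mu> (norm (cis t - cis t')) (\<delta> t') + hardy_ker \<mu> (\<delta> t) (\<delta> t'))" for t t'
  define F where "F t' = ennreal (norm (f (of_real r * cis t')) powr p) * indicator {0..2*pi} t'" for t'
  have [measurable]: "F \<in> borel_measurable borel" unfolding F_def by measurable
  have k_meas [measurable]: "(\<lambda>(t, t'). k t t') \<in> borel_measurable (borel \<Otimes>\<^sub>M borel)" unfolding k_def by measurable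
  have k_int: "(\<integral>\<^sup>+t. k t t' * indicator {0..2*pi} t \<partial>lborel) \<le> ennreal (16 / \<mu>)" if t': "0 \<le> t'" "t' \<le> 2*pi" for t'
  proof -
    let ?h = "\<lambda>t. ennreal (hardy_ker \<mu> (norm (1 - cis t) / 2) (\<delta> t'))"
    have hb: "(\<integral>\<^sup>+t. ?h t * indicator {0..2*pi} t \<partial>lborel) \<le> ennreal (8 / \<mu>)"
      by (rule hardy_ker_circle_integral[OF \<mu> \<delta>])
    \<comment> \<open>Rotating by 2*pi - t' rather than by -t' keeps the shift in [0, 2*pi].\<close>
    have hs: "(\<integral>\<^sup>+t. ?h (t + (2*pi - t')) * indicator {0..2*pi} t \<partial>lborel) = (\<integral>\<^sup>+t. ?h t * indicator {0..2*pi} t \<partial>lborel)"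
    proof (rule nn_integral_periodic_shift)
      show "?h \<in> borel_measurable borel" by measurable
      have "cis (t + 2 * pi) = cis t" for t by (simp add: cis_mult[symmetric])
      then show "?h (t + 2 * pi) = ?h t" for t by simp
    qed (use t' in auto)
    have zero: "hardy_ker \<mu> 0 y = 0" for y by (simp add: hardy_ker_def)
    have pw: "k t t' \<le> ?h (t + (2*pi - t')) + ?h t" if ne: "cis t \<noteq> 1" for t
    proof -
      have e1: "norm (1 - cis (t + (2*pi - t'))) = norm (cis t - cis t')"
      proof -
        have "cis (t + (2*pi - t')) = cis t / cis t'"
          by (metis add.commute add_diff_eq cis_2pi cis_divide cis_mult mult.right_neutral)
        then have "1 - cis (t + (2*pi - t')) = (cis t' - cis t) / cis t'" by (simp add: diff_divide_distrib)
        then have "norm (1 - cis (t + (2*pi - t'))) = norm (cis t' - cis t)" by (simp add: norm_divide)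
        then show ?thesis by (simp add: norm_minus_commute)
      qed
      have 1: "hardy_ker \<mu> (norm (cis t - cis t')) (\<delta> t') \<le> hardy_ker \<mu> (norm (1 - cis (t + (2*pi - t'))) / 2) (\<delta> t')"
      proof (cases "norm (cis t - cis t') = 0")
        case True then show ?thesis unfolding e1 by (simp add: zero)
      next
        case False then show ?thesis unfolding e1 using \<mu> \<delta>[of t'] by (intro hardy_ker_antimono) auto
      qed
      have 2: "hardy_ker \<mu> (\<delta> t) (\<delta> t') \<le> hardy_ker \<mu> (norm (1 - cis t) / 2) (\<delta> t')"
        using norm_one_minus_of_real_cis[of r t] r ne \<mu> \<delta>[of t'] by (intro hardy_ker_antimono) (auto simp: \<delta>_def)
      show ?thesis unfolding k_def using 1 2 hardy_ker_nonneg \<delta>[of t']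
        by (subst ennreal_plus[symmetric]) (auto intro!: ennreal_leI add_mono simp: less_imp_le simp del: ennreal_plus)
    qed
    have ne: "cis t \<noteq> 1" if "t \<in> {0..2*pi}" "t \<noteq> 0" "t \<noteq> 2 * pi" for t
      using that by (intro cis_ne_one) auto
    have "(\<integral>\<^sup>+t. k t t' * indicator {0..2*pi} t \<partial>lborel)
      \<le> (\<integral>\<^sup>+t. ?h (t + (2*pi - t')) * indicator {0..2*pi} t + ?h t * indicator {0..2*pi} t \<partial>lborel)"
    proof (rule nn_integral_mono_AE)
      show "AE t in lborel. k t t' * indicator {0..2*pi} t \<le> ?h (t + (2*pi - t')) * indicator {0..2*pi} t + ?h t * indicator {0..2*pi} t"
        using AE_lborel_singleton[of "2*pi"] AE_lborel_singleton[of 0]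
        by eventually_elim (use pw ne in \<open>auto simp: indicator_def\<close>)
    qed
    also have "\<dots> = (\<integral>\<^sup>+t. ?h (t + (2*pi - t')) * indicator {0..2*pi} t \<partial>lborel) + (\<integral>\<^sup>+t. ?h t * indicator {0..2*pi} t \<partial>lborel)"
      by (rule nn_integral_add) auto
    also have "\<dots> \<le> ennreal (8 / \<mu>) + ennreal (8 / \<mu>)" unfolding hs by (intro add_mono hb)
    also have "\<dots> = ennreal (16 / \<mu>)" using \<mu> by (simp add: ennreal_plus[symmetric] del: ennreal_plus)
    finally show ?thesis .
  qed
  have "(\<integral>\<^sup>+t. maximal_majorant p \<mu> f r t * indicator {0..2*pi} t \<partial>lborel)
    = (\<integral>\<^sup>+t. (\<integral>\<^sup>+t'. (k t t' * indicator {0..2*pi} t) * F t' \<partial>lborel) \<partial>lborel)"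
  proof (rule nn_integral_cong)
    fix t :: real
    have k0: "hardy_ker \<mu> (norm (cis t - cis t')) (\<delta> t') + hardy_ker \<mu> (\<delta> t) (\<delta> t') \<ge> 0" for t'
      using hardy_ker_nonneg \<delta>[of t'] by (simp add: less_imp_le)
    have "maximal_majorant p \<mu> f r t = (\<integral>\<^sup>+t'. k t t' * F t' \<partial>lborel)"
      unfolding maximal_majorant_def k_def F_def \<delta>_def[symmetric]
      using k0 by (intro nn_integral_cong) (simp add: ennreal_mult mult.assoc)
    then show "maximal_majorant p \<mu> f r t * indicator {0..2*pi} t = (\<integral>\<^sup>+t'. (k t t' * indicator {0..2*pi} t) * F t' \<partial>lborel)"
      by (auto simp: indicator_def)
  qed
  also have "\<dots> = (\<integral>\<^sup>+t'. (\<integral>\<^sup>+t. (k t t' * indicator {0..2*pi} t) * F t' \<partial>lborel) \<partial>lborel)"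
    by (rule lborel_pair.Fubini'[symmetric]) (simp add: lborel_prod[symmetric] cong: measurable_cong_sets)
  also have "\<dots> = (\<integral>\<^sup>+t'. (\<integral>\<^sup>+t. k t t' * indicator {0..2*pi} t \<partial>lborel) * F t' \<partial>lborel)"
    by (intro nn_integral_cong nn_integral_multc) measurable
  also have "\<dots> \<le> (\<integral>\<^sup>+t'. ennreal (16 / \<mu>) * F t' \<partial>lborel)"
  proof (rule nn_integral_mono)
    fix t' :: real
    show "(\<integral>\<^sup>+t. k t t' * indicator {0..2*pi} t \<partial>lborel) * F t' \<le> ennreal (16 / \<mu>) * F t'"
    proof (cases "t' \<in> {0..2*pi}")
      case True
      then show ?thesis using k_int[of t'] by (intro mult_right_mono) auto
    qed (simp add: F_def)
  qed
  also have "\<dots> = ennreal (16 / \<mu>) * circle_int p f r"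
    unfolding circle_int_def F_def[symmetric] by (rule nn_integral_cmult) measurable
  finally show ?thesis .
qed

section \<open>The symbol and the kernel of the operator\<close>

text \<open>Turns the line integrals that define \<open>T_op\<close> and \<open>S_op\<close> into
  normalised antiderivatives, so that identities between the operators can be checked by
  differentiating.\<close>

lemma disc_primitive:
  assumes q: "q holomorphic_on disc"
  defines "Q \<equiv> \<lambda>z. contour_integral (linepath 0 z) q"
  shows "Q 0 = 0" "z \<in> disc \<Longrightarrow> (Q has_field_derivative q z) (at z)"
    "Q holomorphic_on disc" "z \<in> disc \<Longrightarrow> deriv Q z = q z"
proof -
  show 0: "Q 0 = 0" unfolding Q_def by simp
  obtain H where H: "\<And>x. x \<in> disc \<Longrightarrow> (H has_field_derivative q x) (at x within disc)"
    using holomorphic_convex_primitive'[OF convex_ball open_ball q] by metis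
  have H': "(H has_field_derivative q x) (at x)" if "x \<in> disc" for x
    using H[OF that] unfolding at_within_open[OF that open_ball] .
  have Q: "Q z = H z - H 0" if "z \<in> disc" for z
  proof -
    have "path_image (linepath 0 z) \<subseteq> disc" using that by (simp add: closed_segment_subset)
    then have "(q has_contour_integral (H (pathfinish (linepath 0 z)) - H (pathstart (linepath 0 z)))) (linepath 0 z)"
      by (intro contour_integral_primitive[OF H valid_path_linepath])
    then show ?thesis unfolding Q_def by (simp only: contour_integral_unique pathstart_linepath pathfinish_linepath)
  qed
  have D: "(Q has_field_derivative q z) (at z)" if "z \<in> disc" for z
  proof -
    have "((\<lambda>z. H z - H 0) has_field_derivative q z) (at z)" using DERIV_diff[OF H'[OF that] DERIV_const[of "H 0"]] by simp
    then show ?thesis by (rule has_field_derivative_transform_within_open[of _ _ _ disc]) (use that Q in auto)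
  qed
  then show "z \<in> disc \<Longrightarrow> (Q has_field_derivative q z) (at z)" .
  from D show "z \<in> disc \<Longrightarrow> deriv Q z = q z" by (rule DERIV_imp_deriv)
  show "Q holomorphic_on disc" using D unfolding holomorphic_on_open[OF open_ball] by blast
qed

lemma disc_primitive_unique:
  assumes H: "\<And>z. z \<in> disc \<Longrightarrow> (H has_field_derivative q z) (at z)" and z: "z \<in> disc"
  shows "contour_integral (linepath 0 z) q = H z - H 0"
proof -
  have "path_image (linepath 0 z) \<subseteq> disc" using z by (simp add: closed_segment_subset)
  then have "(q has_contour_integral (H (pathfinish (linepath 0 z)) - H (pathstart (linepath 0 z)))) (linepath 0 z)"
    by (intro contour_integral_primitive[OF has_field_derivative_at_within[OF H] valid_path_linepath])
  then show ?thesis by (simp only: contour_integral_unique pathstart_linepath pathfinish_linepath)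
qed

lemma T_op_holomorphic:
  assumes "u holomorphic_on disc" "f holomorphic_on disc"
  shows "T_op u f holomorphic_on disc" "T_op u f 0 = 0"
    "z \<in> disc \<Longrightarrow> (T_op u f has_field_derivative f z * deriv u z) (at z)"
proof -
  have "(\<lambda>z. f z * deriv u z) holomorphic_on disc"
    by (intro holomorphic_on_mult holomorphic_deriv assms open_ball)
  note P = disc_primitive[OF this]
  show "T_op u f holomorphic_on disc" "T_op u f 0 = 0" unfolding T_op_def[abs_def] by (rule P)+
  show "z \<in> disc \<Longrightarrow> (T_op u f has_field_derivative f z * deriv u z) (at z)" unfolding T_op_def[abs_def] by (rule P)
qed

lemma S_op_holomorphic:
  assumes "u holomorphic_on disc" "f holomorphic_on disc"
  shows "S_op u f holomorphic_on disc" "S_op u f 0 = 0"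
    "z \<in> disc \<Longrightarrow> (S_op u f has_field_derivative deriv f z * u z) (at z)"
proof -
  have "(\<lambda>z. deriv f z * u z) holomorphic_on disc"
    by (intro holomorphic_on_mult holomorphic_deriv assms open_ball)
  note P = disc_primitive[OF this]
  show "S_op u f holomorphic_on disc" "S_op u f 0 = 0" unfolding S_op_def[abs_def] by (rule P)+
  show "z \<in> disc \<Longrightarrow> (S_op u f has_field_derivative deriv f z * u z) (at z)" unfolding S_op_def[abs_def] by (rule P)
qed

definition STT :: "(complex \<Rightarrow> complex) \<Rightarrow> (complex \<Rightarrow> complex) \<Rightarrow> complex \<Rightarrow> complex" where
  "STT u f = S_op u (T_op u (T_op u f))"

lemma STT_holomorphic:
  assumes "u holomorphic_on disc" "f holomorphic_on disc"
  shows "STT u f holomorphic_on disc" "STT u f 0 = 0"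
    "z \<in> disc \<Longrightarrow> (STT u f has_field_derivative T_op u f z * deriv u z * u z) (at z)"
proof -
  have F: "T_op u f holomorphic_on disc" by (rule T_op_holomorphic[OF assms])
  have G: "T_op u (T_op u f) holomorphic_on disc" by (rule T_op_holomorphic[OF assms(1) F])
  show "STT u f holomorphic_on disc" "STT u f 0 = 0" unfolding STT_def
    by (rule S_op_holomorphic[OF assms(1) G])+
  assume z: "z \<in> disc"
  show "(STT u f has_field_derivative T_op u f z * deriv u z * u z) (at z)" unfolding STT_def
    using S_op_holomorphic(3)[OF assms(1) G z] DERIV_imp_deriv[OF T_op_holomorphic(3)[OF assms(1) F z]] by simp
qed

text \<open>Integration by parts in place of a double integral: with V the antiderivative of v u' f,
  both sides equal v(z) * T_op u f z - V(z).\<close>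

lemma STT_eq_integral:
  assumes u: "u holomorphic_on disc" and f: "f holomorphic_on disc" and z: "z \<in> disc"
  shows "STT u f z = contour_integral (linepath 0 z) (\<lambda>w. ((u z)\<^sup>2 / 2 - (u w)\<^sup>2 / 2) * deriv u w * f w)"
proof -
  define v where "v w = (u w)\<^sup>2 / 2" for w
  have du: "(u has_field_derivative deriv u w) (at w)" if "w \<in> disc" for w
    using u that by (simp add: holomorphic_derivI)
  have dv: "(v has_field_derivative u w * deriv u w) (at w)" if "w \<in> disc" for w
    unfolding v_def using DERIV_cdivide[OF DERIV_power[OF du[OF that], of 2], of 2] by (simp add: mult.commute)
  have q: "(\<lambda>w. v w * deriv u w * f w) holomorphic_on disc"
    unfolding v_def using holomorphic_deriv[OF u open_ball] u f by (intro holomorphic_intros) auto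
  define V where "V z = contour_integral (linepath 0 z) (\<lambda>w. v w * deriv u w * f w)" for z
  have V: "V 0 = 0" "\<And>w. w \<in> disc \<Longrightarrow> (V has_field_derivative v w * deriv u w * f w) (at w)"
    unfolding V_def using disc_primitive[OF q] by auto
  have "((\<lambda>w. v w * T_op u f w - V w) has_field_derivative (T_op u f w * deriv u w * u w)) (at w)" if w: "w \<in> disc" for w
  proof -
    have "((\<lambda>w. v w * T_op u f w - V w) has_field_derivative
      (u w * deriv u w * T_op u f w + f w * deriv u w * v w - v w * deriv u w * f w)) (at w)"
      by (intro DERIV_diff DERIV_mult dv w T_op_holomorphic u f V)
    then show ?thesis by (simp add: mult_ac)
  qed
  from disc_primitive_unique[OF this z]
  have "contour_integral (linepath 0 z) (\<lambda>w. T_op u f w * deriv u w * u w) = v z * T_op u f z - V z"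
    using V(1) T_op_holomorphic(2)[OF u f] by simp
  moreover have "contour_integral (linepath 0 z) (\<lambda>w. T_op u f w * deriv u w * u w) = STT u f z"
    using disc_primitive_unique[OF STT_holomorphic(3)[OF u f] z] STT_holomorphic(2)[OF u f] by simp
  ultimately have "STT u f z = v z * T_op u f z - V z" by simp
  \<comment> \<open>Here v is frozen at the endpoint z, so \<open>v z\<close> is a constant for the
    differentiation.\<close>
  moreover have "((\<lambda>w. v z * T_op u f w - V w) has_field_derivative ((u z)\<^sup>2 / 2 - (u w)\<^sup>2 / 2) * deriv u w * f w) (at w)"
    if w: "w \<in> disc" for w
  proof -
    have "((\<lambda>w. v z * T_op u f w - V w) has_field_derivative (v z * (f w * deriv u w) - v w * deriv u w * f w)) (at w)"
      by (intro DERIV_diff DERIV_cmult w T_op_holomorphic u f V)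
    then show ?thesis by (simp add: v_def algebra_simps)
  qed
  from disc_primitive_unique[OF this z]
  have "contour_integral (linepath 0 z) (\<lambda>w. ((u z)\<^sup>2 / 2 - (u w)\<^sup>2 / 2) * deriv u w * f w) = v z * T_op u f z - V z"
    using V(1) T_op_holomorphic(2)[OF u f] by simp
  ultimately show ?thesis by simp
qed

section \<open>Size and oscillation of the symbol g and its powers\<close>

lemma scaled_in_disc: "z \<in> disc \<Longrightarrow> 0 \<le> t \<Longrightarrow> t \<le> 1 \<Longrightarrow> t *\<^sub>R z \<in> disc" for z :: complex
  using mult_left_le_one_le[of "norm z" t] by simp

lemma Re_one_minus_pos: "z \<in> disc \<Longrightarrow> Re (1 - z) > 0"
  using abs_Re_le_cmod[of z] by auto

text \<open>1 - z lies in the right half plane, so 1 - Ln (1 - z) stays in the strip where Ln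
  inverts exp.\<close>

lemma g_fun_eq:
  assumes "z \<in> disc"
  shows "g_fun z = 1 - Ln (1 - z)"
proof -
  have r: "Re (1 - z) > 0" by (rule Re_one_minus_pos[OF assms])
  then have nz: "1 - z \<noteq> 0" by auto
  have "\<bar>Im (Ln (1 - z))\<bar> < pi / 2" using Re_Ln_pos_lt_imp[OF r] .
  then have "Ln (exp (1 - Ln (1 - z))) = 1 - Ln (1 - z)" by (intro Ln_exp) (auto simp: abs_less_iff)
  moreover have "exp (1 - Ln (1 - z)) = exp 1 / (1 - z)" using nz by (simp add: exp_diff)
  ultimately show ?thesis unfolding g_fun_def by simp
qed

text \<open>The bound 3/10 comes from |1-z| \<le> 2 and ln 2 < 7/10; it keeps negative powers of |g|
  bounded. The bound on Im g is what puts g in BMOA.\<close>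

lemma g_fun_Re_Im:
  assumes "z \<in> disc"
  shows "Re (g_fun z) = 1 - ln (norm (1 - z))" "\<bar>Im (g_fun z)\<bar> < pi / 2" "Re (g_fun z) > 3/10"
proof -
  have r: "Re (1 - z) > 0" by (rule Re_one_minus_pos[OF assms])
  then have nz: "1 - z \<noteq> 0" by auto
  show re: "Re (g_fun z) = 1 - ln (norm (1 - z))" using nz by (simp add: g_fun_eq[OF assms])
  show "\<bar>Im (g_fun z)\<bar> < pi / 2" using Re_Ln_pos_lt_imp[OF r] by (simp add: g_fun_eq[OF assms])
  have "norm (1 - z) \<le> 2" using assms norm_triangle_ineq4[of 1 z] by simp
  then have "ln (norm (1 - z)) \<le> ln 2" using nz by simp
  also have "ln 2 < (7/10 :: real)" using ln2_le_25_over_36 by simp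
  finally show "Re (g_fun z) > 3/10" using re by simp
qed

lemma g_fun_holomorphic: "g_fun holomorphic_on disc"
  and g_fun_has_derivative: "z \<in> disc \<Longrightarrow> (g_fun has_field_derivative 1 / (1 - z)) (at z)"
  and deriv_g_fun: "z \<in> disc \<Longrightarrow> deriv g_fun z = 1 / (1 - z)"
proof -
  have D: "(g_fun has_field_derivative 1 / (1 - z)) (at z)" if z: "z \<in> disc" for z
  proof -
    have "1 - z \<notin> \<real>\<^sub>\<le>\<^sub>0" using Re_one_minus_pos[OF z] by (auto simp: complex_nonpos_Reals_iff)
    then have "((\<lambda>z. 1 - Ln (1 - z)) has_field_derivative 1 / (1 - z)) (at z)"
      by (auto intro!: derivative_eq_intros simp: divide_inverse)
    then show ?thesis by (rule has_field_derivative_transform_within_open[of _ _ _ disc]) (use z in \<open>auto simp: g_fun_eq\<close>)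
  qed
  then show "g_fun holomorphic_on disc" unfolding holomorphic_on_open[OF open_ball] by blast
  show "z \<in> disc \<Longrightarrow> (g_fun has_field_derivative 1 / (1 - z)) (at z)" by (rule D)
  then show "z \<in> disc \<Longrightarrow> deriv g_fun z = 1 / (1 - z)" by (rule DERIV_imp_deriv)
qed

lemma g_fun_nz: "z \<in> disc \<Longrightarrow> g_fun z \<noteq> 0" "z \<in> disc \<Longrightarrow> g_fun z \<notin> \<real>\<^sub>\<le>\<^sub>0" "z \<in> disc \<Longrightarrow> norm (g_fun z) > 3/10"
  using g_fun_Re_Im(3)[of z] complex_Re_le_cmod[of "g_fun z"] by (auto simp: complex_nonpos_Reals_iff)

lemma norm_cpow_g:
  assumes "z \<in> disc"
  shows "norm (cpow_fun g_fun (of_real b) z) = norm (g_fun z) powr b"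
  using g_fun_nz(1)[OF assms] by (simp add: cpow_fun_def powr_def)

lemma cpow_g_holomorphic: "cpow_fun g_fun (of_real b) holomorphic_on disc"
  and deriv_cpow_g: "z \<in> disc \<Longrightarrow> deriv (cpow_fun g_fun (of_real b)) z = of_real b * cpow_fun g_fun (of_real (b - 1)) z / (1 - z)"
proof -
  have D: "(cpow_fun g_fun (of_real b) has_field_derivative of_real b * cpow_fun g_fun (of_real (b - 1)) z / (1 - z)) (at z)"
    if z: "z \<in> disc" for z
  proof -
    have "((\<lambda>z. exp (of_real b * Ln (g_fun z))) has_field_derivative
        exp (of_real b * Ln (g_fun z)) * (of_real b * (inverse (g_fun z) * (1 / (1 - z))))) (at z)"
      by (intro DERIV_chain2[OF DERIV_exp] DERIV_cmult DERIV_chain2[OF has_field_derivative_Ln]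
        g_fun_has_derivative z g_fun_nz(2)[OF z])
    moreover have "exp (of_real (b - 1) * Ln (g_fun z)) = exp (of_real b * Ln (g_fun z)) * inverse (g_fun z)"
    proof -
      have "of_real (b - 1) * Ln (g_fun z) = of_real b * Ln (g_fun z) - Ln (g_fun z)"
        by (simp add: left_diff_distrib)
      then show ?thesis by (simp only: exp_diff exp_Ln[OF g_fun_nz(1)[OF z]] divide_inverse)
    qed
    ultimately show ?thesis unfolding cpow_fun_def[abs_def] by (simp add: divide_inverse mult_ac)
  qed
  then show "cpow_fun g_fun (of_real b) holomorphic_on disc" unfolding holomorphic_on_open[OF open_ball] by blast
  from D show "z \<in> disc \<Longrightarrow> deriv (cpow_fun g_fun (of_real b)) z = of_real b * cpow_fun g_fun (of_real (b - 1)) z / (1 - z)" 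
    by (rule DERIV_imp_deriv)
qed

lemma cpow_square: "(cpow_fun h (of_real b) z)\<^sup>2 = cpow_fun h (of_real (2 * b)) z"
  by (simp add: cpow_fun_def exp_double[symmetric] mult.assoc)

text \<open>The mean value inequality on a convex set, the right half plane cut by a disc. For
  \<gamma> \<ge> 1 the modulus \<gamma> |z| powr (\<gamma> - 1) of the derivative is controlled by
  the radius of that disc. It is used with \<gamma> = 2 \<beta>, which is why \<beta> > 1/2 enters
  the kernel estimate.\<close>

lemma exp_Ln_diff_bound:
  fixes a b :: complex
  assumes a: "Re a > 0" and b: "Re b > 0" and \<gamma>: "\<gamma> \<ge> 1"
  shows "norm (exp (of_real \<gamma> * Ln a) - exp (of_real \<gamma> * Ln b)) \<le> \<gamma> * (max (norm a) (norm b)) powr (\<gamma> - 1) * norm (a - b)"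
proof -
  define S where "S = {z. Re z > 0} \<inter> cball 0 (max (norm a) (norm b))"
  have "convex S" unfolding S_def by (intro convex_Int convex_halfspace_Re_gt convex_cball)
  moreover have "((\<lambda>z. exp (of_real \<gamma> * Ln z)) has_field_derivative (exp (of_real \<gamma> * Ln z) * (of_real \<gamma> / z))) (at z within S)"
    if "z \<in> S" for z
  proof -
    have "z \<notin> \<real>\<^sub>\<le>\<^sub>0" using that by (auto simp: S_def complex_nonpos_Reals_iff)
    then show ?thesis by (auto intro!: derivative_eq_intros simp: divide_inverse)
  qed
  moreover have "norm (exp (of_real \<gamma> * Ln z) * (of_real \<gamma> / z)) \<le> \<gamma> * (max (norm a) (norm b)) powr (\<gamma> - 1)" if "z \<in> S" for z
  proof -
    have z: "z \<noteq> 0" "norm z \<le> max (norm a) (norm b)" using that by (auto simp: S_def)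
    have "norm (exp (of_real \<gamma> * Ln z) * (of_real \<gamma> / z)) = \<gamma> * (norm z powr \<gamma> / norm z)"
      using z \<gamma> by (simp add: norm_mult norm_divide powr_def)
    also have "norm z powr \<gamma> / norm z = norm z powr (\<gamma> - 1)" using z by (simp add: powr_diff)
    also have "\<gamma> * \<dots> \<le> \<gamma> * (max (norm a) (norm b)) powr (\<gamma> - 1)"
      using z \<gamma> by (intro mult_left_mono powr_mono2) auto
    finally show ?thesis .
  qed
  ultimately show ?thesis
    by (rule field_differentiable_bound[of S]) (use a b in \<open>auto simp: S_def\<close>)
qed

text \<open>Re g is 1 minus the logarithm of the distance to 1, and this distance at w lies between
  \<delta>/2 and s + \<delta>, so the real parts differ by at most the logarithm plus ln 2. The
  imaginary parts differ by less than pi; the 4 covers 7/10 + 32/10.\<close>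

lemma g_fun_diff_bound:
  assumes z: "z \<in> disc" and s: "0 \<le> s" "s \<le> 1"
  shows "norm (g_fun z - g_fun ((1 - s) *\<^sub>R z)) \<le> ln ((s + norm (1 - z)) / norm (1 - z)) + 4"
proof -
  define w where "w = (1 - s) *\<^sub>R z"
  define \<delta> where "\<delta> = norm (1 - z)"
  have w: "w \<in> disc" using z s unfolding w_def by (intro scaled_in_disc) auto
  have \<delta>: "\<delta> > 0" unfolding \<delta>_def using Re_one_minus_pos[OF z] by auto
  have nw: "norm (1 - w) > 0" using Re_one_minus_pos[OF w] by auto
  have b: "\<delta> / 2 \<le> norm (1 - w)" "norm (1 - w) \<le> s + \<delta>"
    using one_minus_dist(2,3)[of "1 - s" z] z s by (auto simp: w_def \<delta>_def)
  have "ln (norm (1 - w)) \<le> ln (s + \<delta>)" using b nw \<delta> s by (subst ln_le_cancel_iff) auto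
  moreover have "ln (norm (1 - w)) \<ge> ln (\<delta> / 2)" using b nw \<delta> by (subst ln_le_cancel_iff) auto
  moreover have "ln (\<delta> / 2) = ln \<delta> - ln 2" using \<delta> by (simp add: ln_div)
  moreover have "ln ((s + \<delta>) / \<delta>) = ln (s + \<delta>) - ln \<delta>" using \<delta> s by (simp add: ln_div)
  moreover have "ln ((s + \<delta>) / \<delta>) \<ge> 0" using \<delta> s by (intro ln_ge_zero) simp
  moreover have "ln 2 < (7/10 :: real)" using ln2_le_25_over_36 by simp
  ultimately have re: "\<bar>Re (g_fun z - g_fun w)\<bar> \<le> ln ((s + \<delta>) / \<delta>) + 7/10"
    using g_fun_Re_Im(1)[OF z] g_fun_Re_Im(1)[OF w] unfolding \<delta>_def[symmetric] by simp
  have im: "\<bar>Im (g_fun z - g_fun w)\<bar> \<le> 32/10"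
  proof -
    have "pi < 32/10" using pi_approx by simp
    then show ?thesis using g_fun_Re_Im(2)[OF z] g_fun_Re_Im(2)[OF w] unfolding minus_complex.sel by arith
  qed
  show ?thesis using re im cmod_le[of "g_fun z - g_fun w"] unfolding w_def \<delta>_def by linarith
qed

text \<open>The difference of squares contributes |g w| powr (2 \<beta> - 1), the derivative |g w|
  powr (\<beta> - 1) / |1-w|. What remains is quadratic in D = |g z - g w| \<le> ln q + 4, and every
  positive power of q dominates that.\<close>

lemma cpow_kernel_bound:
  assumes \<beta>: "1/2 < \<beta>" "\<beta> < 2/3" and \<eta>: "\<eta> > 0" and z: "z \<in> disc" and s: "0 < s" "s \<le> 1"
  defines "u \<equiv> cpow_fun g_fun (of_real \<beta>)" and "w \<equiv> (1 - s) *\<^sub>R z" and "\<delta> \<equiv> norm (1 - z)"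
  shows "norm (((u z)\<^sup>2 / 2 - (u w)\<^sup>2 / 2) * deriv u w)
    \<le> 3 * (17 + 8 / \<eta>)\<^sup>2 * ((s + \<delta>) / \<delta>) powr \<eta> * norm (g_fun w) powr (3 * \<beta> - 2) / (s + \<delta>)"
proof -
  have w: "w \<in> disc" using z s unfolding w_def by (intro scaled_in_disc) auto
  have \<delta>: "\<delta> > 0" unfolding \<delta>_def using Re_one_minus_pos[OF z] by auto
  define D where "D = norm (g_fun z - g_fun w)"
  define q where "q = (s + \<delta>) / \<delta>"
  have q: "q \<ge> 1" unfolding q_def using \<delta> s by simp
  define b where "b = norm (g_fun w)"
  have b: "b > 3/10" unfolding b_def by (rule g_fun_nz(3)[OF w])
  have D: "0 \<le> D" "D \<le> ln q + 4" unfolding D_def q_def w_def \<delta>_def using g_fun_diff_bound[OF z, of s] s by auto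
  have "ln q \<le> q powr (\<eta> / 2) / (\<eta> / 2)" using ln_powr_bound[of q "\<eta> / 2"] q \<eta> by simp
  then have lnq: "4 * ln q \<le> 8 / \<eta> * q powr (\<eta> / 2)" by (simp add: field_simps)
  have "1 \<le> q powr (\<eta> / 2)" using q \<eta> by (simp add: ge_one_powr_ge_zero)
  \<comment> \<open>1 + 4 D \<le> 17 + 4 ln q. Two such factors are spent below, hence the exponent
    \<eta>/2.\<close>
  then have D4: "1 + 4 * D \<le> (17 + 8 / \<eta>) * q powr (\<eta> / 2)" using D lnq by (simp add: algebra_simps)
  \<comment> \<open>b > 3/10 > 1/4 gives D \<le> 4 b D, so |g z| \<le> b + D becomes a multiple of b
    and all powers of |g| can be taken at w.\<close>
  have maxb: "max (norm (g_fun z)) b \<le> b * (1 + 4 * D)"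
  proof -
    have "norm (g_fun z) \<le> b + D" unfolding b_def D_def using norm_triangle_ineq[of "g_fun w" "g_fun z - g_fun w"] by simp
    moreover have "D \<le> b * (4 * D)" using b D mult_right_mono[of 1 "b * 4" D] by simp
    ultimately show ?thesis using b D by (simp add: algebra_simps)
  qed
  have "norm ((u z)\<^sup>2 / 2 - (u w)\<^sup>2 / 2) = norm (exp (of_real (2 * \<beta>) * Ln (g_fun z)) - exp (of_real (2 * \<beta>) * Ln (g_fun w))) / 2"
    unfolding u_def cpow_square by (simp add: cpow_fun_def diff_divide_distrib[symmetric] norm_divide)
  also have "\<dots> \<le> (2 * \<beta>) * (max (norm (g_fun z)) b) powr (2 * \<beta> - 1) * D / 2"
    unfolding b_def D_def using exp_Ln_diff_bound[of "g_fun z" "g_fun w" "2 * \<beta>"] g_fun_Re_Im(3)[OF z] g_fun_Re_Im(3)[OF w] \<beta>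
    by (intro divide_right_mono) auto
  also have "\<dots> \<le> (2 * \<beta>) * (b powr (2 * \<beta> - 1) * (1 + 4 * D)) * D / 2"
  proof -
    have "(max (norm (g_fun z)) b) powr (2 * \<beta> - 1) \<le> (b * (1 + 4 * D)) powr (2 * \<beta> - 1)"
      using maxb \<beta> b by (intro powr_mono2) auto
    also have "\<dots> = b powr (2 * \<beta> - 1) * (1 + 4 * D) powr (2 * \<beta> - 1)" using b D by (simp add: powr_mult)
    also have "\<dots> \<le> b powr (2 * \<beta> - 1) * (1 + 4 * D)"
      using D \<beta> powr_mono[of "2 * \<beta> - 1" 1 "1 + 4 * D"] by (intro mult_left_mono) auto
    finally show ?thesis using \<beta> D by (intro divide_right_mono mult_right_mono mult_left_mono) auto
  qed
  finally have n1: "norm ((u z)\<^sup>2 / 2 - (u w)\<^sup>2 / 2) \<le> \<beta> * (b powr (2 * \<beta> - 1) * (1 + 4 * D)) * D" by simp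
  have n2: "norm (deriv u w) \<le> \<beta> * b powr (\<beta> - 1) * (3 / (s + \<delta>))"
  proof -
    have "(s + \<delta>) / 3 \<le> norm (1 - w)"
      using one_minus_dist(1,2)[of "1 - s" z] z s by (auto simp: w_def \<delta>_def)
    then have "1 / norm (1 - w) \<le> 1 / ((s + \<delta>) / 3)" using \<delta> s by (intro frac_le) auto
    then have *: "1 / norm (1 - w) \<le> 3 / (s + \<delta>)" by simp
    have "norm (deriv u w) = \<beta> * b powr (\<beta> - 1) * (1 / norm (1 - w))"
      unfolding u_def deriv_cpow_g[OF w] b_def using \<beta> by (simp add: norm_mult norm_divide norm_cpow_g[OF w] del: of_real_diff)
    also have "\<dots> \<le> \<beta> * b powr (\<beta> - 1) * (3 / (s + \<delta>))" using * \<beta> by (intro mult_left_mono) auto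
    finally show ?thesis .
  qed
  have "norm (((u z)\<^sup>2 / 2 - (u w)\<^sup>2 / 2) * deriv u w) \<le> (\<beta> * (b powr (2 * \<beta> - 1) * (1 + 4 * D)) * D) * (\<beta> * b powr (\<beta> - 1) * (3 / (s + \<delta>)))"
    unfolding norm_mult using n1 n2 D b \<beta> by (intro mult_mono) auto
  also have "\<dots> = (\<beta> * \<beta>) * (3 * ((1 + 4 * D) * D) * (b powr (2 * \<beta> - 1) * b powr (\<beta> - 1)) / (s + \<delta>))"
    by (simp add: mult_ac)
  also have "b powr (2 * \<beta> - 1) * b powr (\<beta> - 1) = b powr (3 * \<beta> - 2)" by (simp add: powr_add[symmetric])
  also have "(\<beta> * \<beta>) * (3 * ((1 + 4 * D) * D) * b powr (3 * \<beta> - 2) / (s + \<delta>))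
    \<le> 1 * (3 * ((17 + 8 / \<eta>)\<^sup>2 * q powr \<eta>) * b powr (3 * \<beta> - 2) / (s + \<delta>))"
  proof -
    have "\<beta> * \<beta> \<le> 1" using \<beta> by (intro mult_le_one) auto
    moreover have "(1 + 4 * D) * D \<le> (17 + 8 / \<eta>)\<^sup>2 * q powr \<eta>"
    proof -
      have "(1 + 4 * D) * D \<le> (1 + 4 * D) * (1 + 4 * D)" using D by (intro mult_left_mono) auto
      also have "\<dots> \<le> ((17 + 8 / \<eta>) * q powr (\<eta> / 2)) * ((17 + 8 / \<eta>) * q powr (\<eta> / 2))"
        using D4 D \<eta> by (intro mult_mono) auto
      also have "\<dots> = (17 + 8 / \<eta>)\<^sup>2 * q powr \<eta>"
        using powr_add[of q "\<eta>/2" "\<eta>/2"] by (simp add: power2_eq_square mult_ac)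
      finally show ?thesis .
    qed
    then have "3 * ((1 + 4 * D) * D) * b powr (3 * \<beta> - 2) / (s + \<delta>) \<le> 3 * ((17 + 8 / \<eta>)\<^sup>2 * q powr \<eta>) * b powr (3 * \<beta> - 2) / (s + \<delta>)"
      using \<delta> s by (intro divide_right_mono mult_right_mono mult_left_mono) auto
    moreover have "0 \<le> 3 * ((1 + 4 * D) * D) * b powr (3 * \<beta> - 2) / (s + \<delta>)"
      using D \<delta> s by simp
    ultimately show ?thesis by (intro mult_mono) auto
  qed
  finally show ?thesis unfolding q_def b_def by (simp add: mult_ac)
qed

text \<open>Close to 1, |g| \<ge> 1 - ln |1-w| makes the negative power small; elsewhere |1-w| is
  bounded below and |g| > 3/10 suffices. The remainder is linear in |1-w| so that |1-w| \<le> s +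
  \<delta> can cancel the denominator of the kernel.\<close>

lemma g_fun_powr_small:
  assumes \<kappa>: "0 < \<kappa>" "\<kappa> \<le> 1" and e: "e > 0"
  obtains K where "K > 0" "\<And>w. w \<in> disc \<Longrightarrow> norm (g_fun w) powr (- \<kappa>) \<le> e + K * norm (1 - w)"
proof -
  \<comment> \<open>Chosen so that - ln \<rho> = e powr (-1/\<kappa>), whose power -\<kappa> is
    e.\<close>
  define \<rho> where "\<rho> = exp (- (e powr (- 1 / \<kappa>)))"
  have \<rho>: "\<rho> > 0" unfolding \<rho>_def by simp
  have "norm (g_fun w) powr (- \<kappa>) \<le> e + (4 / \<rho>) * norm (1 - w)" if w: "w \<in> disc" for w
  proof (cases "norm (1 - w) \<le> \<rho>")
    case True
    have nw: "norm (1 - w) > 0" using Re_one_minus_pos[OF w] by auto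
    have "ln (norm (1 - w)) \<le> ln \<rho>" using True nw \<rho> by (subst ln_le_cancel_iff) auto
    then have "e powr (- 1 / \<kappa>) \<le> norm (g_fun w)"
      using g_fun_Re_Im(1)[OF w] complex_Re_le_cmod[of "g_fun w"] unfolding \<rho>_def by simp
    then have "norm (g_fun w) powr (- \<kappa>) \<le> (e powr (- 1 / \<kappa>)) powr (- \<kappa>)"
      using \<kappa> e by (intro powr_mono2') auto
    also have "\<dots> = e" using \<kappa> e by (simp add: powr_powr)
    finally show ?thesis using \<rho> by (simp add: add_increasing2)
  next
    case False
    have "norm (g_fun w) powr (- \<kappa>) \<le> (3/10) powr (- \<kappa>)"
      using g_fun_nz(3)[OF w] \<kappa> by (intro powr_mono2') auto
    also have "\<dots> \<le> (3/10) powr (- 1)" using \<kappa> by (intro powr_mono') auto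
    also have "\<dots> \<le> 4" by (simp add: powr_minus)
    also have "\<dots> \<le> (4 / \<rho>) * norm (1 - w)" using False \<rho> by (simp add: field_simps)
    finally show ?thesis using e by linarith
  qed
  then show ?thesis using that[of "4 / \<rho>"] \<rho> by simp
qed

section \<open>Integration over the depth s\<close>

text \<open>The path integral runs outwards in t with w = t z, whereas the estimates are written in
  the depth s = 1 - t.\<close>

lemma has_integral_reflect_unit:
  fixes B :: "real \<Rightarrow> real"
  assumes "(B has_integral I) {0..1}"
  shows "((\<lambda>t. B (1 - t)) has_integral I) {0..1}"
proof -
  have "(\<lambda>x::real. 1 - x) ` {0..1} = {0..1}"
    by (auto simp: image_iff intro!: bexI[of _ "1 - _"])
  moreover have "((\<lambda>x. B (- 1 *\<^sub>R x + 1)) has_integral (1 / \<bar>- 1\<bar> ^ DIM(real)) *\<^sub>R I)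
      ((\<lambda>x. (1 / - 1) *\<^sub>R x + - ((1 / - 1) *\<^sub>R 1)) ` cbox 0 1)"
    by (rule has_integral_affinity) (use assms in auto)
  ultimately show ?thesis by simp
qed

text \<open>The function to be bounded is \<open>\<delta> powr \<tau> * s powr (\<tau> - 1) * d powr
  (- 2 * \<tau>)\<close> with d = s + \<delta>. Replacing 2 * d powr \<tau> by the smaller s powr
  \<tau> + \<delta> powr \<tau> gives a majorant with an elementary antiderivative, whose increase
  is at most 4/\<tau> for every \<delta>.\<close>

lemma scale_integral_bound:
  fixes \<tau> \<delta> :: real
  assumes \<tau>: "0 < \<tau>" "\<tau> < 1" and \<delta>: "\<delta> > 0"
  obtains B I where "(B has_integral I) {0..1}" "I \<le> 4 / \<tau>"
    "\<And>s. 0 \<le> s \<Longrightarrow> B s \<ge> 0"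
    "\<And>s. 0 < s \<Longrightarrow> ((s + \<delta>) / s) powr (1 - \<tau>) * ((s + \<delta>) / \<delta>) powr (- \<tau>) / (s + \<delta>) \<le> B s"
proof -
  let ?F = "\<lambda>s. - (4 * \<delta> powr \<tau> / \<tau>) / (s powr \<tau> + \<delta> powr \<tau>)"
  define B where "B s = 4 * \<delta> powr \<tau> * s powr (\<tau> - 1) / (s powr \<tau> + \<delta> powr \<tau>)\<^sup>2" for s
  have pos: "s powr \<tau> + \<delta> powr \<tau> > 0" for s using \<delta> by (simp add: add_nonneg_pos)
  have "(B has_integral (?F 1 - ?F 0)) {0..1}"
  proof (rule fundamental_theorem_of_calculus_interior)
    show "continuous_on {0..1} ?F"
      using \<tau> pos by (intro continuous_intros continuous_on_powr') (auto simp: less_imp_neq[OF pos, symmetric])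
    fix s :: real assume s: "s \<in> {0<..<1}"
    have "((\<lambda>s. s powr \<tau> + \<delta> powr \<tau>) has_real_derivative \<tau> * s powr (\<tau> - 1) + 0) (at s)"
      using s by (intro DERIV_add has_real_derivative_powr DERIV_const) auto
    from DERIV_cmult[OF DERIV_inverse_fun[OF this], of "- (4 * \<delta> powr \<tau> / \<tau>)"] pos[of s]
    have "((\<lambda>s. - (4 * \<delta> powr \<tau> / \<tau>) * inverse (s powr \<tau> + \<delta> powr \<tau>)) has_real_derivative
      - (4 * \<delta> powr \<tau> / \<tau>) * - ((\<tau> * s powr (\<tau> - 1) + 0) * inverse ((s powr \<tau> + \<delta> powr \<tau>) ^ Suc (Suc 0)))) (at s)"
      by simp
    moreover have "- (4 * \<delta> powr \<tau> / \<tau>) * - ((\<tau> * s powr (\<tau> - 1) + 0) * inverse ((s powr \<tau> + \<delta> powr \<tau>) ^ Suc (Suc 0))) = B s"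
      unfolding B_def using \<tau> by (simp add: divide_inverse power2_eq_square)
    ultimately have "(?F has_real_derivative B s) (at s)"
      by (simp only: divide_inverse)
    then show "(?F has_vector_derivative B s) (at s)"
      by (simp add: has_real_derivative_iff_has_vector_derivative)
  qed auto
  moreover have "?F 1 - ?F 0 \<le> 4 / \<tau>"
  proof -
    have "?F 0 = - 4 / \<tau>" using \<tau> \<delta> by simp
    moreover have "?F 1 \<le> 0" using \<tau> \<delta> pos[of 1] by simp
    ultimately show ?thesis by simp
  qed
  moreover have "B s \<ge> 0" for s unfolding B_def by simp
  moreover have "((s + \<delta>) / s) powr (1 - \<tau>) * ((s + \<delta>) / \<delta>) powr (- \<tau>) / (s + \<delta>) \<le> B s" if s: "0 < s" for s
  proof -
    define d where "d = s + \<delta>"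
    have d: "d > 0" "s \<le> d" "\<delta> \<le> d" using s \<delta> d_def by auto
    have "(d / s) powr (1 - \<tau>) * (d / \<delta>) powr (- \<tau>) / d = \<delta> powr \<tau> * s powr (\<tau> - 1) * (d powr (1 - \<tau>) * d powr (- \<tau>) / d powr 1)"
    proof -
      have "(d / s) powr (1 - \<tau>) = d powr (1 - \<tau>) * s powr (\<tau> - 1)"
        using s d powr_minus[of s "1 - \<tau>"] by (simp add: powr_divide) (simp add: divide_inverse)
      moreover have "(d / \<delta>) powr (- \<tau>) = d powr (- \<tau>) * \<delta> powr \<tau>"
        using \<delta> d powr_minus[of \<delta> "- \<tau>"] by (simp add: powr_divide) (simp add: divide_inverse)
      ultimately show ?thesis using d by (simp add: mult_ac)
    qed
    also have "d powr (1 - \<tau>) * d powr (- \<tau>) / d powr 1 = 1 / (d powr \<tau>)\<^sup>2"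
    proof -
      have "d powr (1 - \<tau>) * d powr (- \<tau>) / d powr 1 = d powr (- (\<tau> + \<tau>))"
        by (simp only: powr_add[symmetric] powr_diff[symmetric]) (simp add: algebra_simps)
      also have "\<dots> = 1 / (d powr \<tau> * d powr \<tau>)" by (simp only: powr_minus powr_add divide_inverse mult_1)
      finally show ?thesis by (simp add: power2_eq_square)
    qed
    also have "\<delta> powr \<tau> * s powr (\<tau> - 1) * (1 / (d powr \<tau>)\<^sup>2) \<le> \<delta> powr \<tau> * s powr (\<tau> - 1) * (4 / (s powr \<tau> + \<delta> powr \<tau>)\<^sup>2)"
    proof (rule mult_left_mono)
      have "s powr \<tau> \<le> d powr \<tau>" "\<delta> powr \<tau> \<le> d powr \<tau>" using s \<delta> d \<tau> by (auto intro: powr_mono2)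
      then have "(s powr \<tau> + \<delta> powr \<tau>)\<^sup>2 \<le> (2 * d powr \<tau>)\<^sup>2" by (intro power_mono) auto
      then have "1 / (2 * d powr \<tau>)\<^sup>2 \<le> 1 / (s powr \<tau> + \<delta> powr \<tau>)\<^sup>2"
        using pos[of s] by (intro frac_le) auto
      then show "1 / (d powr \<tau>)\<^sup>2 \<le> 4 / (s powr \<tau> + \<delta> powr \<tau>)\<^sup>2" by (simp add: power_mult_distrib)
    qed auto
    finally show ?thesis unfolding B_def d_def by (simp add: mult_ac)
  qed
  ultimately show ?thesis using that[of B] by blast
qed

lemma powr_three_quarters_integral: "((\<lambda>s. s powr (- 3/4)) has_integral 4) {0..1::real}"
proof -
  have "((\<lambda>s. s powr (- 3/4)) has_integral (4 * 1 powr (1/4) - 4 * 0 powr (1/4))) {0..1::real}"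
  proof (rule fundamental_theorem_of_calculus_interior)
    show "continuous_on {0..1} (\<lambda>s::real. 4 * s powr (1/4))"
      by (intro continuous_intros continuous_on_powr') auto
    fix s :: real assume s: "s \<in> {0<..<1}"
    have "((\<lambda>s. 4 * s powr (1/4)) has_real_derivative 4 * (1/4 * s powr (1/4 - 1))) (at s)"
      using s by (intro DERIV_cmult has_real_derivative_powr) auto
    then show "((\<lambda>s. 4 * s powr (1/4)) has_vector_derivative s powr (- 3/4)) (at s)"
      by (simp add: has_real_derivative_iff_has_vector_derivative)
  qed auto
  then show ?thesis by simp
qed

text \<open>F is |f(w)|, g is |g_fun w| powr (3 \<beta> - 2) and N the maximal bound at z. Solving
  \<open>max\<close> for F gives F \<le> N^(1/p) v^(\<mu>/p) q^(-2\<eta>) with v = d/s and q =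
  d/\<delta>. Half of the gain in q pays for the q^\<eta> of the kernel. Against e, the other half
  makes 1/d integrable; against K d the denominator is gone, and depths below and above s0 are
  treated separately.\<close>

lemma kernel_split_pointwise:
  fixes s \<delta> \<mu> \<eta> \<tau> p N m F e K C s0 g :: real
  assumes p: "p > 0" and \<mu>: "0 < \<mu>" "\<mu> < 1" "\<mu> / p \<le> 1/2"
    and \<eta>: "\<eta> = (1 - \<mu>) / (2 * p)" and \<tau>: "\<tau> = min \<eta> (1/2)"
    and s: "0 < s" "s \<le> 1" and \<delta>: "0 < \<delta>" "\<delta> \<le> 2" and F: "F \<ge> 0" and N: "N \<ge> 0" and m: "m \<ge> 0"
    and max: "(s / (s + \<delta>)) powr \<mu> * ((s + \<delta>) / \<delta>) powr (1 - \<mu>) * F powr p \<le> N"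
    and s0: "s0 > 0" and far: "s \<ge> s0 \<Longrightarrow> F \<le> m"
    and g: "0 \<le> g" "g \<le> e + K * (s + \<delta>)" and e: "e \<ge> 0" and K: "K \<ge> 0" and C: "C \<ge> 0"
  shows "C * ((s + \<delta>) / \<delta>) powr \<eta> * g / (s + \<delta>) * F
     \<le> C * e * N powr (1/p) * (((s + \<delta>) / s) powr (1 - \<tau>) * ((s + \<delta>) / \<delta>) powr (- \<tau>) / (s + \<delta>))
       + (C * K * 2 * s0 powr (1/4) * N powr (1/p) * s powr (- 3/4) + C * K * (3 powr \<eta> * \<delta> powr (- \<eta>) * m))"
proof -
  define d where "d = s + \<delta>"
  define q where "q = d / \<delta>"
  define v where "v = d / s"
  define M where "M = N powr (1/p)"
  have d: "d > 0" "d \<le> 3" using s \<delta> d_def by auto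
  have q: "q \<ge> 1" unfolding q_def d_def using \<delta> s by simp
  have v: "v \<ge> 1" unfolding v_def d_def using \<delta> s by simp
  have \<eta>0: "\<eta> > 0" using \<eta> \<mu> p by simp
  have M: "M \<ge> 0" unfolding M_def by simp
  have F_bound: "F \<le> M * v powr (\<mu>/p) * q powr (- 2 * \<eta>)"
  proof -
    have om: "(s / d) powr \<mu> * q powr (1 - \<mu>) = (v powr (\<mu>/p) * q powr (- 2 * \<eta>)) powr (- p)"
    proof -
      have "(v powr (\<mu>/p) * q powr (- 2 * \<eta>)) powr (- p) = v powr (- \<mu>) * q powr (1 - \<mu>)"
      proof -
        have "- 2 * \<eta> * - p = 1 - \<mu>" "\<mu> / p * - p = - \<mu>" using p by (simp_all add: \<eta> field_simps)
        then show ?thesis by (simp only: powr_mult powr_powr)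
      qed
      also have "v powr (- \<mu>) = (s / d) powr \<mu>"
        unfolding v_def using s d by (simp add: powr_divide powr_minus_divide)
      finally show ?thesis by simp
    qed
    define X where "X = v powr (\<mu>/p) * q powr (- 2 * \<eta>)"
    have X: "X > 0" unfolding X_def using q v by simp
    have "X powr (- p) * F powr p \<le> N" using max om unfolding q_def X_def d_def by simp
    then have "F powr p \<le> N * X powr p" using X by (simp add: powr_minus divide_simps split: if_splits)
    then have "(F powr p) powr (1/p) \<le> (N * X powr p) powr (1/p)" using p by (intro powr_mono2) auto
    then have "F \<le> M * X" using p F X N by (simp add: powr_powr powr_mult M_def)
    then show ?thesis unfolding X_def by (simp add: mult_ac)
  qed
  have A: "q powr \<eta> * F / d \<le> M * (v powr (1 - \<tau>) * q powr (- \<tau>) / d)"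
  proof -
    have "q powr \<eta> * F \<le> q powr \<eta> * (M * v powr (\<mu>/p) * q powr (- 2 * \<eta>))"
      using F_bound by (intro mult_left_mono) auto
    also have "\<dots> = M * (v powr (\<mu>/p) * q powr (- \<eta>))"
      using powr_add[of q \<eta> "- 2 * \<eta>"] by (simp add: mult_ac)
    also have "\<dots> \<le> M * (v powr (1 - \<tau>) * q powr (- \<tau>))"
    proof -
      \<comment> \<open>\<tau> \<le> 1/2 leaves room for \<mu>/p \<le> 1/2 \<le> 1 - \<tau>, and
        \<tau> \<le> \<eta> lets q powr (-\<eta>) be weakened to q powr (-\<tau>).\<close>
      have "\<tau> \<le> 1/2" "\<tau> \<le> \<eta>" using \<tau> by simp_all
      then have "\<mu> / p \<le> 1 - \<tau>" "- \<eta> \<le> - \<tau>" using \<mu>(3) by linarith+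
      then show ?thesis using M q v by (intro mult_left_mono mult_mono powr_mono) auto
    qed
    finally show ?thesis using d by (simp add: divide_right_mono)
  qed
  have B: "q powr \<eta> * F \<le> 2 * s0 powr (1/4) * M * s powr (- 3/4) + 3 powr \<eta> * \<delta> powr (- \<eta>) * m"
  proof (cases "s \<ge> s0")
    case True
    have "q powr \<eta> \<le> 3 powr \<eta> * \<delta> powr (- \<eta>)"
    proof -
      have "q powr \<eta> = d powr \<eta> * \<delta> powr (- \<eta>)"
        unfolding q_def using d \<delta> by (simp add: powr_divide powr_minus_divide)
      also have "\<dots> \<le> 3 powr \<eta> * \<delta> powr (- \<eta>)" using d \<eta>0 by (intro mult_right_mono powr_mono2) auto
      finally show ?thesis .
    qed
    then have "q powr \<eta> * F \<le> 3 powr \<eta> * \<delta> powr (- \<eta>) * m"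
      using far[OF True] F m by (intro mult_mono) auto
    moreover have "0 \<le> 2 * s0 powr (1/4) * M * s powr (- 3/4)" using M by simp
    ultimately show ?thesis by linarith
  next
    case False
    have "q powr \<eta> * F \<le> q powr \<eta> * (M * v powr (\<mu>/p) * q powr (- 2 * \<eta>))"
      using F_bound by (intro mult_left_mono) auto
    also have "\<dots> = M * (v powr (\<mu>/p) * q powr (- \<eta>))"
      using powr_add[of q \<eta> "- 2 * \<eta>"] by (simp add: mult_ac)
    also have "\<dots> \<le> M * (v powr (1/2) * 1)"
      using M q v \<mu> \<eta>0 powr_mono[of "- \<eta>" 0 q] by (intro mult_left_mono mult_mono powr_mono) auto
    also have "v powr (1/2) = d powr (1/2) * s powr (- (1/2))"
      unfolding v_def using d s by (simp add: powr_divide powr_minus_divide)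
    also have "M * (d powr (1/2) * s powr (- (1/2)) * 1) \<le> M * (2 * s powr (- (1/2)) * 1)"
    proof -
      have "d powr (1/2) \<le> 4 powr (1/2)" using d by (intro powr_mono2) auto
      also have "(4::real) powr (1/2) = 2" by (simp add: powr_half_sqrt)
      finally show ?thesis using M by (intro mult_left_mono mult_right_mono) auto
    qed
    \<comment> \<open>Splitting off s powr (1/4) \<le> s0 powr (1/4) makes the share of small depths
      small, while s powr (-3/4) is still integrable.\<close>
    also have "s powr (- (1/2)) = s powr (1/4) * s powr (- 3/4)" by (simp add: powr_add[symmetric])
    also have "M * (2 * (s powr (1/4) * s powr (- 3/4)) * 1) \<le> M * (2 * (s0 powr (1/4) * s powr (- 3/4)) * 1)"
      using False s M by (intro mult_left_mono mult_right_mono powr_mono2) auto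
    finally show ?thesis using m by (simp add: mult_ac add_increasing2)
  qed
  have "C * q powr \<eta> * g / d * F = C * g * (q powr \<eta> * F / d)" by simp
  also have "\<dots> \<le> C * (e + K * d) * (q powr \<eta> * F / d)"
    using g C F d unfolding d_def by (intro mult_right_mono mult_left_mono) auto
  also have "\<dots> = C * e * (q powr \<eta> * F / d) + C * K * (q powr \<eta> * F)"
    using d by (simp add: field_simps)
  also have "\<dots> \<le> C * e * (M * (v powr (1 - \<tau>) * q powr (- \<tau>) / d)) + C * K * (2 * s0 powr (1/4) * M * s powr (- 3/4) + 3 powr \<eta> * \<delta> powr (- \<eta>) * m)"
    using A B C e K by (intro add_mono mult_left_mono) auto
  finally show ?thesis unfolding q_def v_def M_def d_def by (simp add: algebra_simps)
qed

text \<open>The constants are fixed before f, z, N and m, so the bound can be integrated over z and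
  applied along a sequence. With \<rho> = 1 - s0, points of depth at least s0 lie where f is bounded
  by m.\<close>

lemma STT_pointwise_bound:
  assumes \<beta>: "1/2 < \<beta>" "\<beta> < 2/3" and p: "p > 0" and \<mu>: "0 < \<mu>" "\<mu> < 1" "\<mu> / p \<le> 1/2" and \<epsilon>: "\<epsilon> > 0"
  defines "\<eta> \<equiv> (1 - \<mu>) / (2 * p)" and "u \<equiv> cpow_fun g_fun (of_real \<beta>)"
  obtains \<rho> C where "0 < \<rho>" "\<rho> < 1" "C \<ge> 0"
    "\<And>f z N m. f holomorphic_on disc \<Longrightarrow> z \<in> disc \<Longrightarrow> N \<ge> 0 \<Longrightarrow> m \<ge> 0 \<Longrightarrow>
      (\<And>s. 0 < s \<Longrightarrow> s \<le> 1 \<Longrightarrow> (s / (s + norm (1 - z))) powr \<mu> * ((s + norm (1 - z)) / norm (1 - z)) powr (1 - \<mu>)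
          * norm (f ((1 - s) *\<^sub>R z)) powr p \<le> N) \<Longrightarrow>
      (\<And>w. norm w \<le> \<rho> \<Longrightarrow> norm (f w) \<le> m) \<Longrightarrow>
      norm (STT u f z) \<le> \<epsilon> * N powr (1/p) + C * norm (1 - z) powr (- \<eta>) * m"
proof -
  have \<eta>: "\<eta> > 0" unfolding \<eta>_def using \<mu> p by simp
  define \<tau> where "\<tau> = min \<eta> (1/2)"
  have \<tau>: "0 < \<tau>" "\<tau> < 1" unfolding \<tau>_def using \<eta> by auto
  define A where "A = 3 * (17 + 8 / \<eta>)\<^sup>2"
  have "17 + 8 / \<eta> > 0" using \<eta> by (simp add: add_pos_pos)
  then have A: "A > 0" unfolding A_def by simp
  \<comment> \<open>The first part of the bound integrates to at most A e (4/\<tau>) N powr (1/p),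
    half of the allowance \<epsilon>.\<close>
  define e where "e = \<epsilon> * \<tau> / (8 * A)"
  have e: "e > 0" unfolding e_def using \<epsilon> \<tau> A by simp
  obtain K where K: "K > 0" "\<And>w. w \<in> disc \<Longrightarrow> norm (g_fun w) powr (- (2 - 3 * \<beta>)) \<le> e + K * norm (1 - w)"
    using g_fun_powr_small[of "2 - 3 * \<beta>" e] \<beta> e by auto
  \<comment> \<open>The middle part integrates to 8 A K s0 powr (1/4) N powr (1/p), the other half;
    the cap 1/2 keeps 1 - s0 positive.\<close>
  define s0 where "s0 = min ((\<epsilon> / (16 * A * K)) powr 4) (1/2)"
  have s0: "0 < s0" "s0 \<le> 1/2" unfolding s0_def using \<epsilon> A K by auto
  have s0': "s0 powr (1/4) \<le> \<epsilon> / (16 * A * K)"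
  proof -
    have "s0 powr (1/4) \<le> ((\<epsilon> / (16 * A * K)) powr 4) powr (1/4)"
      using s0 by (intro powr_mono2) (auto simp: s0_def)
    also have "\<dots> = \<epsilon> / (16 * A * K)"
    proof -
      have "(x powr 4) powr (1/4) = x" if "x \<ge> 0" for x :: real
        using that unfolding powr_powr by simp
      moreover have "0 \<le> \<epsilon> / (16 * A * K)" using \<epsilon> A K by simp
      ultimately show ?thesis by blast
    qed
    finally show ?thesis .
  qed
  define C where "C = A * K * 3 powr \<eta>"
  have C: "C \<ge> 0" unfolding C_def using A K by simp
  show ?thesis
  proof (rule that[of "1 - s0" C])
    fix f z N m
    assume f: "f holomorphic_on disc" and z: "z \<in> disc" and N: "(N::real) \<ge> 0" and m: "(m::real) \<ge> 0"
      and max: "\<And>s. 0 < s \<Longrightarrow> s \<le> 1 \<Longrightarrow> (s / (s + norm (1 - z))) powr \<mu> * ((s + norm (1 - z)) / norm (1 - z)) powr (1 - \<mu>)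
          * norm (f ((1 - s) *\<^sub>R z)) powr p \<le> N"
      and far: "\<And>w. norm w \<le> 1 - s0 \<Longrightarrow> norm (f w) \<le> m"
    define \<delta> where "\<delta> = norm (1 - z)"
    have \<delta>: "\<delta> > 0" "\<delta> \<le> 2" unfolding \<delta>_def using Re_one_minus_pos[OF z] norm_triangle_ineq4[of 1 z] z by auto
    have u: "u holomorphic_on disc" unfolding u_def by (rule cpow_g_holomorphic)
    define q where "q w = ((u z)\<^sup>2 / 2 - (u w)\<^sup>2 / 2) * deriv u w * f w" for w
    have "q holomorphic_on disc" unfolding q_def using holomorphic_deriv[OF u open_ball] u f
      by (intro holomorphic_intros) auto
    then have "continuous_on (closed_segment 0 z) q"
      by (rule continuous_on_subset[OF holomorphic_on_imp_continuous_on]) (use z in \<open>intro closed_segment_subset; simp\<close>)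
    then have "q contour_integrable_on linepath 0 z" by (rule contour_integrable_continuous_linepath)
    then have "(q has_contour_integral STT u f z) (linepath 0 z)"
      unfolding STT_eq_integral[OF u f z] q_def[symmetric] by (rule has_contour_integral_integral)
    then have int: "((\<lambda>t. q (linepath 0 z t) * z) has_integral STT u f z) {0..1}"
      by (simp add: has_contour_integral_linepath)
    obtain B I where B: "(B has_integral I) {0..1}" "I \<le> 4 / \<tau>" "\<And>s. 0 \<le> s \<Longrightarrow> B s \<ge> 0"
      "\<And>s. 0 < s \<Longrightarrow> ((s + \<delta>) / s) powr (1 - \<tau>) * ((s + \<delta>) / \<delta>) powr (- \<tau>) / (s + \<delta>) \<le> B s"
      using scale_integral_bound[OF \<tau> \<delta>(1)] by metis
    define M where "M = N powr (1/p)"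
    define R where "R s = A * e * M * B s + (A * K * 2 * s0 powr (1/4) * M * s powr (- 3/4) + A * K * (3 powr \<eta> * \<delta> powr (- \<eta>) * m))" for s
    have R_int: "(R has_integral (A * e * M * I + (A * K * 2 * s0 powr (1/4) * M * 4 + A * K * (3 powr \<eta> * \<delta> powr (- \<eta>) * m)))) {0..1}"
      unfolding R_def
      using has_integral_const_real[of "A * K * (3 powr \<eta> * \<delta> powr (- \<eta>) * m)" 0 1]
      by (intro has_integral_add[OF has_integral_mult_right[OF B(1)]
          has_integral_add[OF has_integral_mult_right[OF powr_three_quarters_integral]]]) simp
    have bound: "norm (q ((1 - s) *\<^sub>R z) * z) \<le> R s" if s: "0 < s" "s \<le> 1" for s
    proof -
      define w where "w = (1 - s) *\<^sub>R z"
      have w: "w \<in> disc" unfolding w_def using z s by (intro scaled_in_disc) auto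
      have w1: "norm (1 - w) \<le> s + \<delta>" using one_minus_dist(3)[of "1 - s" z] z s by (auto simp: w_def \<delta>_def)
      have "norm (((u z)\<^sup>2 / 2 - (u w)\<^sup>2 / 2) * deriv u w) \<le> A * ((s + \<delta>) / \<delta>) powr \<eta> * norm (g_fun w) powr (3 * \<beta> - 2) / (s + \<delta>)"
        unfolding u_def w_def \<delta>_def A_def by (rule cpow_kernel_bound[OF \<beta> \<eta> z s])
      then have "norm (q w) \<le> A * ((s + \<delta>) / \<delta>) powr \<eta> * norm (g_fun w) powr (3 * \<beta> - 2) / (s + \<delta>) * norm (f w)"
        unfolding q_def norm_mult[of _ "f w"] by (rule mult_right_mono) simp
      also have "\<dots> \<le> A * e * M * (((s + \<delta>) / s) powr (1 - \<tau>) * ((s + \<delta>) / \<delta>) powr (- \<tau>) / (s + \<delta>))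
       + (A * K * 2 * s0 powr (1/4) * M * s powr (- 3/4) + A * K * (3 powr \<eta> * \<delta> powr (- \<eta>) * m))"
        unfolding M_def
      proof (rule kernel_split_pointwise[OF p \<mu> _ _ s \<delta> _ N m _ s0(1)])
        show "s0 \<le> s \<Longrightarrow> norm (f w) \<le> m"
        proof (rule far)
          assume "s0 \<le> s"
          moreover have "(1 - s) * norm z \<le> 1 - s" using s z by (intro mult_left_le) auto
          ultimately show "norm w \<le> 1 - s0" unfolding w_def using s by simp
        qed
        show "norm (g_fun w) powr (3 * \<beta> - 2) \<le> e + K * (s + \<delta>)"
        proof -
          have "K * norm (1 - w) \<le> K * (s + \<delta>)" using w1 K(1) by (intro mult_left_mono) auto
          moreover have "- (2 - 3 * \<beta>) = 3 * \<beta> - 2" by simp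
          ultimately show ?thesis using K(2)[OF w] by (simp only:)
        qed
      qed (use max[OF s] e K A in \<open>auto simp: \<eta>_def \<tau>_def w_def \<delta>_def\<close>)
      also have "\<dots> \<le> R s" unfolding R_def using B(4)[OF s(1)] A e
        by (intro add_right_mono mult_left_mono) (auto simp: M_def)
      finally have "norm (q w) \<le> R s" .
      moreover have "norm (q w * z) \<le> norm (q w)" unfolding norm_mult using z by (simp add: mult_left_le)
      ultimately show ?thesis unfolding w_def by linarith
    qed
    define R' where "R' t = (if t = 1 then norm (q (linepath 0 z 1) * z) else R (1 - t))" for t
    have "(R' has_integral (A * e * M * I + (A * K * 2 * s0 powr (1/4) * M * 4 + A * K * (3 powr \<eta> * \<delta> powr (- \<eta>) * m)))) {0..1}"
      by (rule has_integral_spike_finite[OF _ _ has_integral_reflect_unit[OF R_int], of "{1}"]) (auto simp: R'_def)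
    moreover have "norm (q (linepath 0 z t) * z) \<le> R' t" if "t \<in> {0..1}" for t
    proof (cases "t = 1")
      case False
      then show ?thesis using bound[of "1 - t"] that by (simp add: R'_def linepath_def)
    qed (simp add: R'_def)
    ultimately have "norm (STT u f z) \<le> A * e * M * I + (A * K * 2 * s0 powr (1/4) * M * 4 + A * K * (3 powr \<eta> * \<delta> powr (- \<eta>) * m))"
      using integral_norm_bound_integral[of "\<lambda>t. q (linepath 0 z t) * z" "{0..1}" R'] int
      by (metis has_integral_iff)
    also have "\<dots> \<le> \<epsilon> / 2 * M + (\<epsilon> / 2 * M + C * \<delta> powr (- \<eta>) * m)"
    proof (intro add_mono)
      have M0: "M \<ge> 0" unfolding M_def by simp
      have "A * e * M * I \<le> A * e * M * (4 / \<tau>)" using B(2) A e M0 by (intro mult_left_mono) auto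
      also have "\<dots> = \<epsilon> / 2 * M" unfolding e_def using A \<tau> by simp
      finally show "A * e * M * I \<le> \<epsilon> / 2 * M" .
      have "A * K * 2 * s0 powr (1/4) * M * 4 \<le> A * K * 2 * (\<epsilon> / (16 * A * K)) * M * 4"
        using s0' A K M0 by (intro mult_right_mono mult_left_mono) auto
      also have "\<dots> = \<epsilon> / 2 * M" using A K by simp
      finally show "A * K * 2 * s0 powr (1/4) * M * 4 \<le> \<epsilon> / 2 * M" .
    qed (simp add: C_def mult_ac)
    finally show "norm (STT u f z) \<le> \<epsilon> * N powr (1/p) + C * norm (1 - z) powr (- \<eta>) * m"
      unfolding M_def \<delta>_def by simp
  qed (use s0 C in auto)
qed

section \<open>The inequality on circles\<close>

lemma maximal_majorant_measurable:
  assumes cont: "continuous_on disc f" and r: "0 \<le> r" "r < 1"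
  shows "maximal_majorant p \<mu> f r \<in> borel_measurable borel"
proof -
  have [measurable]: "(\<lambda>t'. f (of_real r * cis t')) \<in> borel_measurable borel"
    by (rule measurable_on_circle[OF cont r])
  show ?thesis unfolding maximal_majorant_def by measurable
qed

text \<open>For \<mu> = 1 - a and y = 1 the kernel \<open>hardy_ker\<close> is v powr (-a) times a
  factor at least 1/4 for v \<le> 1, so its circle bound covers this integral.\<close>

lemma circle_powr_integral:
  assumes a: "0 < a" "a < 1" and r: "0 \<le> r" "r < 1"
  shows "(\<integral>\<^sup>+t. ennreal (norm (1 - of_real r * cis t) powr (- a)) * indicator {0..2*pi} t \<partial>lborel) \<le> ennreal (32 / (1 - a))"
proof -
  let ?h = "\<lambda>t. ennreal (hardy_ker (1 - a) (norm (1 - cis t) / 2) 1)"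
  have pw: "ennreal (norm (1 - of_real r * cis t) powr (- a)) \<le> 4 * ?h t" if "cis t \<noteq> 1" for t
  proof -
    define v where "v = norm (1 - cis t) / 2"
    have v: "0 < v" "v \<le> 1" unfolding v_def using that norm_triangle_ineq4[of 1 "cis t"] by auto
    have "norm (1 - of_real r * cis t) powr (- a) \<le> v powr (- a)"
      using norm_one_minus_of_real_cis[of r t] r v a unfolding v_def by (intro powr_mono2') auto
    also have "\<dots> \<le> 4 * hardy_ker (1 - a) v 1"
    proof -
      have "(1/4::real) = 2 powr (- 2)" by (simp add: powr_minus)
      also have "\<dots> \<le> 2 powr (- 1 - (1 - a))" using a by (intro powr_mono) auto
      also have "\<dots> \<le> (v + 1) powr (- 1 - (1 - a))" using v a by (intro powr_mono2') auto
      finally have "v powr (- a) * (1/4) \<le> v powr (- a) * (v + 1) powr (- 1 - (1 - a))"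
        by (intro mult_left_mono) auto
      then show ?thesis unfolding hardy_ker_def by simp
    qed
    finally have "ennreal (norm (1 - of_real r * cis t) powr (- a)) \<le> ennreal (4 * hardy_ker (1 - a) v 1)" by (rule ennreal_leI)
    then show ?thesis using hardy_ker_nonneg[of 1 "1 - a" v] unfolding v_def by (simp add: ennreal_mult)
  qed
  have ne: "cis t \<noteq> 1" if "t \<in> {0..2*pi}" "t \<noteq> 0" "t \<noteq> 2 * pi" for t
    using that by (intro cis_ne_one) auto
  have "(\<integral>\<^sup>+t. ennreal (norm (1 - of_real r * cis t) powr (- a)) * indicator {0..2*pi} t \<partial>lborel)
    \<le> (\<integral>\<^sup>+t. 4 * (?h t * indicator {0..2*pi} t) \<partial>lborel)"
  proof (rule nn_integral_mono_AE)
    show "AE t in lborel. ennreal (norm (1 - of_real r * cis t) powr (- a)) * indicator {0..2*pi} t \<le> 4 * (?h t * indicator {0..2*pi} t)"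
      using AE_lborel_singleton[of "2*pi"] AE_lborel_singleton[of 0]
      by eventually_elim (use pw ne in \<open>auto simp: indicator_def\<close>)
  qed
  also have "\<dots> = 4 * (\<integral>\<^sup>+t. ?h t * indicator {0..2*pi} t \<partial>lborel)" by (rule nn_integral_cmult) measurable
  also have "\<dots> \<le> 4 * ennreal (8 / (1 - a))" using a by (intro mult_left_mono hardy_ker_circle_integral) auto
  also have "\<dots> = ennreal (32 / (1 - a))" using a by (simp add: ennreal_mult'[symmetric] flip: ennreal_numeral)
  finally show ?thesis .
qed

text \<open>Replaces the triangle inequality for every p > 0 at once, from a + b \<le> 2 max a
  b.\<close>

lemma powr_add_le:
  fixes a b p :: real
  assumes "a \<ge> 0" "b \<ge> 0" "p > 0"
  shows "(a + b) powr p \<le> 2 powr p * (a powr p + b powr p)"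
proof -
  have "(a + b) powr p \<le> (2 * max a b) powr p" using assms by (intro powr_mono2) auto
  also have "\<dots> = 2 powr p * max a b powr p" using assms by (simp add: powr_mult)
  also have "\<dots> \<le> 2 powr p * (a powr p + b powr p)"
    by (intro mult_left_mono) (auto simp: max_def)
  finally show ?thesis .
qed

text \<open>The pointwise bound with N equal to 100 times the majorant is raised to the power p and
  integrated. As a = \<eta> p = (1 - \<mu>)/2 is below 1, the second term is integrable uniformly in
  r.\<close>

lemma STT_circle_bound:
  assumes \<beta>: "1/2 < \<beta>" "\<beta> < 2/3" and p: "p > 0" and \<epsilon>: "\<epsilon> > 0"
  defines "u \<equiv> cpow_fun g_fun (of_real \<beta>)"
  obtains \<rho> K where "0 < \<rho>" "\<rho> < 1" "K \<ge> 0"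
    "\<And>f r m. f holomorphic_on disc \<Longrightarrow> 0 \<le> r \<Longrightarrow> r < 1 \<Longrightarrow> m \<ge> 0 \<Longrightarrow>
      (\<And>w. norm w \<le> \<rho> \<Longrightarrow> norm (f w) \<le> m) \<Longrightarrow>
      circle_int p (STT u f) r \<le> ennreal \<epsilon> * circle_int p f r + ennreal (K * m powr p)"
proof -
  \<comment> \<open>Secures both \<mu> < 1 and \<mu>/p \<le> 1/2.\<close>
  define \<mu> where "\<mu> = min 1 p / 2"
  have \<mu>: "0 < \<mu>" "\<mu> < 1" "\<mu> / p \<le> 1/2" unfolding \<mu>_def using p by (auto simp: min_def)
  define \<eta> where "\<eta> = (1 - \<mu>) / (2 * p)"
  define a where "a = \<eta> * p"
  have a: "0 < a" "a < 1" unfolding a_def \<eta>_def using \<mu> p by auto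
  \<comment> \<open>1600 = 100 * 16, the constant of the pointwise majorant times that of its
    integral. \<epsilon>1 below is then the p-th root that also absorbs 2 powr p.\<close>
  define c where "c = \<epsilon> * \<mu> / 1600"
  have c: "c > 0" unfolding c_def using \<epsilon> \<mu> by simp
  define \<epsilon>1 where "\<epsilon>1 = (c / 2 powr p) powr (1/p)"
  have \<epsilon>1: "\<epsilon>1 > 0" unfolding \<epsilon>1_def using c by simp
  have \<epsilon>1p: "2 powr p * \<epsilon>1 powr p = c" unfolding \<epsilon>1_def using c p by (simp add: powr_powr)
  obtain \<rho> C where \<rho>: "0 < \<rho>" "\<rho> < 1" and C: "C \<ge> 0" and main:
    "\<And>f z N m. f holomorphic_on disc \<Longrightarrow> z \<in> disc \<Longrightarrow> N \<ge> 0 \<Longrightarrow> m \<ge> 0 \<Longrightarrow>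
      (\<And>s. 0 < s \<Longrightarrow> s \<le> 1 \<Longrightarrow> (s / (s + norm (1 - z))) powr \<mu> * ((s + norm (1 - z)) / norm (1 - z)) powr (1 - \<mu>)
          * norm (f ((1 - s) *\<^sub>R z)) powr p \<le> N) \<Longrightarrow>
      (\<And>w. norm w \<le> \<rho> \<Longrightarrow> norm (f w) \<le> m) \<Longrightarrow>
      norm (STT u f z) \<le> \<epsilon>1 * N powr (1/p) + C * norm (1 - z) powr (- \<eta>) * m"
    apply (rule STT_pointwise_bound[OF \<beta> p \<mu> \<epsilon>1, folded u_def \<eta>_def])
    subgoal premises prems for \<rho> C by (rule prems(1)[OF prems(2-5)])
    done
  define K0 where "K0 = 2 powr p * C powr p"
  show ?thesis
  proof (rule that[of \<rho> "K0 * (32 / (1 - a))"])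
    fix f :: "complex \<Rightarrow> complex" and r m :: real
    assume f: "f holomorphic_on disc" and r: "0 \<le> r" "r < 1" and m: "(m::real) \<ge> 0"
      and far: "\<And>w. norm w \<le> \<rho> \<Longrightarrow> norm (f w) \<le> m"
    have cont: "continuous_on disc f" using f by (rule holomorphic_on_imp_continuous_on)
    let ?M = "maximal_majorant p \<mu> f r"
    have [measurable]: "?M \<in> borel_measurable borel" by (rule maximal_majorant_measurable[OF cont r])
    define \<delta> where "\<delta> t = norm (1 - of_real r * cis t)" for t
    have [measurable]: "\<delta> \<in> borel_measurable borel" unfolding \<delta>_def by measurable
    have pw: "ennreal (norm (STT u f (of_real r * cis t)) powr p)
      \<le> ennreal (c * 100) * ?M t + ennreal (K0 * m powr p) * ennreal (\<delta> t powr (- a))" for t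
    \<comment> \<open>N has to be a real number; where the majorant is infinite the right side is
      infinite, because c > 0.\<close>
    proof (cases "?M t = \<infinity>")
      case True
      then show ?thesis using c by (simp add: ennreal_mult_top)
    next
      case False
      define N where "N = enn2real (100 * ?M t)"
      have fin: "100 * ?M t < \<infinity>" using False by (simp add: ennreal_mult_less_top less_top)
      then have N: "N \<ge> 0" "ennreal N = 100 * ?M t" unfolding N_def by auto
      have z: "of_real r * cis t \<in> disc" using r by (simp add: norm_mult)
      have "norm (STT u f (of_real r * cis t)) \<le> \<epsilon>1 * N powr (1/p) + C * \<delta> t powr (- \<eta>) * m"
        unfolding \<delta>_def
      proof (rule main[OF f z N(1) m _ far])
        fix s :: real assume s: "0 < s" "s \<le> 1"
        have "ennreal ((s / (s + norm (1 - of_real r * cis t))) powr \<mu> * ((s + norm (1 - of_real r * cis t)) / norm (1 - of_real r * cis t)) powr (1 - \<mu>)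
          * norm (f ((1 - s) *\<^sub>R (of_real r * cis t))) powr p) \<le> ennreal N"
          unfolding N(2) by (rule maximal_majorant_pointwise[OF f p \<mu>(1,2) r s])
        then show "(s / (s + norm (1 - of_real r * cis t))) powr \<mu> * ((s + norm (1 - of_real r * cis t)) / norm (1 - of_real r * cis t)) powr (1 - \<mu>)
          * norm (f ((1 - s) *\<^sub>R (of_real r * cis t))) powr p \<le> N"
          using N(1) by (simp only: ennreal_le_iff)
      qed
      then have "norm (STT u f (of_real r * cis t)) powr p \<le> (\<epsilon>1 * N powr (1/p) + C * \<delta> t powr (- \<eta>) * m) powr p"
        using p by (intro powr_mono2) auto
      also have "\<dots> \<le> 2 powr p * ((\<epsilon>1 * N powr (1/p)) powr p + (C * \<delta> t powr (- \<eta>) * m) powr p)"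
        using \<epsilon>1 C m p by (intro powr_add_le) auto
      also have "\<dots> = c * N + K0 * m powr p * \<delta> t powr (- a)"
      proof -
        have "(\<epsilon>1 * N powr (1/p)) powr p = \<epsilon>1 powr p * N"
          using p N(1) by (simp add: powr_mult powr_powr)
        moreover have "(C * \<delta> t powr (- \<eta>) * m) powr p = C powr p * \<delta> t powr (- a) * m powr p"
          using C m by (simp add: powr_mult powr_powr a_def)
        ultimately show ?thesis unfolding \<epsilon>1p[symmetric] K0_def by (simp add: algebra_simps)
      qed
      finally have "ennreal (norm (STT u f (of_real r * cis t)) powr p) \<le> ennreal (c * N + K0 * m powr p * \<delta> t powr (- a))"
        by (rule ennreal_leI)
      also have "\<dots> = ennreal c * ennreal N + ennreal (K0 * m powr p) * ennreal (\<delta> t powr (- a))"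
        using c N(1) unfolding K0_def by (simp add: ennreal_mult)
      also have "ennreal c * ennreal N = ennreal (c * 100) * ?M t"
        using c unfolding N(2) by (simp add: ennreal_mult mult.assoc)
      finally show ?thesis .
    qed
    have "circle_int p (STT u f) r \<le> (\<integral>\<^sup>+t. ennreal (c * 100) * (?M t * indicator {0..2*pi} t)
        + ennreal (K0 * m powr p) * (ennreal (\<delta> t powr (- a)) * indicator {0..2*pi} t) \<partial>lborel)"
      unfolding circle_int_def using pw by (intro nn_integral_mono) (auto simp: indicator_def)
    also have "\<dots> = (\<integral>\<^sup>+t. ennreal (c * 100) * (?M t * indicator {0..2*pi} t) \<partial>lborel)
        + (\<integral>\<^sup>+t. ennreal (K0 * m powr p) * (ennreal (\<delta> t powr (- a)) * indicator {0..2*pi} t) \<partial>lborel)"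
      by (rule nn_integral_add) measurable
    also have "\<dots> = ennreal (c * 100) * (\<integral>\<^sup>+t. ?M t * indicator {0..2*pi} t \<partial>lborel)
        + ennreal (K0 * m powr p) * (\<integral>\<^sup>+t. ennreal (\<delta> t powr (- a)) * indicator {0..2*pi} t \<partial>lborel)"
      by (intro arg_cong2[where f = "(+)"] nn_integral_cmult) measurable
    also have "\<dots> \<le> ennreal (c * 100) * (ennreal (16 / \<mu>) * circle_int p f r) + ennreal (K0 * m powr p) * ennreal (32 / (1 - a))"
      unfolding \<delta>_def by (intro add_mono mult_left_mono maximal_majorant_integral[OF cont \<mu>(1,2) r] circle_powr_integral a r) auto
    also have "\<dots> = ennreal \<epsilon> * circle_int p f r + ennreal (K0 * (32 / (1 - a)) * m powr p)"
    proof -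
      have "ennreal (c * 100) * (ennreal (16 / \<mu>) * circle_int p f r) = ennreal (c * 100 * (16 / \<mu>)) * circle_int p f r"
        using c \<mu> by (subst ennreal_mult) (auto simp: mult.assoc)
      also have "c * 100 * (16 / \<mu>) = \<epsilon>" unfolding c_def using \<mu> by simp
      finally have 1: "ennreal (c * 100) * (ennreal (16 / \<mu>) * circle_int p f r) = ennreal \<epsilon> * circle_int p f r" .
      have "ennreal (K0 * m powr p) * ennreal (32 / (1 - a)) = ennreal (K0 * m powr p * (32 / (1 - a)))"
        using a unfolding K0_def by (intro ennreal_mult[symmetric]) auto
      then have 2: "ennreal (K0 * m powr p) * ennreal (32 / (1 - a)) = ennreal (K0 * (32 / (1 - a)) * m powr p)"
        by (simp add: mult_ac)
      show ?thesis unfolding 1 2 ..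
    qed
    finally show "circle_int p (STT u f) r \<le> ennreal \<epsilon> * circle_int p f r + ennreal (K0 * (32 / (1 - a)) * m powr p)" .
  qed (use \<rho> a in \<open>auto simp: K0_def\<close>)
qed

section \<open>Area integrals as averages over circles\<close>

lemma Complex_measurable_pair [measurable]: "(\<lambda>(x, y). Complex x y) \<in> borel_measurable (borel \<Otimes>\<^sub>M borel)"
proof -
  have "(\<lambda>(x, y). Complex x y) = (\<lambda>p::real\<times>real. complex_of_real (fst p) + \<i> * complex_of_real (snd p))"
    by (auto simp: complex_eq_iff)
  then show ?thesis by simp
qed

lemma pred_disc [measurable]: "Measurable.pred borel (\<lambda>x::complex. x \<in> disc)"
  by (simp add: pred_def)

lemma lborel_complex_eq: "(lborel :: complex measure) = distr (lborel \<Otimes>\<^sub>M lborel) borel (\<lambda>(x, y). Complex x y)"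
proof (rule lborel_eqI)
  fix l u :: complex
  assume le: "\<And>b. b \<in> Basis \<Longrightarrow> l \<bullet> b \<le> u \<bullet> b"
  have le': "Re l \<le> Re u" "Im l \<le> Im u" using le[of 1] le[of \<i>] by (auto simp: Basis_complex_def)
  have "emeasure (distr (lborel \<Otimes>\<^sub>M lborel) borel (\<lambda>(x, y). Complex x y)) (box l u)
      = emeasure (lborel \<Otimes>\<^sub>M lborel) ((\<lambda>(x, y). Complex x y) -` box l u \<inter> space (lborel \<Otimes>\<^sub>M lborel))"
  proof (rule emeasure_distr)
    have "sets (lborel \<Otimes>\<^sub>M lborel) = sets (borel \<Otimes>\<^sub>M (borel :: real measure) :: (real \<times> real) measure)"
      by (rule sets_pair_measure_cong) auto
    then show "(\<lambda>(x, y). Complex x y) \<in> borel_measurable (lborel \<Otimes>\<^sub>M lborel)"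
      using Complex_measurable_pair measurable_cong_sets by blast
  qed simp
  also have "(\<lambda>(x, y). Complex x y) -` box l u \<inter> space (lborel \<Otimes>\<^sub>M lborel) = {Re l<..<Re u} \<times> {Im l<..<Im u}"
    by (auto simp: box_def Basis_complex_def space_pair_measure)
  also have "emeasure (lborel \<Otimes>\<^sub>M lborel) ({Re l<..<Re u} \<times> {Im l<..<Im u}) = ennreal (Re u - Re l) * ennreal (Im u - Im l)"
    using le' by (subst lborel.emeasure_pair_measure_Times) auto
  also have "\<dots> = ennreal (\<Prod>b\<in>Basis. (u - l) \<bullet> b)"
    using le' by (simp add: Basis_complex_def ennreal_mult)
  finally show "emeasure (distr (lborel \<Otimes>\<^sub>M lborel) borel (\<lambda>(x, y). Complex x y)) (box l u) = ennreal (\<Prod>b\<in>Basis. (u - l) \<bullet> b)" .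
qed simp

lemma nn_integral_complex:
  fixes F :: "complex \<Rightarrow> ennreal"
  assumes [measurable]: "F \<in> borel_measurable borel"
  shows "(\<integral>\<^sup>+z. F z \<partial>lborel) = (\<integral>\<^sup>+y. \<integral>\<^sup>+x. F (Complex x y) \<partial>lborel \<partial>lborel)"
    "(\<integral>\<^sup>+z. F z \<partial>lborel) = (\<integral>\<^sup>+x. \<integral>\<^sup>+y. F (Complex x y) \<partial>lborel \<partial>lborel)"
proof -
  have [measurable]: "(\<lambda>(x, y). F (Complex x y)) \<in> borel_measurable (borel \<Otimes>\<^sub>M borel)"
    using measurable_compose[OF Complex_measurable_pair assms] by (simp add: case_prod_unfold)
  have m: "(\<lambda>(x, y). F (Complex x y)) \<in> borel_measurable (lborel \<Otimes>\<^sub>M lborel)"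
    by (simp cong: measurable_cong_sets)
  have e: "(\<integral>\<^sup>+z. F z \<partial>lborel) = (\<integral>\<^sup>+(x, y). F (Complex x y) \<partial>(lborel \<Otimes>\<^sub>M lborel))"
    by (subst lborel_complex_eq, subst nn_integral_distr) (auto simp: case_prod_unfold cong: measurable_cong_sets)
  show "(\<integral>\<^sup>+z. F z \<partial>lborel) = (\<integral>\<^sup>+y. \<integral>\<^sup>+x. F (Complex x y) \<partial>lborel \<partial>lborel)"
    unfolding e using lborel_pair.nn_integral_snd[OF m] by simp
  show "(\<integral>\<^sup>+z. F z \<partial>lborel) = (\<integral>\<^sup>+x. \<integral>\<^sup>+y. F (Complex x y) \<partial>lborel \<partial>lborel)"
    unfolding e using lborel.nn_integral_fst[OF m] by simp
qed

text \<open>With the inner integral along the sheared coordinate, a shear is a translation for each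
  fixed value of the other one.\<close>

lemma nn_integral_shear:
  fixes F :: "complex \<Rightarrow> ennreal"
  assumes [measurable]: "F \<in> borel_measurable borel"
  shows "(\<integral>\<^sup>+z. F (Complex (Re z + s * Im z) (Im z)) \<partial>lborel) = (\<integral>\<^sup>+z. F z \<partial>lborel)"
    "(\<integral>\<^sup>+z. F (Complex (Re z) (Im z + s * Re z)) \<partial>lborel) = (\<integral>\<^sup>+z. F z \<partial>lborel)"
proof -
  have tr: "(\<integral>\<^sup>+t. k (t + c) \<partial>lborel) = (\<integral>\<^sup>+t. k t \<partial>lborel)" if "k \<in> borel_measurable borel" for k :: "real \<Rightarrow> ennreal" and c
    using nn_integral_real_affine[OF that, of 1 c] by (simp add: add.commute)
  have cont: "continuous_on UNIV (\<lambda>z. Complex (Re z + s * Im z) (Im z))" "continuous_on UNIV (\<lambda>z. Complex (Re z) (Im z + s * Re z))"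
    by (intro continuous_intros)+
  have [measurable]: "(\<lambda>z. F (Complex (Re z + s * Im z) (Im z))) \<in> borel_measurable borel"
    "(\<lambda>z. F (Complex (Re z) (Im z + s * Re z))) \<in> borel_measurable borel"
    using cont[THEN borel_measurable_continuous_onI] by (auto intro: measurable_compose[OF _ assms])
  have mx: "(\<lambda>x. F (Complex x y)) \<in> borel_measurable borel" for y
  proof -
    have "continuous_on UNIV (\<lambda>x. Complex x y)" by (intro continuous_intros)
    then show ?thesis by (intro measurable_compose[OF borel_measurable_continuous_onI assms])
  qed
  have my: "(\<lambda>y. F (Complex x y)) \<in> borel_measurable borel" for x
  proof -
    have "continuous_on UNIV (\<lambda>y. Complex x y)" by (intro continuous_intros)
    then show ?thesis by (intro measurable_compose[OF borel_measurable_continuous_onI assms])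
  qed
  show "(\<integral>\<^sup>+z. F (Complex (Re z + s * Im z) (Im z)) \<partial>lborel) = (\<integral>\<^sup>+z. F z \<partial>lborel)"
    using tr[OF mx] by (subst (1 2) nn_integral_complex(1)) auto
  show "(\<integral>\<^sup>+z. F (Complex (Re z) (Im z + s * Re z)) \<partial>lborel) = (\<integral>\<^sup>+z. F z \<partial>lborel)"
    using tr[OF my] by (subst (1 2) nn_integral_complex(2)) auto
qed

text \<open>Every rotation except the half turn is a product of three shears.\<close>

lemma nn_integral_rotate:
  fixes F :: "complex \<Rightarrow> ennreal"
  assumes F: "F \<in> borel_measurable borel"
  shows "(\<integral>\<^sup>+z. F (cis t * z) \<partial>lborel) = (\<integral>\<^sup>+z. F z \<partial>lborel)"
proof -
  have main: "(\<integral>\<^sup>+z. G (cis t * z) \<partial>lborel) = (\<integral>\<^sup>+z. G z \<partial>lborel)"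
    if c: "1 + cos t \<noteq> 0" and G: "G \<in> borel_measurable borel" for t and G :: "complex \<Rightarrow> ennreal"
  proof -
    \<comment> \<open>This is -tan (t/2): the rotation is this shear, a shear by sin t in the other
      direction, and the first shear again.\<close>
    define \<tau> where "\<tau> = - sin t / (1 + cos t)"
    define S1 where "S1 z = Complex (Re z + \<tau> * Im z) (Im z)" for z
    define S2 where "S2 z = Complex (Re z) (Im z + sin t * Re z)" for z
    have e1: "\<tau> * (1 + cos t) = - sin t" unfolding \<tau>_def using c by simp
    have e2: "1 + \<tau> * sin t = cos t"
    proof -
      have "(1 + cos t) * (1 + \<tau> * sin t) = (1 + cos t) * cos t"
      proof -
        have "(1 + cos t) * (1 + \<tau> * sin t) = (1 + cos t) + (\<tau> * (1 + cos t)) * sin t" by (simp add: algebra_simps)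
        also have "\<dots> = 1 + cos t - (sin t)\<^sup>2" unfolding e1 by (simp add: power2_eq_square)
        also have "\<dots> = (1 + cos t) * cos t" using sin_cos_squared_add[of t] by (simp add: power2_eq_square algebra_simps)
        finally show ?thesis .
      qed
      then show ?thesis using c by simp
    qed
    have S: "S1 (S2 (S1 z)) = cis t * z" for z
    proof (rule complex_eqI)
      have "Im (S1 (S2 (S1 z))) = Im z * (1 + \<tau> * sin t) + sin t * Re z" unfolding S1_def S2_def by (simp add: algebra_simps)
      then show im: "Im (S1 (S2 (S1 z))) = Im (cis t * z)" unfolding e2 by simp
      have "Re (S1 (S2 (S1 z))) = Re z + \<tau> * Im z + \<tau> * Im (S1 (S2 (S1 z)))" unfolding S1_def S2_def by simp
      also have "\<dots> = Re z * (1 + \<tau> * sin t) + (\<tau> * (1 + cos t)) * Im z" unfolding im by (simp add: algebra_simps)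
      finally show "Re (S1 (S2 (S1 z))) = Re (cis t * z)" unfolding e1 e2 by simp
    qed
    have [measurable]: "S1 \<in> borel_measurable borel" "S2 \<in> borel_measurable borel"
      unfolding S1_def S2_def by (intro borel_measurable_continuous_onI continuous_intros)+
    note [measurable] = G
    have "(\<integral>\<^sup>+z. G (cis t * z) \<partial>lborel) = (\<integral>\<^sup>+z. (\<lambda>w. G (S1 (S2 w))) (S1 z) \<partial>lborel)" by (simp add: S)
    also have "\<dots> = (\<integral>\<^sup>+z. (\<lambda>w. G (S1 w)) (S2 z) \<partial>lborel)"
      unfolding S1_def[of "z::complex" for z] using nn_integral_shear(1)[of "\<lambda>w. G (S1 (S2 w))" \<tau>] by (simp add: S1_def)
    also have "\<dots> = (\<integral>\<^sup>+z. G (S1 z) \<partial>lborel)"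
      using nn_integral_shear(2)[of "\<lambda>w. G (S1 w)" "sin t"] by (simp add: S2_def)
    also have "\<dots> = (\<integral>\<^sup>+z. G z \<partial>lborel)"
      using nn_integral_shear(1)[of G \<tau>] by (simp add: S1_def)
    finally show ?thesis .
  qed
  show ?thesis
  proof (cases "1 + cos t = 0")
    case False then show ?thesis using main F by blast
  next
    case True
    then have "cos t = -1" by simp
    then have "cis t = -1" using sin_cos_squared_add[of t] by (simp add: complex_eq_iff)
    \<comment> \<open>The half turn is the square of a quarter turn, for which 1 + cos does not
      vanish.\<close>
    then have e: "cis t * z = cis (pi/2) * (cis (pi/2) * z)" for z by (simp add: complex_eq_iff)
    have m: "(\<lambda>z. F (cis (pi/2) * z)) \<in> borel_measurable borel"
      by (intro measurable_compose[OF _ F]) simp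
    show ?thesis unfolding e using main[of "pi/2", OF _ m] main[of "pi/2", OF _ F] by simp
  qed
qed

section \<open>From area integrals to circle integrals\<close>

text \<open>The functions are arbitrary off the disc; extension by 0 gives the Borel measurability
  on the plane that Tonelli's theorem asks for.\<close>

definition disc_ext :: "(complex \<Rightarrow> complex) \<Rightarrow> complex \<Rightarrow> complex" where
  "disc_ext f z = (if z \<in> disc then f z else 0)"

lemma disc_ext_measurable:
  assumes "continuous_on disc f"
  shows "disc_ext f \<in> borel_measurable borel"
proof -
  have "(\<lambda>z. indicator disc z *\<^sub>R f z) \<in> borel_measurable borel"
    by (rule borel_measurable_continuous_on_indicator) (use assms in auto)
  moreover have "(\<lambda>z. indicator disc z *\<^sub>R f z) = disc_ext f" by (auto simp: disc_ext_def indicator_def)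
  ultimately show ?thesis by simp
qed

lemma circle_int_cong:
  assumes "0 \<le> r" "r < 1" "\<And>z. z \<in> disc \<Longrightarrow> f z = h z"
  shows "circle_int p f r = circle_int p h r"
  unfolding circle_int_def using assms by (intro nn_integral_cong) (simp add: norm_mult)

lemma circle_int_measurable:
  assumes "continuous_on disc f"
  shows "(\<lambda>z::complex. circle_int p f (norm z) * indicator disc z) \<in> borel_measurable borel"
proof -
  have [measurable]: "disc_ext f \<in> borel_measurable borel" by (rule disc_ext_measurable[OF assms])
  have "(\<lambda>z::complex. circle_int p (disc_ext f) (norm z) * indicator disc z) \<in> borel_measurable borel"
    unfolding circle_int_def by measurable
  moreover have "circle_int p (disc_ext f) (norm z) * indicator disc z = circle_int p f (norm z) * indicator disc z" for z
    using circle_int_cong[of "norm z" "disc_ext f" f p] by (auto simp: indicator_def disc_ext_def)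
  ultimately show ?thesis by simp
qed

lemma circle_int_rotate:
  assumes f: "continuous_on disc f" and z: "z \<in> disc"
  shows "(\<integral>\<^sup>+t. ennreal (norm (f (cis t * z)) powr p) * indicator {0..2*pi} t \<partial>lborel) = circle_int p f (norm z)"
proof -
  have [measurable]: "(\<lambda>t. f (complex_of_real (norm z) * cis t)) \<in> borel_measurable borel"
    by (rule measurable_on_circle[OF f]) (use z in auto)
  have "cis t * z = complex_of_real (norm z) * cis (t + Arg2pi z)" for t
  proof -
    have "z = complex_of_real (norm z) * cis (Arg2pi z)" by (metis Arg2pi_eq cis_conv_exp)
    then have "cis t * z = cis t * (complex_of_real (norm z) * cis (Arg2pi z))" by simp
    then show ?thesis by (simp add: cis_mult[symmetric])
  qed
  then have "(\<integral>\<^sup>+t. ennreal (norm (f (cis t * z)) powr p) * indicator {0..2*pi} t \<partial>lborel)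
    = (\<integral>\<^sup>+t. (\<lambda>t. ennreal (norm (f (complex_of_real (norm z) * cis t)) powr p)) (t + Arg2pi z) * indicator {0..2*pi} t \<partial>lborel)"
    by simp
  also have "\<dots> = circle_int p f (norm z)"
    unfolding circle_int_def
    by (rule nn_integral_periodic_shift) (use Arg2pi_ge_0[of z] Arg2pi_lt_2pi[of z] in \<open>auto simp: cis_mult[symmetric]\<close>)
  finally show ?thesis .
qed

text \<open>Replaces polar coordinates: by rotation invariance the area integral is its own average
  over all rotations, and Tonelli turns the inner integral into the circle integral of radius |z|. A
  positive weight against circle integrals is all that a comparison circle by circle
  requires.\<close>

lemma bergman_pow_circle:
  assumes f: "continuous_on disc f"
  shows "bergman_pow p \<alpha> f = ennreal ((\<alpha> + 1) / pi) *
     (\<integral>\<^sup>+z. ennreal ((1 - (norm z)\<^sup>2) powr \<alpha> / (2 * pi)) * (circle_int p f (norm z) * indicator disc z) \<partial>lborel)"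
proof -
  have [measurable]: "disc_ext f \<in> borel_measurable borel" by (rule disc_ext_measurable[OF f])
  define \<Psi> where "\<Psi> z = ennreal (norm (disc_ext f z) powr p * (1 - (cmod z)\<^sup>2) powr \<alpha>) * indicator disc z" for z
  have [measurable]: "\<Psi> \<in> borel_measurable borel" unfolding \<Psi>_def by measurable
  have eq: "ennreal (norm (f z) powr p * (1 - (cmod z)\<^sup>2) powr \<alpha>) * indicator disc z = \<Psi> z" for z
    unfolding \<Psi>_def by (simp add: disc_ext_def indicator_def)
  have "ennreal (2 * pi) * (\<integral>\<^sup>+z. \<Psi> z \<partial>lborel) = (\<integral>\<^sup>+t. (\<integral>\<^sup>+z. \<Psi> z \<partial>lborel) * indicator {0..2*pi} t \<partial>lborel)"
    by (subst nn_integral_cmult_indicator) (auto simp: mult.commute)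
  also have "\<dots> = (\<integral>\<^sup>+t. (\<integral>\<^sup>+z. \<Psi> (cis t * z) * indicator {0..2*pi} t \<partial>lborel) \<partial>lborel)"
    by (intro nn_integral_cong) (simp add: nn_integral_multc nn_integral_rotate)
  also have "\<dots> = (\<integral>\<^sup>+z. (\<integral>\<^sup>+t. \<Psi> (cis t * z) * indicator {0..2*pi} t \<partial>lborel) \<partial>lborel)"
    by (rule lborel_pair.Fubini') (simp add: case_prod_unfold cong: measurable_cong_sets)
  also have "\<dots> = (\<integral>\<^sup>+z. ennreal ((1 - (norm z)\<^sup>2) powr \<alpha>) * (circle_int p f (norm z) * indicator disc z) \<partial>lborel)"
  proof (rule nn_integral_cong)
    fix z :: complex
    show "(\<integral>\<^sup>+t. \<Psi> (cis t * z) * indicator {0..2*pi} t \<partial>lborel) = ennreal ((1 - (norm z)\<^sup>2) powr \<alpha>) * (circle_int p f (norm z) * indicator disc z)"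
    proof (cases "z \<in> disc")
      case True
      have [measurable]: "(\<lambda>t. disc_ext f (cis t * z)) \<in> borel_measurable borel" by measurable
      have n: "norm (cis t * z) = norm z" for t by (simp add: norm_mult)
      have d: "disc_ext f (cis t * z) = f (cis t * z)" for t using True by (simp add: disc_ext_def n)
      have "(\<integral>\<^sup>+t. \<Psi> (cis t * z) * indicator {0..2*pi} t \<partial>lborel)
        = (\<integral>\<^sup>+t. ennreal ((1 - (norm z)\<^sup>2) powr \<alpha>) * (ennreal (norm (disc_ext f (cis t * z)) powr p) * indicator {0..2*pi} t) \<partial>lborel)"
      proof (rule nn_integral_cong)
        fix t :: real
        have "indicator disc (cis t * z) = (1::ennreal)" using True by (simp add: indicator_def n)
        then show "\<Psi> (cis t * z) * indicator {0..2*pi} t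
          = ennreal ((1 - (norm z)\<^sup>2) powr \<alpha>) * (ennreal (norm (disc_ext f (cis t * z)) powr p) * indicator {0..2*pi} t)"
          unfolding \<Psi>_def n by (simp add: ennreal_mult mult_ac)
      qed
      also have "\<dots> = ennreal ((1 - (norm z)\<^sup>2) powr \<alpha>) * (\<integral>\<^sup>+t. ennreal (norm (disc_ext f (cis t * z)) powr p) * indicator {0..2*pi} t \<partial>lborel)"
        by (rule nn_integral_cmult) measurable
      finally show ?thesis using True circle_int_rotate[OF f True, of p] by (simp add: d)
    qed (simp add: \<Psi>_def norm_mult)
  qed
  finally have 1: "ennreal (2 * pi) * (\<integral>\<^sup>+z. \<Psi> z \<partial>lborel) = (\<integral>\<^sup>+z. ennreal ((1 - (norm z)\<^sup>2) powr \<alpha>) * (circle_int p f (norm z) * indicator disc z) \<partial>lborel)" .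
  have [measurable]: "(\<lambda>z::complex. circle_int p f (norm z) * indicator disc z) \<in> borel_measurable borel"
    by (rule circle_int_measurable[OF f])
  have "(\<integral>\<^sup>+z. \<Psi> z \<partial>lborel) = ennreal (1 / (2*pi)) * (ennreal (2 * pi) * (\<integral>\<^sup>+z. \<Psi> z \<partial>lborel))"
    by (simp add: mult.assoc[symmetric] ennreal_mult[symmetric])
  also have "\<dots> = (\<integral>\<^sup>+z. ennreal (1 / (2*pi)) * (ennreal ((1 - (norm z)\<^sup>2) powr \<alpha>) * (circle_int p f (norm z) * indicator disc z)) \<partial>lborel)"
    unfolding 1 by (rule nn_integral_cmult[symmetric]) measurable
  also have "\<dots> = (\<integral>\<^sup>+z. ennreal ((1 - (norm z)\<^sup>2) powr \<alpha> / (2*pi)) * (circle_int p f (norm z) * indicator disc z) \<partial>lborel)"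
  proof (rule nn_integral_cong)
    fix z :: complex
    have "ennreal ((1 - (norm z)\<^sup>2) powr \<alpha> / (2*pi)) = ennreal (1 / (2*pi)) * ennreal ((1 - (norm z)\<^sup>2) powr \<alpha>)"
      by (subst ennreal_mult[symmetric]) auto
    then show "ennreal (1 / (2*pi)) * (ennreal ((1 - (norm z)\<^sup>2) powr \<alpha>) * (circle_int p f (norm z) * indicator disc z))
      = ennreal ((1 - (norm z)\<^sup>2) powr \<alpha> / (2*pi)) * (circle_int p f (norm z) * indicator disc z)"
      by (simp add: mult.assoc)
  qed
  finally show ?thesis unfolding bergman_pow_def eq by simp
qed

text \<open>For \<alpha> < 0 put a = -\<alpha>. The set A n where 1 - |z|^2 \<le> 2^(-n) has area pi
  2^(-n), and where 1 - |z|^2 > 2^(-(n+1)) the weight is at most 2^((n+1) a). The sum is geometric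
  with ratio 2^(a-1) < 1.\<close>

lemma disc_weight_finite:
  assumes \<alpha>: "\<alpha> > -1"
  shows "(\<integral>\<^sup>+z. ennreal ((1 - (cmod z)\<^sup>2) powr \<alpha>) * indicator disc z \<partial>lborel) < \<infinity>"
proof (cases "\<alpha> \<ge> 0")
  case True
  have "(\<integral>\<^sup>+z. ennreal ((1 - (cmod z)\<^sup>2) powr \<alpha>) * indicator disc z \<partial>lborel) \<le> (\<integral>\<^sup>+z. indicator disc (z::complex) \<partial>lborel)"
  proof (rule nn_integral_mono)
    fix z :: complex
    have "(1 - (cmod z)\<^sup>2) powr \<alpha> \<le> 1" if "z \<in> disc"
      using True that by (intro powr_le1) (auto simp: power_le_one)
    then show "ennreal ((1 - (cmod z)\<^sup>2) powr \<alpha>) * indicator disc z \<le> indicator disc z"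
      by (auto simp: indicator_def)
  qed
  also have "\<dots> < \<infinity>" using emeasure_lborel_ball_finite[of "0::complex" 1] by simp
  finally show ?thesis .
next
  case False
  define a where "a = - \<alpha>"
  have a: "0 < a" "a < 1" unfolding a_def using False \<alpha> by auto
  define A where "A n = disc - ball (0::complex) (sqrt (1 - (1/2) ^ n))" for n :: nat
  have [measurable]: "A n \<in> sets borel" for n unfolding A_def by simp
  have pow1: "(1/2::real) ^ n \<le> 1" for n by (simp add: power_le_one)
  have A_meas: "emeasure lborel (A n) = ennreal (pi * (1/2) ^ n)" for n
  proof -
    have ball: "emeasure lborel (ball (0::complex) r) = ennreal (pi * r\<^sup>2)" if "r \<ge> 0" for r
      using emeasure_ball[OF that, of "0::complex"] by (simp add: unit_ball_vol_2)
    have "sqrt (1 - (1/2) ^ n) \<le> 1" by simp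
    then have "ball (0::complex) (sqrt (1 - (1/2) ^ n)) \<subseteq> disc" by (intro subset_ball)
    then have "emeasure lborel (A n) = emeasure lborel disc - emeasure lborel (ball (0::complex) (sqrt (1 - (1/2) ^ n)))"
      unfolding A_def using less_imp_neq[OF emeasure_lborel_ball_finite[of "0::complex"]]
      by (intro emeasure_Diff) auto
    also have "\<dots> = ennreal (pi * 1\<^sup>2) - ennreal (pi * (sqrt (1 - (1/2) ^ n))\<^sup>2)"
      using pow1[of n] by (subst (1 2) ball) auto
    also have "\<dots> = ennreal (pi - pi * (1 - (1/2) ^ n))"
      using pow1[of n] by (subst ennreal_minus) auto
    also have "pi - pi * (1 - (1/2) ^ n) = pi * (1/2) ^ n" by (simp add: algebra_simps)
    finally show ?thesis .
  qed
  define c where "c n = 2 powr (real (Suc n) * a)" for n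
  have cover: "ennreal ((1 - (cmod z)\<^sup>2) powr \<alpha>) * indicator disc z \<le> (\<Sum>n. ennreal (c n) * indicator (A n) z)" for z :: complex
  proof (cases "z \<in> disc")
    case True
    define y where "y = 1 - (norm z)\<^sup>2"
    have y: "0 < y" "y \<le> 1" unfolding y_def using True by (auto simp: power_less_one_iff abs_square_less_1)
    \<comment> \<open>Leastness gives 2^(-(n+1)) < y \<le> 2^(-n): the first inequality bounds the
      weight, the second puts z into A n.\<close>
    define n where "n = (LEAST n. (1/2::real) ^ Suc n < y)"
    have ex: "\<exists>n. (1/2::real) ^ Suc n < y"
    proof -
      obtain n where "(1/2::real) ^ n < y" using real_arch_pow_inv[of y "1/2"] y by auto
      moreover have "(1/2::real) ^ Suc n \<le> (1/2) ^ n" by simp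
      ultimately show ?thesis using order_le_less_trans by blast
    qed
    have n1: "(1/2::real) ^ Suc n < y" unfolding n_def using ex by (rule LeastI_ex)
    have n2: "y \<le> (1/2) ^ n"
    proof (cases n)
      case 0 then show ?thesis using y by simp
    next
      case (Suc k)
      then have "\<not> (1/2::real) ^ Suc k < y" unfolding n_def using not_less_Least[of k "\<lambda>n. (1/2::real) ^ Suc n < y"] by simp
      then show ?thesis unfolding Suc by simp
    qed
    have zA: "z \<in> A n"
    proof -
      have "sqrt (1 - (1/2) ^ n) \<le> sqrt ((norm z)\<^sup>2)" using n2 unfolding y_def by (intro real_sqrt_le_mono) simp
      then have "sqrt (1 - (1/2) ^ n) \<le> norm z" by simp
      then show ?thesis using True unfolding A_def by simp
    qed
    have "y powr \<alpha> \<le> ((1/2) ^ Suc n) powr \<alpha>" using n1 False y by (intro powr_mono2') auto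
    also have "(1/2::real) ^ Suc n = 2 powr (- real (Suc n))"
      by (simp only: powr_minus powr_realpow[symmetric] zero_less_numeral) (simp add: power_divide powr_realpow powr_add divide_simps)
    also have "(2 powr (- real (Suc n))) powr \<alpha> = c n"
    proof -
      have "- real (Suc n) * \<alpha> = real (Suc n) * a" unfolding a_def by (simp add: algebra_simps)
      then show ?thesis unfolding c_def powr_powr by (simp only:)
    qed
    finally have "ennreal (y powr \<alpha>) * indicator disc z \<le> ennreal (c n) * indicator (A n) z"
      using True zA by (simp add: ennreal_leI)
    also have "\<dots> \<le> (\<Sum>n. ennreal (c n) * indicator (A n) z)"
    proof -
      define h where "h n = ennreal (c n) * indicator (A n) z" for n
      have "h n \<le> suminf h" using sum_le_suminf[of h "{n}"] by simp
      then show ?thesis unfolding h_def .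
    qed
    finally show ?thesis unfolding y_def .
  qed simp
  have "(\<integral>\<^sup>+z. ennreal ((1 - (cmod z)\<^sup>2) powr \<alpha>) * indicator disc z \<partial>lborel) \<le> (\<integral>\<^sup>+z. (\<Sum>n. ennreal (c n) * indicator (A n) z) \<partial>lborel)"
    by (rule nn_integral_mono) (rule cover)
  also have "\<dots> = (\<Sum>n. \<integral>\<^sup>+z. ennreal (c n) * indicator (A n) z \<partial>lborel)"
    by (rule nn_integral_suminf) measurable
  also have "\<dots> = (\<Sum>n. ennreal (2 powr a * pi * (2 powr (a - 1)) ^ n))"
  proof (rule suminf_cong)
    fix n
    have "(\<integral>\<^sup>+z. ennreal (c n) * indicator (A n) z \<partial>lborel) = ennreal (c n) * ennreal (pi * (1/2) ^ n)"
      by (simp add: nn_integral_cmult_indicator A_meas)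
    also have "\<dots> = ennreal (c n * (pi * (1/2) ^ n))" by (simp add: ennreal_mult c_def)
    also have "c n * (pi * (1/2) ^ n) = 2 powr a * pi * (2 powr (a - 1)) ^ n"
    proof -
      have "c n = 2 powr a * (2 powr a) ^ n"
        unfolding c_def by (simp add: powr_realpow[symmetric] powr_powr powr_add[symmetric] algebra_simps)
      moreover have "((2::real) powr (a - 1)) ^ n = (2 powr a) ^ n * (1/2) ^ n"
        by (simp add: powr_diff power_divide)
      ultimately show ?thesis by (simp only: mult_ac)
    qed
    finally show "(\<integral>\<^sup>+z. ennreal (c n) * indicator (A n) z \<partial>lborel) = ennreal (2 powr a * pi * (2 powr (a - 1)) ^ n)" .
  qed
  also have "\<dots> < \<infinity>"
  proof -
    have "(2::real) powr (a - 1) < 2 powr 0" using a by (intro powr_less_mono) auto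
    then have "summable (\<lambda>n. 2 powr a * pi * (2 powr (a - 1)) ^ n)"
      by (intro summable_mult summable_geometric) simp
    then show ?thesis by (subst suminf_ennreal2) auto
  qed
  finally show ?thesis .
qed

text \<open>The value obtained when every circle integral is replaced by 1, hence the factor of an
  additive constant when a circle inequality is carried over to the space.\<close>

definition Apa_mass :: "real \<Rightarrow> ennreal" where
  "Apa_mass \<alpha> = (if \<alpha> = -1 then ennreal (1 / (2 * pi)) else
     ennreal ((\<alpha> + 1) / pi) * (\<integral>\<^sup>+z. ennreal ((1 - (cmod z)\<^sup>2) powr \<alpha> / (2 * pi)) * indicator disc z \<partial>lborel))"

lemma Apa_mass_finite:
  assumes "\<alpha> \<ge> -1"
  shows "Apa_mass \<alpha> < \<infinity>"
proof (cases "\<alpha> = -1")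
  case False
  have "(\<integral>\<^sup>+z. ennreal ((1 - (cmod z)\<^sup>2) powr \<alpha> / (2 * pi)) * indicator disc z \<partial>lborel)
    = (\<integral>\<^sup>+z. ennreal (1 / (2 * pi)) * (ennreal ((1 - (cmod z)\<^sup>2) powr \<alpha>) * indicator disc z) \<partial>lborel)"
    by (intro nn_integral_cong) (simp add: ennreal_mult'[symmetric] mult.assoc[symmetric])
  also have "\<dots> = ennreal (1 / (2 * pi)) * (\<integral>\<^sup>+z. ennreal ((1 - (cmod z)\<^sup>2) powr \<alpha>) * indicator disc z \<partial>lborel)"
    by (rule nn_integral_cmult) measurable
  also have "\<dots> < \<infinity>" using disc_weight_finite[of \<alpha>] assms False by (simp add: ennreal_mult_less_top)
  finally show ?thesis unfolding Apa_mass_def using False by (simp add: ennreal_mult_less_top)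
qed (simp add: Apa_mass_def)

lemma hardy_pow_circle: "hardy_pow p f = (SUP r\<in>{0..<1}. ennreal (1 / (2 * pi)) * circle_int p f r)"
  unfolding hardy_pow_def circle_int_def ..

text \<open>Both functionals depend on a function through its circle integrals, monotonically and
  sublinearly: one is a supremum over radii, the other a weighted integral. Two functions on the
  right allow for differences.\<close>

lemma Apa_pow_le_of_circle:
  assumes f: "continuous_on disc f" "continuous_on disc f1" "continuous_on disc f2" and \<alpha>: "\<alpha> \<ge> -1"
    and le: "\<And>r. 0 \<le> r \<Longrightarrow> r < 1 \<Longrightarrow> circle_int p f r \<le> ennreal a1 * circle_int p f1 r + ennreal a2 * circle_int p f2 r + ennreal b"
  shows "Apa_pow p \<alpha> f \<le> ennreal a1 * Apa_pow p \<alpha> f1 + ennreal a2 * Apa_pow p \<alpha> f2 + ennreal b * Apa_mass \<alpha>"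
proof (cases "\<alpha> = -1")
  case True
  let ?c = "ennreal (1 / (2 * pi))"
  have "hardy_pow p f \<le> ennreal a1 * hardy_pow p f1 + ennreal a2 * hardy_pow p f2 + ennreal b * ?c"
    unfolding hardy_pow_circle[of p f]
  proof (rule SUP_least)
    fix r :: real assume r: "r \<in> {0..<1}"
    have u: "?c * circle_int p h r \<le> hardy_pow p h" for h
      unfolding hardy_pow_circle by (rule SUP_upper[OF r])
    have "?c * circle_int p f r \<le> ?c * (ennreal a1 * circle_int p f1 r + ennreal a2 * circle_int p f2 r + ennreal b)"
      using le[of r] r by (intro mult_left_mono) auto
    also have "\<dots> = ennreal a1 * (?c * circle_int p f1 r) + ennreal a2 * (?c * circle_int p f2 r) + ennreal b * ?c"
      by (simp add: distrib_left mult_ac)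
    also have "\<dots> \<le> ennreal a1 * hardy_pow p f1 + ennreal a2 * hardy_pow p f2 + ennreal b * ?c"
      by (intro add_mono mult_left_mono u) auto
    finally show "?c * circle_int p f r \<le> ennreal a1 * hardy_pow p f1 + ennreal a2 * hardy_pow p f2 + ennreal b * ?c" .
  qed
  then show ?thesis using True by (simp add: Apa_pow_def Apa_mass_def)
next
  case False
  let ?c = "ennreal ((\<alpha> + 1) / pi)"
  define W where "W z = ennreal ((1 - (cmod z)\<^sup>2) powr \<alpha> / (2 * pi))" for z :: complex
  have [measurable]: "W \<in> borel_measurable borel" unfolding W_def by measurable
  note [measurable] = circle_int_measurable[OF f(2), of p] circle_int_measurable[OF f(3), of p]
  define I where "I h = (\<integral>\<^sup>+z. W z * (circle_int p h (norm z) * indicator disc z) \<partial>lborel)" for h :: "complex \<Rightarrow> complex"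
  have B: "bergman_pow p \<alpha> h = ?c * I h" if "continuous_on disc h" for h
    unfolding I_def W_def by (rule bergman_pow_circle[OF that])
  have "I f \<le> (\<integral>\<^sup>+z. ennreal a1 * (W z * (circle_int p f1 (norm z) * indicator disc z))
      + ennreal a2 * (W z * (circle_int p f2 (norm z) * indicator disc z)) + ennreal b * (W z * indicator disc z) \<partial>lborel)"
    unfolding I_def
  proof (rule nn_integral_mono)
    fix z :: complex
    show "W z * (circle_int p f (norm z) * indicator disc z) \<le> ennreal a1 * (W z * (circle_int p f1 (norm z) * indicator disc z))
      + ennreal a2 * (W z * (circle_int p f2 (norm z) * indicator disc z)) + ennreal b * (W z * indicator disc z)"
    proof (cases "z \<in> disc")
      case True
      then have "W z * circle_int p f (norm z) \<le> W z * (ennreal a1 * circle_int p f1 (norm z) + ennreal a2 * circle_int p f2 (norm z) + ennreal b)"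
        using le[of "norm z"] by (intro mult_left_mono) auto
      then show ?thesis using True by (simp add: distrib_left mult_ac)
    qed simp
  qed
  also have "\<dots> = (\<integral>\<^sup>+z. ennreal a1 * (W z * (circle_int p f1 (norm z) * indicator disc z))
      + ennreal a2 * (W z * (circle_int p f2 (norm z) * indicator disc z)) \<partial>lborel) + (\<integral>\<^sup>+z. ennreal b * (W z * indicator disc z) \<partial>lborel)"
    by (rule nn_integral_add) measurable
  also have "(\<integral>\<^sup>+z. ennreal a1 * (W z * (circle_int p f1 (norm z) * indicator disc z))
      + ennreal a2 * (W z * (circle_int p f2 (norm z) * indicator disc z)) \<partial>lborel)
     = (\<integral>\<^sup>+z. ennreal a1 * (W z * (circle_int p f1 (norm z) * indicator disc z)) \<partial>lborel)
      + (\<integral>\<^sup>+z. ennreal a2 * (W z * (circle_int p f2 (norm z) * indicator disc z)) \<partial>lborel)"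
    by (rule nn_integral_add) measurable
  also have "(\<integral>\<^sup>+z. ennreal a1 * (W z * (circle_int p f1 (norm z) * indicator disc z)) \<partial>lborel) = ennreal a1 * I f1"
    unfolding I_def by (rule nn_integral_cmult) measurable
  also have "(\<integral>\<^sup>+z. ennreal a2 * (W z * (circle_int p f2 (norm z) * indicator disc z)) \<partial>lborel) = ennreal a2 * I f2"
    unfolding I_def by (rule nn_integral_cmult) measurable
  also have "(\<integral>\<^sup>+z. ennreal b * (W z * indicator disc z) \<partial>lborel) = ennreal b * (\<integral>\<^sup>+z. W z * indicator disc z \<partial>lborel)"
    by (rule nn_integral_cmult) measurable
  finally have "?c * I f \<le> ?c * (ennreal a1 * I f1 + ennreal a2 * I f2 + ennreal b * (\<integral>\<^sup>+z. W z * indicator disc z \<partial>lborel))"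
    by (rule mult_left_mono) simp
  also have "\<dots> = ennreal a1 * (?c * I f1) + ennreal a2 * (?c * I f2) + ennreal b * (?c * (\<integral>\<^sup>+z. W z * indicator disc z \<partial>lborel))"
    by (simp add: distrib_left mult_ac)
  finally show ?thesis unfolding Apa_pow_def Apa_mass_def W_def[symmetric] using False B f by simp
qed

section \<open>Pointwise growth of functions in the spaces\<close>

text \<open>The Poisson inequality with A = 1 at w = z/r. As r - |z| \<ge> (1 - |z|)/2, the Poisson
  kernel is at most 4 / (1 - |z|), and 4 \<le> 2 * pi absorbs the constant.\<close>

lemma circle_growth:
  assumes f: "f holomorphic_on disc" and p: "p > 0" and z: "z \<in> disc" and r: "(1 + norm z) / 2 \<le> r" "r < 1"
  shows "ennreal (norm (f z) powr p * (1 - norm z)) \<le> circle_int p f r"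
proof -
  have z1: "norm z < 1" using z by simp
  have "0 < (1 + norm z) / 2" by (simp add: add_pos_nonneg)
  then have r0: "r > 0" using r(1) by (rule order_less_le_trans)
  define \<phi> where "\<phi> w = f (complex_of_real r * w)" for w
  define w where "w = z / complex_of_real r"
  have nw: "norm w = norm z / r" unfolding w_def using r0 by (simp add: norm_divide)
  have zr: "norm z < r" using r z1 by simp
  have w1: "norm w < 1" unfolding nw using zr r0 by simp
  have cont: "continuous_on disc f" using f by (rule holomorphic_on_imp_continuous_on)
  have \<phi>hol: "\<phi> holomorphic_on ball 0 1" and \<phi>cont: "continuous_on (cball 0 1) \<phi>"
    unfolding \<phi>_def by (rule dilate_holomorphic[OF f]; use r r0 in simp)+
  have c1: "continuous_on {0..2*pi} (\<lambda>t. norm (\<phi> (cis t)) powr p)"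
  proof -
    have "continuous_on {0..2*pi} (\<lambda>t. \<phi> (cis t))"
      by (rule continuous_on_compose2[OF \<phi>cont]) (auto intro!: continuous_intros)
    then show ?thesis using p by (intro continuous_intros continuous_on_powr') auto
  qed
  have nz: "cis t - w \<noteq> 0" for t using w1 by auto
  define J where "J = integral {0..2*pi} (\<lambda>t. norm (\<phi> (cis t)) powr p)"
  have dz: "1 - norm z > 0" using z1 by simp
  have "2 * pi * (norm (\<phi> w) powr p * norm (1::complex))
    \<le> integral {0..2*pi} (\<lambda>t. (1 - (norm w)\<^sup>2) / (norm (cis t - w))\<^sup>2 * (norm (\<phi> (cis t)) powr p * norm (1::complex)))"
    by (rule weighted_Poisson_bound[OF \<phi>hol \<phi>cont p w1]) auto
  also have "\<dots> \<le> integral {0..2*pi} (\<lambda>t. 4 / (1 - norm z) * norm (\<phi> (cis t)) powr p)"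
  proof (rule integral_le)
    show "(\<lambda>t. (1 - (norm w)\<^sup>2) / (norm (cis t - w))\<^sup>2 * (norm (\<phi> (cis t)) powr p * norm (1::complex))) integrable_on {0..2*pi}"
      using nz by (intro integrable_continuous_interval continuous_intros c1) auto
    show "(\<lambda>t. 4 / (1 - norm z) * norm (\<phi> (cis t)) powr p) integrable_on {0..2*pi}"
      by (intro integrable_continuous_interval continuous_intros c1)
    fix t
    have "1 - norm w \<le> norm (cis t - w)" using norm_triangle_ineq2[of "cis t" w] by simp
    then have "(1 - (norm w)\<^sup>2) / (norm (cis t - w))\<^sup>2 \<le> (1 - (norm w)\<^sup>2) / (1 - norm w)\<^sup>2"
      using w1 by (intro frac_le power_mono) (auto simp: power_le_one)
    also have "\<dots> = (1 + norm w) / (1 - norm w)"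
    proof -
      have "(1 - (norm w)\<^sup>2) = (1 + norm w) * (1 - norm w)" by (simp add: power2_eq_square algebra_simps)
      then show ?thesis using w1 by (simp add: power2_eq_square)
    qed
    also have "\<dots> \<le> 2 / ((1 - norm z) / 2)"
    proof (rule frac_le)
      have "r * (1 - norm w) = r - norm z" unfolding nw using r0 by (simp add: algebra_simps)
      moreover have "r * (1 - norm w) \<le> 1 * (1 - norm w)" using r r0 w1 by (intro mult_right_mono) auto
      ultimately have "r - norm z \<le> 1 - norm w" by simp
      then show "(1 - norm z) / 2 \<le> 1 - norm w" using r(1) by argo
    qed (use w1 z1 in auto)
    finally have "(1 - (norm w)\<^sup>2) / (norm (cis t - w))\<^sup>2 \<le> 4 / (1 - norm z)" by simp
    from mult_right_mono[OF this, of "norm (\<phi> (cis t)) powr p"]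
    show "(1 - (norm w)\<^sup>2) / (norm (cis t - w))\<^sup>2 * (norm (\<phi> (cis t)) powr p * norm (1::complex)) \<le> 4 / (1 - norm z) * norm (\<phi> (cis t)) powr p"
      by simp
  qed
  also have "\<dots> = 4 / (1 - norm z) * J" unfolding J_def by simp
  finally have *: "2 * pi * norm (f z) powr p \<le> 4 / (1 - norm z) * J"
    unfolding \<phi>_def w_def using r0 by simp
  have "norm (f z) powr p * (1 - norm z) \<le> J"
  proof -
    have "2 * pi * norm (f z) powr p * (1 - norm z) \<le> 4 / (1 - norm z) * J * (1 - norm z)"
      using * dz by (intro mult_right_mono) auto
    then have "2 * pi * norm (f z) powr p * (1 - norm z) \<le> 4 * J" using dz by simp
    moreover have "4 * (norm (f z) powr p * (1 - norm z)) \<le> 2 * pi * (norm (f z) powr p * (1 - norm z))"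
      using pi_gt3 dz by (intro mult_right_mono) auto
    ultimately show ?thesis by (simp add: mult_ac)
  qed
  then have "ennreal (norm (f z) powr p * (1 - norm z)) \<le> ennreal J" by (rule ennreal_leI)
  also have "ennreal J = circle_int p f r"
    unfolding J_def circle_int_def \<phi>_def[symmetric] by (rule nn_integral_interval_eq_integral[symmetric, OF c1]) auto
  finally show ?thesis .
qed

text \<open>In the Bergman case \<open>circle_growth\<close> is integrated over a ball of radius
  y/8, y = 1 - |z|, whose points have moduli in the admissible range. Circle integrals depend on the
  modulus alone, so the ball may be centred on the real axis.\<close>

lemma Apa_growth:
  assumes \<alpha>: "\<alpha> \<ge> -1" and p: "p > 0"
  obtains C N where "C > 0" "N \<ge> (0::real)"
    "\<And>f z. f holomorphic_on disc \<Longrightarrow> z \<in> disc \<Longrightarrow> ennreal (norm (f z) powr p * (1 - norm z) powr N) \<le> ennreal C * Apa_pow p \<alpha> f"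
proof (cases "\<alpha> = -1")
  case True
  show ?thesis
  proof (rule that[of "2 * pi" 1])
    fix f z assume f: "f holomorphic_on disc" and z: "z \<in> disc"
    let ?r = "(1 + norm z) / 2"
    have r: "?r \<in> {0..<1}" using z by auto
    have "ennreal (1 / (2*pi)) * circle_int p f ?r \<le> hardy_pow p f"
      unfolding hardy_pow_circle by (rule SUP_upper[OF r])
    then have "ennreal (2 * pi) * (ennreal (1 / (2*pi)) * circle_int p f ?r) \<le> ennreal (2 * pi) * hardy_pow p f"
      by (rule mult_left_mono) simp
    moreover have "ennreal (2 * pi) * (ennreal (1 / (2*pi)) * circle_int p f ?r) = circle_int p f ?r"
      by (simp add: mult.assoc[symmetric] ennreal_mult[symmetric])
    moreover have "ennreal (norm (f z) powr p * (1 - norm z)) \<le> circle_int p f ?r"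
      by (rule circle_growth[OF f p z]) (use r in auto)
    ultimately show "ennreal (norm (f z) powr p * (1 - norm z) powr 1) \<le> ennreal (2 * pi) * Apa_pow p \<alpha> f"
      using True z by (simp add: Apa_pow_def)
  qed auto
next
  case False
  then have \<alpha>1: "\<alpha> + 1 > 0" using \<alpha> by simp
  \<comment> \<open>The exponent is |\<alpha>| for the weight, 1 from \<open>circle_growth\<close>
    and 2 for the area of the ball. The absolute value treats both signs of \<alpha>, as 1 - |v|^2
    lies between y/8 and 1.\<close>
  define N where "N = 3 + \<bar>\<alpha>\<bar>"
  define c where "c = (\<alpha> + 1) / pi * ((1/8) powr \<bar>\<alpha>\<bar> / (2 * pi) * (pi * (1/8)\<^sup>2))"
  have c: "c > 0" unfolding c_def using \<alpha>1 by simp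
  show ?thesis
  proof (rule that[of "1 / c" N])
    fix f z assume f: "f holomorphic_on disc" and z: "z \<in> disc"
    have cont: "continuous_on disc f" using f by (rule holomorphic_on_imp_continuous_on)
    define y where "y = 1 - norm z"
    have y: "0 < y" "y \<le> 1" unfolding y_def using z by auto
    define a where "a = complex_of_real (1 - y / 4)"
    have na: "norm a = 1 - y / 4" unfolding a_def using y by (simp del: of_real_diff)
    have sub: "1 - 3 * y / 8 \<le> norm v \<and> norm v \<le> 1 - y / 8" if "v \<in> ball a (y / 8)" for v
      using that norm_triangle_ineq2[of a v] norm_triangle_ineq2[of v a] unfolding mem_ball dist_norm na norm_minus_commute[of v a] by linarith
    define k where "k = (y / 8) powr \<bar>\<alpha>\<bar> / (2 * pi) * (norm (f z) powr p * y)"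
    have k0: "k \<ge> 0" unfolding k_def using y by simp
    have "(\<integral>\<^sup>+v. ennreal k * indicator (ball a (y / 8)) v \<partial>lborel)
      \<le> (\<integral>\<^sup>+v. ennreal ((1 - (norm v)\<^sup>2) powr \<alpha> / (2 * pi)) * (circle_int p f (norm v) * indicator disc v) \<partial>lborel)"
    proof (rule nn_integral_mono)
      fix v :: complex
      show "ennreal k * indicator (ball a (y / 8)) v \<le> ennreal ((1 - (norm v)\<^sup>2) powr \<alpha> / (2 * pi)) * (circle_int p f (norm v) * indicator disc v)"
      proof (cases "v \<in> ball a (y / 8)")
        case True
        have v: "1 - 3 * y / 8 \<le> norm v" "norm v \<le> 1 - y / 8" using sub[OF True] by auto
        have vd: "v \<in> disc" using v y by simp
        have "norm z = 1 - y" unfolding y_def by simp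
        then have "(1 + norm z) / 2 \<le> norm v" using v(1) y by argo
        then have cg: "ennreal (norm (f z) powr p * y) \<le> circle_int p f (norm v)"
          unfolding y_def using circle_growth[OF f p z] vd by simp
        have vv: "y / 8 \<le> 1 - (norm v)\<^sup>2" "1 - (norm v)\<^sup>2 \<le> 1"
        proof -
          have "norm v * norm v \<le> norm v" using vd by (intro mult_left_le) auto
          then show "y / 8 \<le> 1 - (norm v)\<^sup>2" using v by (simp add: power2_eq_square)
        qed auto
        have "(y / 8) powr \<bar>\<alpha>\<bar> \<le> (1 - (norm v)\<^sup>2) powr \<bar>\<alpha>\<bar>" using y vv by (intro powr_mono2) auto
        also have "\<dots> \<le> (1 - (norm v)\<^sup>2) powr \<alpha>" using y vv by (intro powr_mono') auto
        finally have "ennreal ((y / 8) powr \<bar>\<alpha>\<bar> / (2 * pi)) * ennreal (norm (f z) powr p * y)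
          \<le> ennreal ((1 - (norm v)\<^sup>2) powr \<alpha> / (2 * pi)) * circle_int p f (norm v)"
          using cg by (intro mult_mono ennreal_leI divide_right_mono) auto
        moreover have "ennreal ((y / 8) powr \<bar>\<alpha>\<bar> / (2 * pi)) * ennreal (norm (f z) powr p * y) = ennreal k"
          unfolding k_def using y by (intro ennreal_mult[symmetric]) auto
        ultimately show ?thesis using True vd by simp
      qed simp
    qed
    then have "ennreal ((\<alpha> + 1) / pi) * (\<integral>\<^sup>+v. ennreal k * indicator (ball a (y / 8)) v \<partial>lborel) \<le> Apa_pow p \<alpha> f"
      unfolding Apa_pow_def using False bergman_pow_circle[OF cont, of p \<alpha>] by (simp add: mult_left_mono)
    moreover have "(\<integral>\<^sup>+v. ennreal k * indicator (ball a (y / 8)) v \<partial>lborel) = ennreal (k * (pi * (y / 8)\<^sup>2))"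
    proof -
      have "emeasure lborel (ball a (y / 8)) = ennreal (pi * (y / 8)\<^sup>2)"
        using emeasure_ball[of "y / 8" a] y by (simp add: unit_ball_vol_2)
      then show ?thesis using k0 by (simp add: nn_integral_cmult_indicator ennreal_mult)
    qed
    moreover have "ennreal ((\<alpha> + 1) / pi) * ennreal (k * (pi * (y / 8)\<^sup>2)) = ennreal (c * (norm (f z) powr p * y powr N))"
    proof -
      have "y powr N = y powr \<bar>\<alpha>\<bar> * y * y\<^sup>2"
      proof -
        have "y powr N = y powr \<bar>\<alpha>\<bar> * y powr 3" unfolding N_def by (simp add: powr_add)
        moreover have "y powr 3 = y ^ 3" using y powr_realpow[of y 3] by simp
        ultimately show ?thesis by (simp add: power3_eq_cube power2_eq_square)
      qed
      moreover have "(y / 8) powr \<bar>\<alpha>\<bar> = y powr \<bar>\<alpha>\<bar> * (1/8) powr \<bar>\<alpha>\<bar>"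
        using powr_mult[of y "1/8" "\<bar>\<alpha>\<bar>"] y by simp
      ultimately have "(\<alpha> + 1) / pi * (k * (pi * (y / 8)\<^sup>2)) = c * (norm (f z) powr p * y powr N)"
        unfolding k_def c_def by (simp add: power_divide power2_eq_square)
      moreover have "ennreal ((\<alpha> + 1) / pi) * ennreal (k * (pi * (y / 8)\<^sup>2)) = ennreal ((\<alpha> + 1) / pi * (k * (pi * (y / 8)\<^sup>2)))"
        using k0 \<alpha>1 by (intro ennreal_mult[symmetric]) auto
      ultimately show ?thesis by simp
    qed
    ultimately have "ennreal (c * (norm (f z) powr p * y powr N)) \<le> Apa_pow p \<alpha> f" by simp
    then have "ennreal (1 / c) * ennreal (c * (norm (f z) powr p * y powr N)) \<le> ennreal (1 / c) * Apa_pow p \<alpha> f"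
      by (rule mult_left_mono) simp
    moreover have "ennreal (1 / c) * ennreal (c * (norm (f z) powr p * y powr N)) = ennreal (norm (f z) powr p * y powr N)"
      using c by (subst ennreal_mult'[symmetric]) auto
    ultimately show "ennreal (norm (f z) powr p * (1 - norm z) powr N) \<le> ennreal (1 / c) * Apa_pow p \<alpha> f"
      unfolding y_def by simp
  qed (use c in \<open>auto simp: N_def\<close>)
qed

section \<open>Compactness\<close>

lemma disc_eq_by_derivative:
  assumes "\<And>z. z \<in> disc \<Longrightarrow> (F has_field_derivative q z) (at z)" "\<And>z. z \<in> disc \<Longrightarrow> (H has_field_derivative q z) (at z)"
    and "F 0 = H 0" "z \<in> disc"
  shows "F z = H z"
  using disc_primitive_unique[of F q z] disc_primitive_unique[of H q z] assms by simp

lemma T_op_diff: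
  assumes u: "u holomorphic_on disc" and f: "f holomorphic_on disc" and h: "h holomorphic_on disc" and z: "z \<in> disc"
  shows "T_op u (\<lambda>z. f z - h z) z = T_op u f z - T_op u h z"
proof (rule disc_eq_by_derivative[OF _ _ _ z])
  have fh: "(\<lambda>z. f z - h z) holomorphic_on disc" using f h by (intro holomorphic_intros)
  show "(T_op u (\<lambda>z. f z - h z) has_field_derivative (f z - h z) * deriv u z) (at z)" if "z \<in> disc" for z
    by (rule T_op_holomorphic(3)[OF u fh that])
  show "((\<lambda>z. T_op u f z - T_op u h z) has_field_derivative (f z - h z) * deriv u z) (at z)" if "z \<in> disc" for z
    using DERIV_diff[OF T_op_holomorphic(3)[OF u f that] T_op_holomorphic(3)[OF u h that]] by (simp add: left_diff_distrib)
  show "T_op u (\<lambda>z. f z - h z) 0 = T_op u f 0 - T_op u h 0"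
    using T_op_holomorphic(2)[OF u fh] T_op_holomorphic(2)[OF u f] T_op_holomorphic(2)[OF u h] by simp
qed

lemma STT_diff:
  assumes u: "u holomorphic_on disc" and f: "f holomorphic_on disc" and h: "h holomorphic_on disc" and z: "z \<in> disc"
  shows "STT u (\<lambda>z. f z - h z) z = STT u f z - STT u h z"
proof (rule disc_eq_by_derivative[OF _ _ _ z])
  have fh: "(\<lambda>z. f z - h z) holomorphic_on disc" using f h by (intro holomorphic_intros)
  show "(STT u (\<lambda>z. f z - h z) has_field_derivative (T_op u f z - T_op u h z) * deriv u z * u z) (at z)" if "z \<in> disc" for z
    using STT_holomorphic(3)[OF u fh that] T_op_diff[OF u f h that] by simp
  show "((\<lambda>z. STT u f z - STT u h z) has_field_derivative (T_op u f z - T_op u h z) * deriv u z * u z) (at z)" if "z \<in> disc" for z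
    using DERIV_diff[OF STT_holomorphic(3)[OF u f that] STT_holomorphic(3)[OF u h that]] by (simp add: left_diff_distrib)
  show "STT u (\<lambda>z. f z - h z) 0 = STT u f 0 - STT u h 0"
    using STT_holomorphic(2)[OF u fh] STT_holomorphic(2)[OF u f] STT_holomorphic(2)[OF u h] by simp
qed

lemma Apa_pow_cong:
  assumes "\<And>z. z \<in> disc \<Longrightarrow> f z = h z"
  shows "Apa_pow p \<alpha> f = Apa_pow p \<alpha> h"
proof -
  have "hardy_pow p f = hardy_pow p h"
    unfolding hardy_pow_circle by (intro SUP_cong refl arg_cong2[where f = "(*)"] circle_int_cong assms) auto
  moreover have "bergman_pow p \<alpha> f = bergman_pow p \<alpha> h"
    unfolding bergman_pow_def
  proof (rule arg_cong2[where f = "(*)", OF refl nn_integral_cong])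
    fix z :: complex
    show "ennreal (norm (f z) powr p * (1 - (cmod z)\<^sup>2) powr \<alpha>) * indicator disc z
      = ennreal (norm (h z) powr p * (1 - (cmod z)\<^sup>2) powr \<alpha>) * indicator disc z"
      by (cases "z \<in> disc") (simp_all add: assms)
  qed
  ultimately show ?thesis by (simp add: Apa_pow_def)
qed

lemma circle_int_diff:
  assumes f: "continuous_on disc f" and h: "continuous_on disc h" and p: "p > 0" and r: "0 \<le> r" "r < 1"
  shows "circle_int p (\<lambda>z. f z - h z) r \<le> ennreal (2 powr p) * circle_int p f r + ennreal (2 powr p) * circle_int p h r"
proof -
  note [measurable] = measurable_on_circle[OF f r] measurable_on_circle[OF h r]
  let ?I = "\<lambda>f t. ennreal (norm (f (of_real r * cis t)) powr p) * indicator {0..2*pi} t"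
  have "circle_int p (\<lambda>z. f z - h z) r \<le> (\<integral>\<^sup>+t. ennreal (2 powr p) * ?I f t + ennreal (2 powr p) * ?I h t \<partial>lborel)"
    unfolding circle_int_def
  proof (rule nn_integral_mono)
    fix t
    define a b where "a = f (of_real r * cis t)" and "b = h (of_real r * cis t)"
    have "norm (a - b) powr p \<le> (norm a + norm b) powr p" using p by (intro powr_mono2 norm_triangle_ineq4) auto
    also have "\<dots> \<le> 2 powr p * (norm a powr p + norm b powr p)" using p by (intro powr_add_le) auto
    finally have "ennreal (norm (a - b) powr p) \<le> ennreal (2 powr p * norm a powr p + 2 powr p * norm b powr p)"
      by (intro ennreal_leI) (simp add: distrib_left)
    also have "\<dots> = ennreal (2 powr p) * ennreal (norm a powr p) + ennreal (2 powr p) * ennreal (norm b powr p)"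
      by (simp add: ennreal_mult)
    finally show "ennreal (norm (f (of_real r * cis t) - h (of_real r * cis t)) powr p) * indicator {0..2*pi} t
      \<le> ennreal (2 powr p) * ?I f t + ennreal (2 powr p) * ?I h t"
      unfolding a_def b_def by (auto simp: indicator_def)
  qed
  also have "\<dots> = (\<integral>\<^sup>+t. ennreal (2 powr p) * ?I f t \<partial>lborel) + (\<integral>\<^sup>+t. ennreal (2 powr p) * ?I h t \<partial>lborel)"
    by (rule nn_integral_add) measurable
  also have "\<dots> = ennreal (2 powr p) * circle_int p f r + ennreal (2 powr p) * circle_int p h r"
    unfolding circle_int_def by (intro arg_cong2[where f = "(+)"] nn_integral_cmult) measurable
  finally show ?thesis .
qed

lemma Apa_pow_diff:
  assumes f: "continuous_on disc f" and h: "continuous_on disc h" and p: "p > 0" and \<alpha>: "\<alpha> \<ge> -1"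
  shows "Apa_pow p \<alpha> (\<lambda>z. f z - h z) \<le> ennreal (2 powr p) * Apa_pow p \<alpha> f + ennreal (2 powr p) * Apa_pow p \<alpha> h"
proof -
  have "continuous_on disc (\<lambda>z. f z - h z)" by (intro continuous_intros f h)
  from Apa_pow_le_of_circle[OF this f h \<alpha>, of p "2 powr p" "2 powr p" 0] circle_int_diff[OF f h p]
  show ?thesis by simp
qed

text \<open>Fatou's lemma, on each circle in the Hardy case and on the disc otherwise. It places the
  limit supplied by Montel's theorem in the space.\<close>

lemma Apa_pow_Fatou:
  fixes fs :: "nat \<Rightarrow> complex \<Rightarrow> complex"
  assumes fs: "\<And>n. continuous_on disc (fs n)" and h: "continuous_on disc h" and p: "p > 0"
    and lim: "\<And>z. z \<in> disc \<Longrightarrow> (\<lambda>n. fs n z) \<longlonglongrightarrow> h z"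
    and bound: "\<And>n. Apa_pow p \<alpha> (fs n) \<le> B"
  shows "Apa_pow p \<alpha> h \<le> B"
proof -
  have lim_powr: "(\<lambda>n. ennreal (norm (fs n z) powr p)) \<longlonglongrightarrow> ennreal (norm (h z) powr p)" if "z \<in> disc" for z
    using p by (intro tendsto_ennrealI tendsto_powr' tendsto_norm lim that tendsto_const) auto
  have liminf_le: "liminf X \<le> B'" if "\<And>n. X n \<le> B'" for X :: "nat \<Rightarrow> ennreal" and B'
    using Liminf_mono[of X "\<lambda>_. B'" sequentially] that by (simp add: Liminf_const)
  show ?thesis
  proof (cases "\<alpha> = -1")
    case True
    let ?c = "ennreal (1 / (2 * pi))"
    have "hardy_pow p h \<le> B" unfolding hardy_pow_circle
    proof (rule SUP_least)
      fix r :: real assume r: "r \<in> {0..<1}"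
      then have r': "0 \<le> r" "r < 1" by auto
      note [measurable] = measurable_on_circle[OF fs r'] measurable_on_circle[OF h r']
      have "?c * circle_int p h r = (\<integral>\<^sup>+t. ?c * (ennreal (norm (h (of_real r * cis t)) powr p) * indicator {0..2*pi} t) \<partial>lborel)"
        unfolding circle_int_def by (rule nn_integral_cmult[symmetric]) measurable
      also have "\<dots> = (\<integral>\<^sup>+t. liminf (\<lambda>n. ?c * (ennreal (norm (fs n (of_real r * cis t)) powr p) * indicator {0..2*pi} t)) \<partial>lborel)"
      proof (rule nn_integral_cong)
        fix t
        have "of_real r * cis t \<in> disc" using r by (simp add: norm_mult)
        then have "(\<lambda>n. ?c * (ennreal (norm (fs n (of_real r * cis t)) powr p) * indicator {0..2*pi} t))
          \<longlonglongrightarrow> ?c * (ennreal (norm (h (of_real r * cis t)) powr p) * indicator {0..2*pi} t)"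
          by (cases "t \<in> {0..2*pi}") (auto intro!: ennreal_tendsto_cmult lim_powr)
        then show "?c * (ennreal (norm (h (of_real r * cis t)) powr p) * indicator {0..2*pi} t)
          = liminf (\<lambda>n. ?c * (ennreal (norm (fs n (of_real r * cis t)) powr p) * indicator {0..2*pi} t))"
          by (simp add: lim_imp_Liminf)
      qed
      also have "\<dots> \<le> liminf (\<lambda>n. \<integral>\<^sup>+t. ?c * (ennreal (norm (fs n (of_real r * cis t)) powr p) * indicator {0..2*pi} t) \<partial>lborel)"
        by (rule nn_integral_liminf) measurable
      also have "\<dots> \<le> B"
      proof (rule liminf_le)
        fix n
        have "(\<integral>\<^sup>+t. ?c * (ennreal (norm (fs n (of_real r * cis t)) powr p) * indicator {0..2*pi} t) \<partial>lborel) = ?c * circle_int p (fs n) r"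
          unfolding circle_int_def by (rule nn_integral_cmult) measurable
        also have "\<dots> \<le> hardy_pow p (fs n)" unfolding hardy_pow_circle by (rule SUP_upper[OF r])
        also have "\<dots> \<le> B" using bound[of n] True by (simp add: Apa_pow_def)
        finally show "(\<integral>\<^sup>+t. ?c * (ennreal (norm (fs n (of_real r * cis t)) powr p) * indicator {0..2*pi} t) \<partial>lborel) \<le> B" .
      qed
      finally show "?c * circle_int p h r \<le> B" .
    qed
    then show ?thesis using True by (simp add: Apa_pow_def)
  next
    case False
    note [measurable] = disc_ext_measurable[OF fs] disc_ext_measurable[OF h]
    let ?c = "ennreal ((\<alpha> + 1) / pi)"
    define \<Psi> where "\<Psi> f z = ?c * (ennreal (norm (disc_ext f z) powr p * (1 - (cmod z)\<^sup>2) powr \<alpha>) * indicator disc z)" for f z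
    have eq: "bergman_pow p \<alpha> f = (\<integral>\<^sup>+z. \<Psi> f z \<partial>lborel)" if "continuous_on disc f" for f
    proof -
      note [measurable] = disc_ext_measurable[OF that]
      have "bergman_pow p \<alpha> f = ?c * (\<integral>\<^sup>+z. ennreal (norm (disc_ext f z) powr p * (1 - (cmod z)\<^sup>2) powr \<alpha>) * indicator disc z \<partial>lborel)"
        unfolding bergman_pow_def
      proof (rule arg_cong2[where f = "(*)", OF refl nn_integral_cong])
        fix z :: complex
        show "ennreal (norm (f z) powr p * (1 - (cmod z)\<^sup>2) powr \<alpha>) * indicator disc z
          = ennreal (norm (disc_ext f z) powr p * (1 - (cmod z)\<^sup>2) powr \<alpha>) * indicator disc z"
          by (cases "z \<in> disc") (simp_all add: disc_ext_def)
      qed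
      also have "\<dots> = (\<integral>\<^sup>+z. \<Psi> f z \<partial>lborel)" unfolding \<Psi>_def by (rule nn_integral_cmult[symmetric]) measurable
      finally show ?thesis .
    qed
    have "(\<integral>\<^sup>+z. \<Psi> h z \<partial>lborel) = (\<integral>\<^sup>+z. liminf (\<lambda>n. \<Psi> (fs n) z) \<partial>lborel)"
    proof (rule nn_integral_cong)
      fix z
      have "(\<lambda>n. \<Psi> (fs n) z) \<longlonglongrightarrow> \<Psi> h z"
      proof (cases "z \<in> disc")
        case True
        have "(\<lambda>n. norm (fs n z) powr p * (1 - (cmod z)\<^sup>2) powr \<alpha>) \<longlonglongrightarrow> norm (h z) powr p * (1 - (cmod z)\<^sup>2) powr \<alpha>"
          using p by (intro tendsto_mult tendsto_powr'[of _ _ _ _ p] tendsto_norm lim True tendsto_const) auto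
        then show ?thesis using True unfolding \<Psi>_def by (auto intro!: ennreal_tendsto_cmult tendsto_ennrealI simp: disc_ext_def)
      qed (simp add: \<Psi>_def)
      then show "\<Psi> h z = liminf (\<lambda>n. \<Psi> (fs n) z)" by (simp add: lim_imp_Liminf)
    qed
    also have "\<dots> \<le> liminf (\<lambda>n. \<integral>\<^sup>+z. \<Psi> (fs n) z \<partial>lborel)"
      by (rule nn_integral_liminf) (unfold \<Psi>_def, measurable)
    also have "\<dots> \<le> B"
      by (rule liminf_le) (use bound False in \<open>simp add: Apa_pow_def eq[OF fs, symmetric]\<close>)
    finally show ?thesis using False by (simp add: Apa_pow_def eq[OF h])
  qed
qed

text \<open>Only the term with \<epsilon> involves the norm of f; the other sees f on a fixed
  smaller disc. Membership of the image and compactness both follow from this.\<close>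

lemma STT_Apa_bound:
  assumes \<beta>: "1/2 < \<beta>" "\<beta> < 2/3" and p: "p > 0" and \<alpha>: "\<alpha> \<ge> -1" and \<epsilon>: "\<epsilon> > 0"
  defines "u \<equiv> cpow_fun g_fun (of_real \<beta>)"
  obtains \<rho> K where "0 < \<rho>" "\<rho> < 1" "K \<ge> 0"
    "\<And>f m. f holomorphic_on disc \<Longrightarrow> m \<ge> 0 \<Longrightarrow> (\<And>w. norm w \<le> \<rho> \<Longrightarrow> norm (f w) \<le> m) \<Longrightarrow>
      Apa_pow p \<alpha> (STT u f) \<le> ennreal \<epsilon> * Apa_pow p \<alpha> f + ennreal (K * m powr p)"
proof (rule STT_circle_bound[OF \<beta> p \<epsilon>, folded u_def])
  fix \<rho> K assume \<rho>: "0 < \<rho>" "\<rho> < 1" and K: "(K::real) \<ge> 0" and main: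
    "\<And>f r m. f holomorphic_on disc \<Longrightarrow> 0 \<le> r \<Longrightarrow> r < 1 \<Longrightarrow> m \<ge> 0 \<Longrightarrow>
      (\<And>w. norm w \<le> \<rho> \<Longrightarrow> norm (f w) \<le> m) \<Longrightarrow>
      circle_int p (STT u f) r \<le> ennreal \<epsilon> * circle_int p f r + ennreal (K * m powr p)"
  define Q where "Q = enn2real (Apa_mass \<alpha>)"
  have Q: "Q \<ge> 0" "Apa_mass \<alpha> = ennreal Q" unfolding Q_def using Apa_mass_finite[OF \<alpha>] by (auto simp: less_top)
  have u: "u holomorphic_on disc" unfolding u_def by (rule cpow_g_holomorphic)
  show thesis
  proof (rule that[OF \<rho>, of "K * Q"])
    fix f m assume f: "f holomorphic_on disc" and m: "(m::real) \<ge> 0" and far: "\<And>w. norm w \<le> \<rho> \<Longrightarrow> norm (f w) \<le> m"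
    have fc: "continuous_on disc f" and Lc: "continuous_on disc (STT u f)"
      using f STT_holomorphic(1)[OF u f] by (auto intro: holomorphic_on_imp_continuous_on)
    have "Apa_pow p \<alpha> (STT u f) \<le> ennreal \<epsilon> * Apa_pow p \<alpha> f + ennreal 0 * Apa_pow p \<alpha> f + ennreal (K * m powr p) * Apa_mass \<alpha>"
      by (rule Apa_pow_le_of_circle[OF Lc fc fc \<alpha>]) (use main[OF f _ _ m far] in simp)
    also have "ennreal (K * m powr p) * Apa_mass \<alpha> = ennreal (K * Q * m powr p)"
      unfolding Q using K Q(1) by (simp add: ennreal_mult[symmetric] mult_ac)
    finally show "Apa_pow p \<alpha> (STT u f) \<le> ennreal \<epsilon> * Apa_pow p \<alpha> f + ennreal (K * Q * m powr p)" by simp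
  qed (use K Q in simp)
qed

lemma STT_in_Apa:
  assumes \<beta>: "1/2 < \<beta>" "\<beta> < 2/3" and p: "p > 0" and \<alpha>: "\<alpha> \<ge> -1" and f: "f \<in> Apa p \<alpha>"
  shows "STT (cpow_fun g_fun (of_real \<beta>)) f \<in> Apa p \<alpha>"
proof (rule STT_Apa_bound[OF \<beta> p \<alpha> zero_less_one])
  let ?u = "cpow_fun g_fun (complex_of_real \<beta>)"
  fix \<rho> K assume \<rho>: "0 < \<rho>" "\<rho> < 1" and K: "(K::real) \<ge> 0" and main:
    "\<And>f m. f holomorphic_on disc \<Longrightarrow> m \<ge> 0 \<Longrightarrow> (\<And>w. norm w \<le> \<rho> \<Longrightarrow> norm (f w) \<le> m) \<Longrightarrow>
      Apa_pow p \<alpha> (STT ?u f) \<le> ennreal 1 * Apa_pow p \<alpha> f + ennreal (K * m powr p)"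
  have fh: "f holomorphic_on disc" and fa: "Apa_pow p \<alpha> f < \<infinity>" using f by (auto simp: Apa_def)
  have "continuous_on (cball 0 \<rho>) f"
    by (rule continuous_on_subset[OF holomorphic_on_imp_continuous_on[OF fh]]) (use \<rho> in auto)
  then have "bounded (f ` cball 0 \<rho>)" by (intro compact_imp_bounded compact_continuous_image) auto
  then obtain m where m: "m > 0" "\<And>w. norm w \<le> \<rho> \<Longrightarrow> norm (f w) \<le> m" by (auto simp: bounded_pos)
  have "Apa_pow p \<alpha> (STT ?u f) \<le> ennreal 1 * Apa_pow p \<alpha> f + ennreal (K * m powr p)"
    by (rule main[OF fh _ m(2)]) (use m in auto)
  also have "\<dots> < \<infinity>" using fa by simp
  finally show ?thesis unfolding Apa_def using STT_holomorphic(1)[OF cpow_g_holomorphic fh] by simp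
qed

text \<open>\<open>Apa_growth\<close>, with 1 - |z| bounded below by its value at a point of K of
  largest modulus. This is the hypothesis of Montel's theorem.\<close>

lemma Apa_bounded_locally_bounded:
  assumes p: "p > 0" and \<alpha>: "\<alpha> \<ge> -1" and K: "compact K" "K \<subseteq> disc"
  shows "\<exists>B. \<forall>f \<in> {f. f holomorphic_on disc \<and> Apa_pow p \<alpha> f \<le> ennreal C}. \<forall>z\<in>K. norm (f z) \<le> B"
proof (cases "K = {}")
  case False
  obtain C0 N where C0: "C0 > 0" "N \<ge> (0::real)" and growth:
    "\<And>f z. f holomorphic_on disc \<Longrightarrow> z \<in> disc \<Longrightarrow> ennreal (norm (f z) powr p * (1 - norm z) powr N) \<le> ennreal C0 * Apa_pow p \<alpha> f"
    using Apa_growth[OF \<alpha> p] by metis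
  have "continuous_on K norm" by (intro continuous_intros)
  then obtain z0 where z0: "z0 \<in> K" "\<And>z. z \<in> K \<Longrightarrow> norm z \<le> norm z0"
    using continuous_attains_sup[OF K(1) False] by metis
  define y where "y = 1 - norm z0"
  have y: "y > 0" unfolding y_def using z0 K by auto
  \<comment> \<open>\<open>ennreal\<close> sends negative numbers to 0, so C is replaced by its
    positive part.\<close>
  define C1 where "C1 = max C 0"
  have "norm (f z) \<le> (C0 * C1 / y powr N) powr (1/p)" if f: "f holomorphic_on disc" "Apa_pow p \<alpha> f \<le> ennreal C" and z: "z \<in> K" for f z
  proof -
    have "ennreal (norm (f z) powr p * (1 - norm z) powr N) \<le> ennreal C0 * Apa_pow p \<alpha> f" using growth[OF f(1)] z K by auto
    also have "\<dots> \<le> ennreal C0 * ennreal C1"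
      using f(2) by (intro mult_left_mono) (auto simp: C1_def max_def ennreal_neg split: if_splits)
    also have "\<dots> = ennreal (C0 * C1)" using C0 unfolding C1_def by (simp add: ennreal_mult)
    finally have 1: "norm (f z) powr p * (1 - norm z) powr N \<le> C0 * C1" using C0 unfolding C1_def by (subst (asm) ennreal_le_iff) auto
    have "norm (f z) powr p * y powr N \<le> norm (f z) powr p * (1 - norm z) powr N"
      using z0(2)[OF z] y C0 unfolding y_def by (intro mult_left_mono powr_mono2) auto
    with 1 have "norm (f z) powr p \<le> C0 * C1 / y powr N" using y by (simp add: pos_le_divide_eq)
    then have "(norm (f z) powr p) powr (1/p) \<le> (C0 * C1 / y powr N) powr (1/p)" using p by (intro powr_mono2) auto
    then show ?thesis using p by (simp add: powr_powr)
  qed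
  then show ?thesis by blast
qed auto

text \<open>Montel's theorem gives a subsequence with locally uniform limit h, which lies in the
  space by Fatou. The differences from h are bounded in the space and tend to 0 uniformly on the
  disc of radius \<rho>, so \<open>STT_Apa_bound\<close> makes their images small; the images
  converge to that of h.\<close>

lemma STT_compact:
  assumes \<beta>: "1/2 < \<beta>" "\<beta> < 2/3" and p: "p > 0" and \<alpha>: "\<alpha> \<ge> -1"
  shows "compact_Apa_op p \<alpha> (STT (cpow_fun g_fun (of_real \<beta>)))"
  unfolding compact_Apa_op_def
proof (intro conjI ballI allI impI)
  let ?u = "cpow_fun g_fun (complex_of_real \<beta>)"
  have u: "?u holomorphic_on disc" by (rule cpow_g_holomorphic)
  show "STT ?u f \<in> Apa p \<alpha>" if "f \<in> Apa p \<alpha>" for f by (rule STT_in_Apa[OF \<beta> p \<alpha> that])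
  fix fs :: "nat \<Rightarrow> complex \<Rightarrow> complex"
  assume "\<exists>C::real. \<forall>n. fs n \<in> Apa p \<alpha> \<and> Apa_pow p \<alpha> (fs n) \<le> ennreal C"
  then obtain C0 where C0: "\<And>n. fs n \<in> Apa p \<alpha>" "\<And>n. Apa_pow p \<alpha> (fs n) \<le> ennreal C0" by blast
  define C where "C = max C0 0"
  have C: "C \<ge> 0" "\<And>n. Apa_pow p \<alpha> (fs n) \<le> ennreal C"
    using C0(2) by (auto simp: C_def max_def ennreal_neg split: if_splits)
  have hol: "fs n holomorphic_on disc" for n using C0(1)[of n] by (simp add: Apa_def)
  define \<H> where "\<H> = {f. f holomorphic_on disc \<and> Apa_pow p \<alpha> f \<le> ennreal C}"
  obtain h r where h: "h holomorphic_on disc" and r: "strict_mono (r :: nat \<Rightarrow> nat)"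
    and lim: "\<And>z. z \<in> disc \<Longrightarrow> (\<lambda>n. fs (r n) z) \<longlonglongrightarrow> h z"
    and unif: "\<And>K. compact K \<Longrightarrow> K \<subseteq> disc \<Longrightarrow> uniform_limit K (fs \<circ> r) h sequentially"
  proof (rule Montel[of disc \<H> fs])
    show "\<exists>B. \<forall>f\<in>\<H>. \<forall>z\<in>K. norm (f z) \<le> B" if "compact K" "K \<subseteq> disc" for K
      unfolding \<H>_def by (rule Apa_bounded_locally_bounded[OF p \<alpha> that])
    show "range fs \<subseteq> \<H>" unfolding \<H>_def using hol C by auto
  qed (auto simp: \<H>_def)
  have hc: "continuous_on disc h" using h by (rule holomorphic_on_imp_continuous_on)
  have fc: "continuous_on disc (fs n)" for n using hol by (rule holomorphic_on_imp_continuous_on)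
  have hB: "Apa_pow p \<alpha> h \<le> ennreal C"
    by (rule Apa_pow_Fatou[OF fc hc p lim C(2)])
  then have hA: "h \<in> Apa p \<alpha>" unfolding Apa_def using h by (auto intro: le_less_trans)
  define D where "D k = (\<lambda>z. fs (r k) z - h z)" for k
  have Dh: "D k holomorphic_on disc" for k unfolding D_def using hol h by (intro holomorphic_intros)
  define C2 where "C2 = 2 powr p * C + 2 powr p * C"
  have C2: "C2 \<ge> 0" unfolding C2_def using C by simp
  have DB: "Apa_pow p \<alpha> (D k) \<le> ennreal C2" for k
  proof -
    have "Apa_pow p \<alpha> (D k) \<le> ennreal (2 powr p) * Apa_pow p \<alpha> (fs (r k)) + ennreal (2 powr p) * Apa_pow p \<alpha> h"
      unfolding D_def by (rule Apa_pow_diff[OF fc hc p \<alpha>])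
    also have "\<dots> \<le> ennreal (2 powr p) * ennreal C + ennreal (2 powr p) * ennreal C"
      using C(2) hB by (intro add_mono mult_left_mono) auto
    also have "\<dots> = ennreal C2"
      unfolding C2_def using C(1) by (subst ennreal_plus) (auto simp: ennreal_mult)
    finally show ?thesis .
  qed
  have "(\<lambda>k. Apa_pow p \<alpha> (STT ?u (D k))) \<longlonglongrightarrow> 0"
  proof (rule order_tendstoI)
    fix e :: ennreal assume e: "0 < e"
    obtain e' where e': "e' > 0" "ennreal e' < e"
    proof -
      from dense[OF e] obtain y where y: "0 < y" "y < e" by blast
      then show ?thesis using that[of "enn2real y"]
        by (metis enn2real_positive_iff ennreal_enn2real_if infinity_ennreal_def less_top order_less_le_trans top_greatest top.not_eq_extremum)
    qed
    \<comment> \<open>Each of the two terms is allotted e'/2; the added 1, here and in m, avoids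
      division by 0.\<close>
    define \<epsilon> where "\<epsilon> = e' / (2 * (C2 + 1))"
    have \<epsilon>: "\<epsilon> > 0" unfolding \<epsilon>_def using e' C2 by simp
    show "\<forall>\<^sub>F k in sequentially. Apa_pow p \<alpha> (STT ?u (D k)) < e"
    proof (rule STT_Apa_bound[OF \<beta> p \<alpha> \<epsilon>])
      fix \<rho> K assume \<rho>: "0 < \<rho>" "\<rho> < 1" and K: "(K::real) \<ge> 0" and main:
        "\<And>f m. f holomorphic_on disc \<Longrightarrow> m \<ge> 0 \<Longrightarrow> (\<And>w. norm w \<le> \<rho> \<Longrightarrow> norm (f w) \<le> m) \<Longrightarrow>
          Apa_pow p \<alpha> (STT ?u f) \<le> ennreal \<epsilon> * Apa_pow p \<alpha> f + ennreal (K * m powr p)"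
      define m where "m = (e' / (2 * (K + 1))) powr (1/p)"
      have m: "m > 0" unfolding m_def using e' K by simp
      have mp: "K * m powr p \<le> e' / 2"
      proof -
        have "m powr p = e' / (2 * (K + 1))" unfolding m_def using e' K p by (simp add: powr_powr)
        moreover have "K * (e' / (2 * (K + 1))) \<le> (K + 1) * (e' / (2 * (K + 1)))" using K e' by (intro mult_right_mono) auto
        moreover have "x * (e' / (2 * x)) = e' / 2" if "x \<noteq> 0" for x using that by simp
        then have "(K + 1) * (e' / (2 * (K + 1))) = e' / 2" using K by (metis add_nonneg_pos less_irrefl zero_less_one)
        ultimately show ?thesis by metis
      qed
      have "uniform_limit (cball 0 \<rho>) (fs \<circ> r) h sequentially" using \<rho> by (intro unif) auto
      from uniform_limitD[OF this m] show "\<forall>\<^sub>F k in sequentially. Apa_pow p \<alpha> (STT ?u (D k)) < e"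
      proof eventually_elim
        fix k assume k: "\<forall>z\<in>cball 0 \<rho>. dist ((fs \<circ> r) k z) (h z) < m"
        have "Apa_pow p \<alpha> (STT ?u (D k)) \<le> ennreal \<epsilon> * Apa_pow p \<alpha> (D k) + ennreal (K * m powr p)"
          by (rule main[OF Dh]) (use k m in \<open>auto simp: D_def dist_norm less_imp_le\<close>)
        also have "\<dots> \<le> ennreal \<epsilon> * ennreal C2 + ennreal (e' / 2)"
          using DB mp by (intro add_mono mult_left_mono ennreal_leI) auto
        also have "\<dots> = ennreal (\<epsilon> * C2 + e' / 2)" using \<epsilon> C2 e' by (simp add: ennreal_mult)
        also have "\<dots> \<le> ennreal e'"
        proof (rule ennreal_leI)
          have "\<epsilon> * C2 \<le> \<epsilon> * (C2 + 1)" using \<epsilon> by (intro mult_left_mono) auto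
          also have "\<dots> = e' / 2"
          proof -
            have "e' / (2 * x) * x = e' / 2" if "x \<noteq> 0" for x using that by simp
            moreover have "C2 + 1 \<noteq> 0" using C2 by linarith
            ultimately show ?thesis unfolding \<epsilon>_def by blast
          qed
          finally show "\<epsilon> * C2 + e' / 2 \<le> e'" by simp
        qed
        finally show "Apa_pow p \<alpha> (STT ?u (D k)) < e" using e'(2) by (rule le_less_trans)
      qed
    qed
  qed simp
  moreover have "Apa_pow p \<alpha> (\<lambda>z. STT ?u (fs (r k)) z - STT ?u h z) = Apa_pow p \<alpha> (STT ?u (D k))" for k
    unfolding D_def by (rule Apa_pow_cong) (simp add: STT_diff[OF u hol h])
  ultimately have "(\<lambda>k. Apa_pow p \<alpha> (\<lambda>z. STT ?u (fs (r k)) z - STT ?u h z)) \<longlonglongrightarrow> 0" by simp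
  then show "\<exists>r h. strict_mono r \<and> h \<in> Apa p \<alpha> \<and> (\<lambda>k. Apa_pow p \<alpha> (\<lambda>z. STT ?u (fs (r k)) z - h z)) \<longlonglongrightarrow> 0"
    using r STT_in_Apa[OF \<beta> p \<alpha> hA] by (intro exI[of _ r] exI[of _ "STT ?u h"] conjI)
qed

section \<open>BMOA, the Bloch space and unboundedness\<close>

lemma circle_mean_square:
  assumes h: "h holomorphic_on disc" and r: "0 < r" "r < 1"
  shows "((\<lambda>t. (h (of_real r * cis t))\<^sup>2) has_integral 2 * of_real pi * (h 0)\<^sup>2) {0..2*pi}"
proof -
  have "(\<lambda>z. (h z)\<^sup>2) holomorphic_on cball 0 r"
    by (intro holomorphic_intros holomorphic_on_subset[OF h]) (use r in auto)
  from Cauchy_integral_circlepath_simple[OF this, of 0] r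
  have "((\<lambda>t. (h (of_real r * cis t))\<^sup>2 / (of_real r * cis t) * complex_of_real r * \<i> * cis t)
      has_integral (2 * of_real pi * \<i> * (h 0)\<^sup>2)) {0..2*pi}"
    by (simp add: circlepath_integral_iff)
  moreover have "(h (of_real r * cis t))\<^sup>2 / (of_real r * cis t) * complex_of_real r * \<i> * cis t
     = (h (of_real r * cis t))\<^sup>2 * \<i>" for t
    using r by simp
  ultimately have "((\<lambda>t. (h (of_real r * cis t))\<^sup>2 * \<i>) has_integral (2 * of_real pi * \<i> * (h 0)\<^sup>2)) {0..2*pi}" by (simp only:)
  from has_integral_mult_left[OF this, of "- \<i>"] show ?thesis by (simp add: mult_ac)
qed

text \<open>Here \<open>|h|\<^sup>2 = Re (h\<^sup>2) + 2 (Im h)\<^sup>2\<close>, and \<open>h\<^sup>2\<close> has mean \<open>h(0)\<^sup>2\<close> on each circle.\<close>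

lemma hardy_square_bound:
  assumes h: "h holomorphic_on disc" and B: "\<And>z. z \<in> disc \<Longrightarrow> \<bar>Im (h z)\<bar> \<le> B"
  shows "hardy_pow 2 h \<le> ennreal ((norm (h 0))\<^sup>2 + 2 * B\<^sup>2)"
  unfolding hardy_pow_circle
proof (rule SUP_least)
  fix r :: real assume "r \<in> {0..<1}"
  then have r: "0 \<le> r" "r < 1" by auto
  have B0: "B \<ge> 0" using B[of 0] by simp
  define D where "D = (norm (h 0))\<^sup>2 + 2 * B\<^sup>2"
  have D: "D \<ge> 0" unfolding D_def by simp
  have c: "continuous_on {0..2*pi} (\<lambda>t. (norm (h (of_real r * cis t)))\<^sup>2)"
    by (intro continuous_intros continuous_on_circle holomorphic_on_imp_continuous_on h r)
  have "integral {0..2*pi} (\<lambda>t. (norm (h (of_real r * cis t)))\<^sup>2) \<le> 2 * pi * D"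
  \<comment> \<open>Cauchy's formula is used on a circle of positive radius; on the degenerate
    circle the integrand is constant.\<close>
  proof (cases "r = 0")
    case True
    then have "integral {0..2*pi} (\<lambda>t. (norm (h (of_real r * cis t)))\<^sup>2) = 2 * pi * (norm (h 0))\<^sup>2" by simp
    also have "\<dots> \<le> 2 * pi * D" unfolding D_def by (intro mult_left_mono) auto
    finally show ?thesis .
  next
    case False
    then have r0: "r > 0" using r by simp
    have "((\<lambda>t. Re ((h (of_real r * cis t))\<^sup>2)) has_integral Re (2 * of_real pi * (h 0)\<^sup>2)) {0..2*pi}"
      using has_integral_linear[OF circle_mean_square[OF h r0 r(2)] bounded_linear_Re] by (simp add: comp_def)
    moreover have "((\<lambda>t::real. 2 * B\<^sup>2) has_integral (2 * pi * (2 * B\<^sup>2))) {0..2*pi}"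
      using has_integral_const_real[of "2 * B\<^sup>2" 0 "2*pi"] by simp
    ultimately have up: "((\<lambda>t. Re ((h (of_real r * cis t))\<^sup>2) + 2 * B\<^sup>2) has_integral
        (Re (2 * of_real pi * (h 0)\<^sup>2) + 2 * pi * (2 * B\<^sup>2))) {0..2*pi}"
      by (rule has_integral_add)
    have "integral {0..2*pi} (\<lambda>t. (norm (h (of_real r * cis t)))\<^sup>2)
      \<le> integral {0..2*pi} (\<lambda>t. Re ((h (of_real r * cis t))\<^sup>2) + 2 * B\<^sup>2)"
    proof (rule integral_le)
      fix t
      let ?w = "h (of_real r * cis t)"
      have "of_real r * cis t \<in> disc" using r by (simp add: norm_mult)
      from B[OF this] have "(Im ?w)\<^sup>2 \<le> B\<^sup>2" using B0 by (simp add: abs_le_square_iff[symmetric])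
      moreover have "(norm ?w)\<^sup>2 = Re (?w\<^sup>2) + 2 * (Im ?w)\<^sup>2" unfolding cmod_power2 by (simp add: power2_eq_square)
      ultimately show "(norm ?w)\<^sup>2 \<le> Re (?w\<^sup>2) + 2 * B\<^sup>2" by simp
    qed (use c up in \<open>auto intro: integrable_continuous_interval\<close>)
    also have "\<dots> = Re (2 * of_real pi * (h 0)\<^sup>2) + 2 * pi * (2 * B\<^sup>2)" by (rule integral_unique[OF up])
    also have "Re (2 * of_real pi * (h 0)\<^sup>2) \<le> norm (2 * of_real pi * (h 0)\<^sup>2)" by (rule complex_Re_le_cmod)
    also have "norm (2 * of_real pi * (h 0)\<^sup>2) = 2 * pi * (norm (h 0))\<^sup>2" by (simp add: norm_mult norm_power)
    finally show ?thesis unfolding D_def by (simp add: algebra_simps)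
  qed
  moreover have "circle_int 2 h r = ennreal (integral {0..2*pi} (\<lambda>t. (norm (h (of_real r * cis t)))\<^sup>2))"
    unfolding circle_int_def using nn_integral_interval_eq_integral[OF c] by simp
  ultimately have "ennreal (1 / (2*pi)) * circle_int 2 h r \<le> ennreal (1 / (2*pi)) * ennreal (2 * pi * D)"
    by (intro mult_left_mono) (auto intro: ennreal_leI)
  also have "\<dots> = ennreal D" using D by (simp add: ennreal_mult'[symmetric])
  finally show "ennreal (1 / (2*pi)) * circle_int 2 h r \<le> ennreal ((norm (h 0))\<^sup>2 + 2 * B\<^sup>2)" unfolding D_def .
qed

lemma mobius_disc:
  assumes a: "a \<in> disc" and z: "z \<in> disc"
  shows "mobius a z \<in> disc" "1 - cnj a * z \<noteq> 0"
proof -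
  show "1 - cnj a * z \<noteq> 0"
  proof
    assume "1 - cnj a * z = 0"
    then have "norm (cnj a * z) = 1" by (metis eq_iff_diff_eq_0 norm_one)
    moreover have "norm (cnj a * z) \<le> norm a" using z by (simp add: norm_mult mult_left_le)
    ultimately show False using a by simp
  qed
  have "norm (Moebius_function 0 a z) < 1" using Moebius_function_norm_lt_1[of a z 0] a z by simp
  moreover have "norm (mobius a z) = norm (Moebius_function 0 a z)"
    unfolding mobius_def Moebius_function_simple by (simp add: norm_divide norm_minus_commute)
  ultimately show "mobius a z \<in> disc" by simp
qed

lemma mobius_holomorphic:
  assumes "a \<in> disc"
  shows "mobius a holomorphic_on disc"
  unfolding mobius_def[abs_def] using mobius_disc(2)[OF assms] by (intro holomorphic_intros) auto

lemma compose_mobius_holomorphic: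
  assumes f: "f holomorphic_on disc" and a: "a \<in> disc"
  shows "(\<lambda>z. f (mobius a z) - f a) holomorphic_on disc"
proof -
  have "f \<circ> mobius a holomorphic_on disc"
    by (rule holomorphic_on_compose_gen[OF mobius_holomorphic[OF a] f]) (use mobius_disc(1)[OF a] in blast)
  then show ?thesis unfolding comp_def by (intro holomorphic_intros)
qed

text \<open>|Im g| < pi/2, so g composed with a Moebius map minus g a has imaginary part at most pi,
  and it vanishes at 0 because the map sends 0 to a. The resulting bound 2 pi^2 is the same for all
  a.\<close>

lemma g_fun_BMOA: "g_fun \<in> BMOA"
proof -
  have "hardy_pow 2 g_fun \<le> ennreal ((norm (g_fun 0))\<^sup>2 + 2 * (pi / 2)\<^sup>2)"
    by (rule hardy_square_bound[OF g_fun_holomorphic]) (use g_fun_Re_Im(2) in \<open>auto intro: less_imp_le\<close>)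
  then have "hardy_pow 2 g_fun < \<infinity>" by (rule le_less_trans) simp
  then have "g_fun \<in> Apa 2 (-1)" unfolding Apa_def Apa_pow_def using g_fun_holomorphic by simp
  moreover have "hardy_pow 2 (\<lambda>z. g_fun (mobius a z) - g_fun a) \<le> ennreal (2 * pi\<^sup>2)" if a: "a \<in> disc" for a
  proof -
    have "\<bar>Im (g_fun (mobius a z) - g_fun a)\<bar> \<le> pi" if z: "z \<in> disc" for z
      using g_fun_Re_Im(2)[OF mobius_disc(1)[OF a z]] g_fun_Re_Im(2)[OF a] unfolding minus_complex.sel by linarith
    from hardy_square_bound[OF compose_mobius_holomorphic[OF g_fun_holomorphic a] this]
    show ?thesis by (simp add: mobius_def)
  qed
  ultimately show ?thesis unfolding BMOA_def by blast
qed

text \<open>The function h(z) = f(mobius a z) - f(a) has h'(0) = -f'(a) (1 - |a|^2). Cauchy's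
  inequality on |z| = 1/2 bounds this by the Hardy norm of h; the radius 3/4 is the smallest that
  \<open>circle_growth\<close> admits for such z.\<close>

lemma BMOA_subset_bloch: "BMOA \<subseteq> bloch"
proof
  fix f assume "f \<in> BMOA"
  then obtain C0 :: real where f: "f holomorphic_on disc"
    and C0: "\<And>a. a \<in> disc \<Longrightarrow> hardy_pow 2 (\<lambda>z. f (mobius a z) - f a) \<le> ennreal C0"
    unfolding BMOA_def Apa_def by blast
  define C where "C = max C0 0"
  have C: "C \<ge> 0" "hardy_pow 2 (\<lambda>z. f (mobius a z) - f a) \<le> ennreal C" if "a \<in> disc" for a
    using C0[OF that] by (auto simp: C_def max_def ennreal_neg split: if_splits)
  have "(1 - (cmod a)\<^sup>2) * norm (deriv f a) \<le> 2 * sqrt (4 * pi * C)" if a: "a \<in> disc" for a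
  proof -
    define h where "h z = f (mobius a z) - f a" for z
    have h: "h holomorphic_on disc" unfolding h_def by (rule compose_mobius_holomorphic[OF f a])
    have bound: "norm (h z) \<le> sqrt (4 * pi * C)" if z: "norm z = 1/2" for z
    proof -
      have "ennreal (norm (h z) powr 2 * (1 - norm z)) \<le> circle_int 2 h (3/4)"
        by (rule circle_growth[OF h]) (use z in auto)
      also have "circle_int 2 h (3/4) = ennreal (2 * pi) * (ennreal (1 / (2 * pi)) * circle_int 2 h (3/4))"
        by (simp add: mult.assoc[symmetric] ennreal_mult[symmetric])
      also have "\<dots> \<le> ennreal (2 * pi) * hardy_pow 2 h"
        unfolding hardy_pow_circle by (intro mult_left_mono SUP_upper) auto
      also have "\<dots> \<le> ennreal (2 * pi) * ennreal C"
        using C(2)[OF a] unfolding h_def by (intro mult_left_mono) auto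
      also have "\<dots> = ennreal (2 * pi * C)" using C(1)[OF a] by (simp add: ennreal_mult)
      finally have "norm (h z) powr 2 * (1 - norm z) \<le> 2 * pi * C"
        using C(1)[OF a] by (subst (asm) ennreal_le_iff) auto
      then have "(norm (h z))\<^sup>2 \<le> 4 * pi * C" using z by simp
      then show ?thesis by (rule real_le_rsqrt)
    qed
    have "norm ((deriv ^^ 1) h 0) \<le> fact 1 * sqrt (4 * pi * C) / (1/2) ^ 1"
    proof (rule Cauchy_inequality)
      show "h holomorphic_on ball 0 (1/2)" by (rule holomorphic_on_subset[OF h]) auto
      show "continuous_on (cball 0 (1/2)) h"
        by (rule continuous_on_subset[OF holomorphic_on_imp_continuous_on[OF h]]) auto
    qed (use bound in auto)
    then have "norm (deriv h 0) \<le> 2 * sqrt (4 * pi * C)" by simp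
    moreover have "deriv h 0 = deriv f a * - (1 - of_real ((cmod a)\<^sup>2))"
    proof -
      have m: "(mobius a has_field_derivative - (1 - of_real ((cmod a)\<^sup>2))) (at 0)"
      proof -
        have "(mobius a has_field_derivative ((0 - 1) * (1 - cnj a * 0) - (a - 0) * (0 - cnj a * 1)) / ((1 - cnj a * 0) * (1 - cnj a * 0))) (at 0)"
          unfolding mobius_def[abs_def]
          by (intro DERIV_divide DERIV_diff DERIV_const DERIV_ident DERIV_cmult) simp
        then show ?thesis by (simp add: complex_norm_square[symmetric] del: of_real_power)
      qed
      have "(f has_field_derivative deriv f a) (at (mobius a 0))"
        using holomorphic_derivI[OF f open_ball a] by (simp add: mobius_def)
      from DERIV_chain2[OF this m]
      have "((\<lambda>z. f (mobius a z)) has_field_derivative deriv f a * - (1 - of_real ((cmod a)\<^sup>2))) (at 0)" .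
      from DERIV_diff[OF this DERIV_const[of "f a"]]
      have "(h has_field_derivative deriv f a * - (1 - of_real ((cmod a)\<^sup>2))) (at 0)" unfolding h_def by simp
      then show ?thesis by (rule DERIV_imp_deriv)
    qed
    moreover have "norm (1 - of_real ((cmod a)\<^sup>2) :: complex) = 1 - (cmod a)\<^sup>2"
    proof -
      have "(1 - of_real ((cmod a)\<^sup>2) :: complex) = of_real (1 - (cmod a)\<^sup>2)" by simp
      moreover have "(cmod a)\<^sup>2 \<le> 1" using a by (simp add: power_le_one)
      ultimately show ?thesis by (metis abs_of_nonneg diff_ge_0_iff_ge norm_of_real)
    qed
    ultimately have "norm (deriv f a) * (1 - (cmod a)\<^sup>2) \<le> 2 * sqrt (4 * pi * C)"
      by (simp only: norm_mult norm_minus_cancel)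
    then show ?thesis by (simp only: mult.commute)
  qed
  then show "f \<in> bloch" unfolding bloch_def using f by blast
qed

section \<open>Growth along the real axis\<close>

text \<open>The parameter s straightens the symbol: g = 1 + s, and g'(x) dx = ds, since g'(x) = exp
  s while dx = exp (-s) ds.\<close>

lemma g_fun_real_axis:
  assumes "0 \<le> s"
  defines "x \<equiv> complex_of_real (1 - exp (- s))"
  shows "x \<in> disc" "g_fun x = of_real (1 + s)" "1 - x = of_real (exp (- s))" "norm x = 1 - exp (- s)"
proof -
  have e: "exp (- s) \<le> 1" using assms by simp
  show n: "norm x = 1 - exp (- s)" unfolding x_def using e by (simp del: of_real_diff)
  then show d: "x \<in> disc" by simp
  show o: "1 - x = of_real (exp (- s))" unfolding x_def by simp
  show "g_fun x = of_real (1 + s)" unfolding g_fun_eq[OF d] o by (simp add: Ln_of_real)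
qed

text \<open>On the axis the Bloch quantity is 2 \<beta> (1 + |x|) (1 + s) powr (2 \<beta> - 1), and
  s is taken with s powr \<gamma> = |C| + 1.\<close>

lemma cpow_not_bloch:
  assumes \<beta>: "1/2 < \<beta>"
  shows "cpow_fun g_fun (of_real (2 * \<beta>)) \<notin> bloch"
proof
  assume "cpow_fun g_fun (of_real (2 * \<beta>)) \<in> bloch"
  then obtain C where C: "\<And>z. z \<in> disc \<Longrightarrow> (1 - (cmod z)\<^sup>2) * norm (deriv (cpow_fun g_fun (of_real (2 * \<beta>))) z) \<le> C"
    unfolding bloch_def by blast
  define \<gamma> where "\<gamma> = 2 * \<beta> - 1"
  have \<gamma>: "\<gamma> > 0" unfolding \<gamma>_def using \<beta> by simp
  define s where "s = (\<bar>C\<bar> + 1) powr (1 / \<gamma>)"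
  have s: "s \<ge> 0" unfolding s_def by simp
  define x where "x = complex_of_real (1 - exp (- s))"
  note ax = g_fun_real_axis[OF s, folded x_def]
  have "norm (deriv (cpow_fun g_fun (of_real (2 * \<beta>))) x) = 2 * \<beta> * (1 + s) powr \<gamma> / exp (- s)"
    unfolding deriv_cpow_g[OF ax(1)] \<gamma>_def[symmetric] norm_mult norm_divide norm_cpow_g[OF ax(1)] ax(2,3)
    using s \<beta> by (simp add: norm_mult del: of_real_add of_real_mult)
  then have "(1 - (cmod x)\<^sup>2) * (2 * \<beta> * (1 + s) powr \<gamma> / exp (- s)) \<le> C" using C[OF ax(1)] by simp
  moreover have "1 - (cmod x)\<^sup>2 = exp (- s) * (1 + cmod x)" unfolding ax(4) by (simp add: power2_eq_square algebra_simps)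
  ultimately have "(1 + cmod x) * (2 * \<beta>) * (1 + s) powr \<gamma> \<le> C" by simp
  moreover have "1 * (1 + s) powr \<gamma> \<le> ((1 + cmod x) * (2 * \<beta>)) * (1 + s) powr \<gamma>"
  proof (rule mult_right_mono)
    have "1 * 1 \<le> (1 + cmod x) * (2 * \<beta>)" using \<beta> by (intro mult_mono) auto
    then show "1 \<le> (1 + cmod x) * (2 * \<beta>)" by simp
  qed simp
  moreover have "\<bar>C\<bar> + 1 \<le> (1 + s) powr \<gamma>"
  proof -
    have "\<bar>C\<bar> + 1 = s powr \<gamma>" unfolding s_def using \<gamma> by (simp add: powr_powr)
    also have "\<dots> \<le> (1 + s) powr \<gamma>" using s \<gamma> by (intro powr_mono2) auto
    finally show ?thesis .
  qed
  ultimately show False by linarith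
qed

lemma Re_mult_of_real: "Re (z * complex_of_real r) = Re z * r"
  by simp

text \<open>Along x = 1 - exp (-s) the derivative of Re Q is Re q * exp (-s), so the difference of
  the two sides is nondecreasing. Real parts spare a proof that the functions are real on the
  axis.\<close>

lemma axis_primitive_lower_bound:
  assumes Q: "\<And>z. z \<in> disc \<Longrightarrow> (Q has_field_derivative q z) (at z)" and Q0: "Q 0 = 0"
    and low: "\<And>s. s \<ge> 0 \<Longrightarrow> Re (q (of_real (1 - exp (- s)))) * exp (- s) \<ge> c * s ^ k" and s: "s \<ge> 0"
  shows "Re (Q (of_real (1 - exp (- s)))) \<ge> c / real (k + 1) * s ^ (k + 1)"
proof -
  define \<phi> where "\<phi> s = Re (Q (of_real (1 - exp (- s)))) - c / real (k + 1) * s ^ (k + 1)" for s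
  have "\<phi> 0 \<le> \<phi> s"
  proof (rule DERIV_nonneg_imp_nondecreasing[OF s])
    fix v assume v: "0 \<le> v" "v \<le> s"
    let ?x = "complex_of_real (1 - exp (- v))"
    have "((\<lambda>v. complex_of_real (1 - exp (- v))) has_vector_derivative of_real (exp (- v))) (at v)"
      by (rule has_vector_derivative_of_real) (auto intro!: derivative_eq_intros)
    from field_vector_diff_chain_at[OF this Q[OF g_fun_real_axis(1)[OF v(1)]]]
    have "((\<lambda>v. Q (complex_of_real (1 - exp (- v)))) has_vector_derivative of_real (exp (- v)) * q ?x) (at v)"
      by (simp add: comp_def)
    then have "((\<lambda>v. Re (Q (complex_of_real (1 - exp (- v))))) has_real_derivative Re (of_real (exp (- v)) * q ?x)) (at v)"
      unfolding has_real_derivative_iff_has_vector_derivative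
      by (rule bounded_linear.has_vector_derivative[OF bounded_linear_Re])
    moreover have "((\<lambda>v. c / real (k + 1) * v ^ (k + 1)) has_real_derivative c / real (k + 1) * (real (k + 1) * v ^ k)) (at v)"
      using DERIV_cmult[OF DERIV_pow[of "k + 1" v], of "c / real (k + 1)"] by simp
    ultimately have "(\<phi> has_real_derivative (Re (of_real (exp (- v)) * q ?x) - c / real (k + 1) * (real (k + 1) * v ^ k))) (at v)"
      unfolding \<phi>_def by (rule DERIV_diff)
    moreover have "Re (of_real (exp (- v)) * q ?x) - c / real (k + 1) * (real (k + 1) * v ^ k) \<ge> 0"
      using low[OF v(1)] by (simp add: mult.commute)
    ultimately show "\<exists>d. (\<phi> has_real_derivative d) (at v) \<and> 0 \<le> d" by blast
  qed
  then show ?thesis unfolding \<phi>_def using Q0 by simp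
qed

text \<open>The power rises by 3: one for each of two integrations and one from the factor g = 1 + s
  \<ge> s in the outer one. The divisors are the exponents after each integration.\<close>

lemma STT_g_lower_bound:
  assumes f: "f holomorphic_on disc" and c: "c \<ge> 0"
    and low: "\<And>s. s \<ge> 0 \<Longrightarrow> Re (f (of_real (1 - exp (- s)))) \<ge> c * s ^ k" and s: "s \<ge> 0"
  shows "Re (STT g_fun f (of_real (1 - exp (- s)))) \<ge> c / (real (k + 1) * real (k + 3)) * s ^ (k + 3)"
proof -
  let ?x = "\<lambda>s. complex_of_real (1 - exp (- s))"
  have F: "Re (T_op g_fun f (?x v)) \<ge> c / real (k + 1) * v ^ (k + 1)" if "v \<ge> 0" for v
  proof (rule axis_primitive_lower_bound[OF T_op_holomorphic(3)[OF g_fun_holomorphic f] T_op_holomorphic(2)[OF g_fun_holomorphic f] _ that])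
    fix v :: real assume v: "v \<ge> 0"
    have "f (?x v) * deriv g_fun (?x v) = f (?x v) * of_real (exp v)"
      unfolding deriv_g_fun[OF g_fun_real_axis(1)[OF v]] g_fun_real_axis(3)[OF v] by (simp add: exp_minus field_simps)
    then have "Re (f (?x v) * deriv g_fun (?x v)) = Re (f (?x v)) * exp v" by (simp only: Re_mult_of_real)
    then have "Re (f (?x v) * deriv g_fun (?x v)) * exp (- v) = Re (f (?x v))" by (simp only:) (simp add: exp_minus)
    then show "Re (f (?x v) * deriv g_fun (?x v)) * exp (- v) \<ge> c * v ^ k" using low[OF v] by simp
  qed
  have "Re (STT g_fun f (?x s)) \<ge> c / real (k + 1) / real (k + 2 + 1) * s ^ (k + 2 + 1)"
  proof (rule axis_primitive_lower_bound[OF STT_holomorphic(3)[OF g_fun_holomorphic f] STT_holomorphic(2)[OF g_fun_holomorphic f] _ s])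
    fix v :: real assume v: "v \<ge> 0"
    have "T_op g_fun f (?x v) * deriv g_fun (?x v) * g_fun (?x v) = T_op g_fun f (?x v) * of_real (exp v * (1 + v))"
      unfolding deriv_g_fun[OF g_fun_real_axis(1)[OF v]] g_fun_real_axis(2,3)[OF v] by (simp add: exp_minus field_simps)
    then have "Re (T_op g_fun f (?x v) * deriv g_fun (?x v) * g_fun (?x v)) = Re (T_op g_fun f (?x v)) * (exp v * (1 + v))"
      by (simp only: Re_mult_of_real)
    then have e: "Re (T_op g_fun f (?x v) * deriv g_fun (?x v) * g_fun (?x v)) * exp (- v) = Re (T_op g_fun f (?x v)) * (1 + v)"
      by (simp only:) (simp add: exp_minus)
    have "c / real (k + 1) * v ^ (k + 2) = c / real (k + 1) * v ^ (k + 1) * v" by simp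
    also have "\<dots> \<le> Re (T_op g_fun f (?x v)) * (1 + v)"
    proof (rule mult_mono[OF F[OF v]])
      have "0 \<le> c / real (k + 1) * v ^ (k + 1)" using c v by simp
      then show "0 \<le> Re (T_op g_fun f (?x v))" using F[OF v] by (rule order_trans)
    qed (use v in auto)
    finally show "Re (T_op g_fun f (?x v) * deriv g_fun (?x v) * g_fun (?x v)) * exp (- v) \<ge> c / real (k + 1) * v ^ (k + 2)"
      unfolding e .
  qed
  then show ?thesis by (simp add: numeral_3_eq_3 mult.commute)
qed

text \<open>Iterating on one function treats all \<alpha> and p together: the operator bound
  contributes C^n and the growth exponent N contributes exp (N n), both geometric in n, against
  (n/9) powr (p n).\<close>

lemma STT_g_unbounded:
  assumes p: "p > 0" and \<alpha>: "\<alpha> \<ge> -1"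
  shows "\<not> bounded_Apa_op p \<alpha> (STT g_fun)"
proof
  assume "bounded_Apa_op p \<alpha> (STT g_fun)"
  then obtain C0 :: real where inA: "\<And>f. f \<in> Apa p \<alpha> \<Longrightarrow> STT g_fun f \<in> Apa p \<alpha>"
    and C0: "\<And>f. f \<in> Apa p \<alpha> \<Longrightarrow> Apa_pow p \<alpha> (STT g_fun f) \<le> ennreal C0 * Apa_pow p \<alpha> f"
    unfolding bounded_Apa_op_def by blast
  define C where "C = max C0 1"
  have C: "C \<ge> 1" unfolding C_def by simp
  have one: "(\<lambda>z. 1) \<in> Apa p \<alpha>"
  proof -
    have "circle_int p (\<lambda>z. 1) r \<le> ennreal 0 * circle_int p (\<lambda>z. 1) r + ennreal 0 * circle_int p (\<lambda>z. 1) r + ennreal (2 * pi)" for r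
      unfolding circle_int_def by simp
    from Apa_pow_le_of_circle[OF _ _ _ \<alpha> this]
    have "Apa_pow p \<alpha> (\<lambda>z. 1) \<le> ennreal (2 * pi) * Apa_mass \<alpha>" by simp
    also have "\<dots> < \<infinity>" using Apa_mass_finite[OF \<alpha>] by (simp add: ennreal_mult_less_top)
    finally show ?thesis unfolding Apa_def by simp
  qed
  define A where "A = enn2real (Apa_pow p \<alpha> (\<lambda>z. 1))"
  have A: "A \<ge> 0" "Apa_pow p \<alpha> (\<lambda>z. 1) = ennreal A" unfolding A_def using one by (auto simp: Apa_def less_top)
  define L where "L n = (STT g_fun ^^ n) (\<lambda>z. 1)" for n
  have L0: "L 0 = (\<lambda>z. 1)" and LSuc: "L (Suc n) = STT g_fun (L n)" for n unfolding L_def by auto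
  have LA: "L n \<in> Apa p \<alpha> \<and> Apa_pow p \<alpha> (L n) \<le> ennreal (C ^ n * A)" for n
  proof (induction n)
    case 0 then show ?case using one A by (simp add: L0)
  next
    case (Suc n)
    have "Apa_pow p \<alpha> (L (Suc n)) \<le> ennreal C0 * Apa_pow p \<alpha> (L n)" unfolding LSuc using Suc C0 by blast
    also have "\<dots> \<le> ennreal C * ennreal (C ^ n * A)" using Suc by (intro mult_mono ennreal_leI) (auto simp: C_def)
    also have "\<dots> = ennreal (C ^ Suc n * A)" using C A by (simp add: ennreal_mult'[symmetric] mult.assoc)
    finally show ?case using Suc inA by (simp add: LSuc)
  qed
  have Lhol: "L n holomorphic_on disc" for n using LA by (simp add: Apa_def)
  have low: "\<And>s. s \<ge> 0 \<Longrightarrow> Re (L n (of_real (1 - exp (- s)))) \<ge> 1 / (9 ^ n * (fact n)\<^sup>2) * s ^ (3 * n)" for n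
  proof (induction n)
    case 0 then show ?case by (simp add: L0)
  next
    case (Suc n)
    let ?c = "1 / (9 ^ n * (fact n)\<^sup>2) :: real"
    have "?c / (real (3 * n + 1) * real (3 * n + 3)) * s ^ (3 * n + 3) \<le> Re (L (Suc n) (of_real (1 - exp (- s))))"
      unfolding LSuc by (rule STT_g_lower_bound[OF Lhol _ Suc.IH Suc.prems]) simp
    moreover have "1 / (9 ^ Suc n * (fact (Suc n))\<^sup>2) * s ^ (3 * Suc n) \<le> ?c / (real (3 * n + 1) * real (3 * n + 3)) * s ^ (3 * n + 3)"
    proof -
      \<comment> \<open>With k = 3 n the new divisors are 3 n + 1 and 3 n + 3; this is the source of
        9^n (n!)^2.\<close>
      have "real (3 * n + 1) * real (3 * n + 3) \<le> 9 * (real (Suc n))\<^sup>2" by (simp add: power2_eq_square algebra_simps)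
      then have "?c / (9 * (real (Suc n))\<^sup>2) \<le> ?c / (real (3 * n + 1) * real (3 * n + 3))" by (intro divide_left_mono) auto
      moreover have "?c / (9 * (real (Suc n))\<^sup>2) = 1 / (9 ^ Suc n * (fact (Suc n))\<^sup>2)"
      proof -
        have "9 ^ Suc n * (fact (Suc n))\<^sup>2 = 9 ^ n * (fact n)\<^sup>2 * (9 * (real (Suc n))\<^sup>2)"
          by (simp add: power2_eq_square mult_ac del: of_nat_Suc)
        then show ?thesis by (simp only: divide_divide_eq_left)
      qed
      ultimately have "1 / (9 ^ Suc n * (fact (Suc n))\<^sup>2) \<le> ?c / (real (3 * n + 1) * real (3 * n + 3))" by (simp only:)
      then have "1 / (9 ^ Suc n * (fact (Suc n))\<^sup>2) * s ^ (3 * n + 3) \<le> ?c / (real (3 * n + 1) * real (3 * n + 3)) * s ^ (3 * n + 3)"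
        using Suc.prems by (intro mult_right_mono) auto
      then show ?thesis by (simp add: add.commute)
    qed
    ultimately show ?case by linarith
  qed
  obtain C1 N where C1: "C1 > 0" "N \<ge> (0::real)" and growth:
    "\<And>f z. f holomorphic_on disc \<Longrightarrow> z \<in> disc \<Longrightarrow> ennreal (norm (f z) powr p * (1 - norm z) powr N) \<le> ennreal C1 * Apa_pow p \<alpha> f"
    using Apa_growth[OF \<alpha> p] by metis
  define D where "D = C * exp N"
  have D: "D > 0" unfolding D_def using C by simp
  have main: "(real n / 9) powr (p * n) \<le> C1 * A * D ^ n" if n: "n > 0" for n
  proof -
    let ?x = "complex_of_real (1 - exp (- real n))"
    note ax = g_fun_real_axis[of "real n"]
    \<comment> \<open>At s = n the inequality n! \<le> n^n cancels two of the three factors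
      n^n.\<close>
    have "real n ^ n / 9 ^ n \<le> 1 / (9 ^ n * (fact n)\<^sup>2) * real n ^ (3 * n)"
    proof -
      have "(fact n)\<^sup>2 \<le> (real n ^ n)\<^sup>2" by (intro power_mono)
        (use fact_le_power[of n, where 'a = real] in \<open>simp_all add: of_nat_power\<close>)
      then have "real n ^ n * (fact n)\<^sup>2 \<le> real n ^ n * (real n ^ n)\<^sup>2" by (intro mult_left_mono) auto
      also have "\<dots> = real n ^ (3 * n)" by (simp add: power_mult[symmetric] power_add[symmetric])
      finally show ?thesis by (simp add: divide_simps mult_ac)
    qed
    also have "\<dots> \<le> Re (L n ?x)" using low[of "real n" n] by simp
    also have "\<dots> \<le> norm (L n ?x)" by (rule complex_Re_le_cmod)
    finally have "(real n / 9) ^ n \<le> norm (L n ?x)" by (simp add: power_divide)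
    then have "((real n / 9) ^ n) powr p \<le> norm (L n ?x) powr p" using p by (intro powr_mono2) auto
    then have "(real n / 9) powr (p * n) \<le> norm (L n ?x) powr p"
      using n by (simp add: powr_realpow[symmetric] powr_powr mult.commute)
    then have "(real n / 9) powr (p * n) * exp (- (N * n)) \<le> norm (L n ?x) powr p * (1 - norm ?x) powr N"
      using ax(4) by (intro mult_mono) (auto simp: powr_def)
    also have "\<dots> \<le> C1 * (C ^ n * A)"
    proof -
      have "ennreal (norm (L n ?x) powr p * (1 - norm ?x) powr N) \<le> ennreal C1 * Apa_pow p \<alpha> (L n)"
        by (rule growth[OF Lhol]) (use ax(1) in simp)
      also have "\<dots> \<le> ennreal C1 * ennreal (C ^ n * A)" using LA by (intro mult_left_mono) auto
      also have "\<dots> = ennreal (C1 * (C ^ n * A))" using C1 by (simp add: ennreal_mult'[symmetric])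
      finally show ?thesis using C1 C A by (subst (asm) ennreal_le_iff) auto
    qed
    finally have "(real n / 9) powr (p * n) \<le> C1 * (C ^ n * A) * exp (N * n)" by (simp add: exp_minus divide_simps)
    also have "exp (N * n) = exp N ^ n" by (simp add: exp_of_nat_mult[symmetric] mult.commute)
    finally show ?thesis unfolding D_def by (simp add: power_mult_distrib mult_ac)
  qed
  define B where "B = C1 * A"
  \<comment> \<open>(n/9) powr p \<ge> 2 D leaves 2^n \<le> B, which n \<ge> B contradicts because n
    < 2^n.\<close>
  obtain n :: nat where n: "real n \<ge> max (max 1 (9 * (2 * D) powr (1/p))) B" using real_arch_simple by blast
  have n0: "n > 0" using n by (simp add: max_def split: if_splits)
  have "2 * D \<le> (real n / 9) powr p"
  proof -
    have "(2 * D) powr (1/p) \<le> real n / 9" using n by simp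
    then have "((2 * D) powr (1/p)) powr p \<le> (real n / 9) powr p" using p by (intro powr_mono2) auto
    then show ?thesis using p D by (simp add: powr_powr)
  qed
  then have "(2 * D) ^ n \<le> ((real n / 9) powr p) ^ n" using D by (intro power_mono) auto
  also have "\<dots> = (real n / 9) powr (p * n)" using n0 by (simp add: powr_realpow[symmetric] powr_powr)
  also have "\<dots> \<le> B * D ^ n" unfolding B_def by (rule main[OF n0])
  finally have "2 ^ n * D ^ n \<le> B * D ^ n" by (simp add: power_mult_distrib)
  then have "2 ^ n \<le> B" using D by simp
  moreover have "real n < 2 ^ n" by (simp add: of_nat_less_two_power)
  moreover have "B \<le> real n" using n by simp
  ultimately show False by linarith
qed

theorem theorem1p5:
  shows "(g_fun \<in> BMOA \<and>
          (\<forall>\<alpha> p::real. \<alpha> \<ge> -1 \<and> p > 0 \<longrightarrow>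
             \<not> bounded_Apa_op p \<alpha> (\<lambda>f. S_op g_fun (T_op g_fun (T_op g_fun f)))))
       \<and> (\<forall>\<beta>::real. 1/2 < \<beta> \<and> \<beta> < 2/3 \<longrightarrow>
            cpow_fun g_fun (complex_of_real (2*\<beta>)) \<notin> bloch \<and>
            cpow_fun g_fun (complex_of_real (2*\<beta>)) \<notin> BMOA \<and>
            (\<forall>\<alpha> p::real. \<alpha> \<ge> -1 \<and> p > 0 \<longrightarrow>
               compact_Apa_op p \<alpha> (\<lambda>f. S_op (cpow_fun g_fun (complex_of_real \<beta>))
                                  (T_op (cpow_fun g_fun (complex_of_real \<beta>))
                                    (T_op (cpow_fun g_fun (complex_of_real \<beta>)) f)))))"
  using g_fun_BMOA STT_g_unbounded STT_compact cpow_not_bloch BMOA_subset_bloch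
  unfolding STT_def[abs_def] by blast

end
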